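(* Let $m,n\ge1$. The spinor representation $V_q(m,n)$ of $\mathrm{U}_q(\mathfrak{osp}(2m+1|2n),\Theta_1)$ is irreducible, with highest weight vector $|0\rangle$ of weight $$(\underbrace{-1,\dots,-1}_{m-1},\underbrace{1,\dots,1}_{n},\sqrt{-1}\,q^{1/2}).$$
   Context: $q$ is an indeterminate over $\mathbb{C}$; all algebras and vector spaces are over $\mathbb{C}(q^{1/2})$; $\sqrt{-1}\in\mathbb{C}$ is the imaginary unit. For a superalgebra, $[x]\in\mathbb{Z}_2$ denotes the parity of a homogeneous element $x$. **The quantum supergroup $\mathrm{U}_q(\mathfrak{osp}(2m+1|2n),\Theta_1)$, $\Theta_1=\{m,m+n\}$.** Let $A=(a_{ij})_{1\le i,j\le m+n}$ be given by $a_{mm}=0$ and $a_{ii}=2$ for $i\ne m$; $a_{m,m+1}=1$ and $a_{i,i+1}=-1$ for $1\le i\le m+n-1$, $i\ne m$; $a_{i+1,i}=-1$ for $1\le i\le m+n-2$; $a_{m+n,m+n-1}=-2$; all other entries $0$. Let $d_i=-1$ for $1\le i\le m$, $d_i=1$ for $m<i<m+n$, $d_{m+n}=\tfrac12$, and $q_i=q^{d_i}$. $\mathrm{U}_q(\mathfrak{osp}(2m+1|2n),\Theta_1)$ is the associative superalgebra generated by $e_i,f_i,k_i^{\pm1}$ ($1\le i\le m+n$), with $e_s,f_s$ odd for $s\in\Theta_1$ and all other generators even, subject to - $k_ik_i^{-1}=k_i^{-1}k_i=1$, $k_ik_j=k_jk_i$; - $k_ie_jk_i^{-1}=q_i^{a_{ij}}e_j$,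 $k_if_jk_i^{-1}=q_i^{-a_{ij}}f_j$; - $e_if_j-(-1)^{[e_i][f_j]}f_je_i=\delta_{ij}\dfrac{k_i-k_i^{-1}}{q-q^{-1}}$; - $e_m^2=f_m^2=0$; - $(\mathrm{Ad}_{e_i})^{1-a_{ij}}(e_j)=(\mathrm{Ad}_{f_i})^{1-a_{ij}}(f_j)=0$ for $a_{ii}\ne0$, $i\ne j$; - (when $m\ge2$) $\mathrm{Ad}_{e_m}\mathrm{Ad}_{e_{m-1}}\mathrm{Ad}_{e_m}(e_{m+1})=0$, $\mathrm{Ad}_{f_m}\mathrm{Ad}_{f_{m-1}}\mathrm{Ad}_{f_m}(f_{m+1})=0$, where, for homogeneous $x$, $\mathrm{Ad}_{e_i}(x)=e_ix-(-1)^{[e_i][x]}k_ixk_i^{-1}e_i$ and $\mathrm{Ad}_{f_i}(x)=f_ix-(-1)^{[f_i][x]}k_i^{-1}xk_if_i$. **The deformed Clifford superalgebra $\mathrm{Cl}_q(m,n)$** is the associative superalgebra generated by bosonic generators $\phi_i,\phi_i^\dagger,u_i^{\pm1}$ ($1\le i\le m$) and fermionic generators $\psi_j,\psi_j^\dagger,v_j^{\pm1}$ ($1\le j\le n$), with $\psi_j,\psi_j^\dagger$ odd and all other generators even, subject to the following relations. Fermionic: - $v_iv_j=v_jv_i$, $v_iv_i^{-1}=v_i^{-1}v_i=1$; - $v_i\psi_jv_i^{-1}=q^{\delta_{ij}}\psi_j$, $v_i\psi_j^\dagger v_i^{-1}=q^{-\delta_{ij}}\psi_j^\dagger$; - $\psi_i\psi_j+\psi_j\psi_i=\psi_i^\dagger\psi_j^\dagger+\psi_j^\dagger\psi_i^\dagger=0$;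 - $\psi_i\psi_j^\dagger+\psi_j^\dagger\psi_i=0$ for $i\ne j$; - $\psi_i\psi_i^\dagger+q\psi_i^\dagger\psi_i=v_i^{-1}$, $\psi_i\psi_i^\dagger+q^{-1}\psi_i^\dagger\psi_i=v_i$. Bosonic: - $u_iu_j=u_ju_i$, $u_iu_i^{-1}=u_i^{-1}u_i=1$; - $u_i\phi_ju_i^{-1}=q^{-\delta_{ij}}\phi_j$, $u_i\phi_j^\dagger u_i^{-1}=q^{\delta_{ij}}\phi_j^\dagger$; - $\phi_i\phi_j-\phi_j\phi_i=\phi_i^\dagger\phi_j^\dagger-\phi_j^\dagger\phi_i^\dagger=0$; - $\phi_i\phi_j^\dagger-\phi_j^\dagger\phi_i=0$ for $i\ne j$; - $\phi_i\phi_i^\dagger-q\phi_i^\dagger\phi_i=u_i^{-1}$, $\phi_i\phi_i^\dagger-q^{-1}\phi_i^\dagger\phi_i=u_i$. Moreover every bosonic generator commutes with every fermionic generator. **Fock space.** $V_q(m,n)$ is the $\mathrm{Cl}_q(m,n)$-module with basis $$|\mathbf t\rangle=(\phi_1^\dagger)^{t_1}\cdots(\phi_m^\dagger)^{t_m}(\psi_1^\dagger)^{\bar t_1}\cdots(\psi_n^\dagger)^{\bar t_n}|0\rangle,\quad \mathbf t=(t_1,\dots,t_m,\bar t_1,\dots,\bar t_n),\ t_i\in\mathbb{Z}_{\ge0},\ \bar t_j\in\{0,1\},$$ where the vacuum vector $|0\rangle$ satisfies $\phi_i|0\rangle=\psi_j|0\rangle=0$, $u_i|0\rangle=v_j|0\rangle=|0\rangle$.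 Explicitly, with $[t]_q=(q^t-q^{-t})/(q-q^{-1})$ and $\mathbf e_i$ the $i$-th unit vector: $u_i|\mathbf t\rangle=q^{t_i}|\mathbf t\rangle$, $\phi_i|\mathbf t\rangle=[t_i]_q|\mathbf t-\mathbf e_i\rangle$, $\phi_i^\dagger|\mathbf t\rangle=|\mathbf t+\mathbf e_i\rangle$, $v_j|\mathbf t\rangle=q^{-\bar t_j}|\mathbf t\rangle$, $\psi_j|\mathbf t\rangle=(-1)^{\bar t_1+\cdots+\bar t_{j-1}}|\mathbf t-\mathbf e_{m+j}\rangle$, $\psi_j^\dagger|\mathbf t\rangle=(-1)^{\bar t_1+\cdots+\bar t_{j-1}}|\mathbf t+\mathbf e_{m+j}\rangle$, where $|\mathbf t\pm\mathbf e_{m+j}\rangle=0$ if $\bar t_j\pm1\notin\{0,1\}$. **Spinor representation.** $V_q(m,n)$ is made into a $\mathrm{U}_q(\mathfrak{osp}(2m+1|2n),\Theta_1)$-module through the algebra homomorphism $\pi$ to $\mathrm{Cl}_q(m,n)$ with - $e_i\mapsto\phi_i\phi_{i+1}^\dagger$, $f_i\mapsto\phi_{i+1}\phi_i^\dagger$, $k_i\mapsto-u_iu_{i+1}^{-1}$ for $1\le i\le m-1$; - $e_m\mapsto\phi_m\psi_1^\dagger$, $f_m\mapsto\phi_m^\dagger\psi_1$, $k_m\mapsto u_mv_1^{-1}$; - $e_{m+j}\mapsto\psi_j\psi_{j+1}^\dagger$, $f_{m+j}\mapsto\psi_{j+1}\psi_j^\dagger$, $k_{m+j}\mapsto v_jv_{j+1}^{-1}$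 for $1\le j\le n-1$; - $e_{m+n}\mapsto\sqrt{-1}(q^{1/2}-q^{-1/2})^{-1}\psi_n$, $f_{m+n}\mapsto\psi_n^\dagger$, $k_{m+n}\mapsto\sqrt{-1}q^{1/2}v_n$. A highest weight vector of weight $(\lambda_1,\dots,\lambda_{m+n})$ is a nonzero vector $w$ with $e_iw=0$ and $k_iw=\lambda_iw$ for all $i$. *)

theory Defs
  imports
    "HOL-Library.Poly_Mapping"
    "HOL-Computational_Algebra.Polynomial"
    "HOL-Computational_Algebra.Fraction_Field"
    "HOL-Algebra.QuotRing"
    "HOL-Algebra.Module"
begin

section \<open>The ground field \<open>\<complex>(q\<^bsup>1/2\<^esup>)\<close>\<close>

text \<open>Rational functions over the complex numbers; the polynomial variable is \<open>q\<^bsup>1/2\<^esup>\<close>.\<close>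

type_synonym Cq = "complex poly fract"

definition cst :: "complex \<Rightarrow> Cq" where
  "cst c = Fract [:c:] 1"

definition qhalf :: Cq where
  "qhalf = Fract [:0, 1:] 1"

definition qq :: Cq where
  "qq = qhalf ^ 2"

definition sqrt_neg1 :: Cq where
  "sqrt_neg1 = cst \<i>"

definition qnum :: "nat \<Rightarrow> Cq" where
  "qnum t = (qq ^ t - inverse qq ^ t) / (qq - inverse qq)"


section \<open>Algebras presented by generators and relations\<close>

text \<open>
  Words in the generators form the free monoid, written additively so that finitely supported
  functions on words carry the convolution product of \<^theory>\<open>HOL-Library.Poly_Mapping\<close>: this is
  the product of the free associative algebra.
\<close>

datatype 'g word = Word (letters: "'g list")

instantiation word :: (type) monoid_add
begin

definition zero_word :: "'g word" where
  "zero_word = Word []"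

definition plus_word :: "'g word \<Rightarrow> 'g word \<Rightarrow> 'g word" where
  "plus_word v w = Word (letters v @ letters w)"

instance
  by standard (simp_all add: zero_word_def plus_word_def)

end

definition gen :: "'g \<Rightarrow> ('g word \<Rightarrow>\<^sub>0 'k::field)" where
  "gen g = Poly_Mapping.single (Word [g]) 1"

text \<open>Scalar multiplication, used both for free algebras and for the Fock space.\<close>

definition smul :: "'k::field \<Rightarrow> ('b \<Rightarrow>\<^sub>0 'k) \<Rightarrow> ('b \<Rightarrow>\<^sub>0 'k)" where
  "smul c v = Poly_Mapping.map ((*) c) v"

text \<open>The free associative algebra on the generators in \<open>G\<close>.\<close>

definition free_algebra :: "'g set \<Rightarrow> ('k::field, 'g word \<Rightarrow>\<^sub>0 'k) module" where
  "free_algebra G =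
     \<lparr>carrier = {x. \<forall>w \<in> Poly_Mapping.keys x. set (letters w) \<subseteq> G},
      mult = (*), one = 1, zero = 0, add = (+), smult = smul\<rparr>"

text \<open>Relations \<open>l = r\<close> are given as the elements \<open>l - r\<close>; \<open>rel_class G R x\<close> is the class of \<open>x\<close>
  modulo the two-sided ideal they generate.\<close>

definition rel_class ::
    "'g set \<Rightarrow> ('g word \<Rightarrow>\<^sub>0 'k::field) set \<Rightarrow> ('g word \<Rightarrow>\<^sub>0 'k) \<Rightarrow> ('g word \<Rightarrow>\<^sub>0 'k) set" where
  "rel_class G R x =
     (Idl\<^bsub>free_algebra G\<^esub> R) +>\<^bsub>free_algebra G\<^esub> x"

definition presented_algebra ::
    "'g set \<Rightarrow> ('g word \<Rightarrow>\<^sub>0 'k::field) set \<Rightarrow> ('k, ('g word \<Rightarrow>\<^sub>0 'k) set) module" where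
  "presented_algebra G R =
     ring.extend (free_algebra G Quot (Idl\<^bsub>free_algebra G\<^esub> R))
       (module.fields (\<lambda>c X. \<Union>x\<in>X. rel_class G R (smul c x)))"

text \<open>Extension of a map on generators to an algebra homomorphism between free algebras.\<close>

definition free_lift ::
    "('g \<Rightarrow> ('h word \<Rightarrow>\<^sub>0 'k::field)) \<Rightarrow> ('g word \<Rightarrow>\<^sub>0 'k) \<Rightarrow> ('h word \<Rightarrow>\<^sub>0 'k)" where
  "free_lift h x =
     (\<Sum>w \<in> Poly_Mapping.keys x. smul (Poly_Mapping.lookup x w) (prod_list (map h (letters w))))"

definition linear_ext ::
    "('b \<Rightarrow> ('c \<Rightarrow>\<^sub>0 'k::field)) \<Rightarrow> ('b \<Rightarrow>\<^sub>0 'k) \<Rightarrow> ('c \<Rightarrow>\<^sub>0 'k)" where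
  "linear_ext h v = (\<Sum>b \<in> Poly_Mapping.keys v. smul (Poly_Mapping.lookup v b) (h b))"

text \<open>Action of the free algebra on a vector space with basis \<open>'b\<close>, from the action of each
  generator on each basis vector; the rightmost letter of a word acts first.\<close>

definition free_action ::
    "('g \<Rightarrow> 'b \<Rightarrow> ('b \<Rightarrow>\<^sub>0 'k::field)) \<Rightarrow> ('g word \<Rightarrow>\<^sub>0 'k) \<Rightarrow> ('b \<Rightarrow>\<^sub>0 'k) \<Rightarrow> ('b \<Rightarrow>\<^sub>0 'k)" where
  "free_action h x v =
     (\<Sum>w \<in> Poly_Mapping.keys x.
        smul (Poly_Mapping.lookup x w) (foldr (\<lambda>g. linear_ext (h g)) (letters w) v))"

text \<open>Parity in a free superalgebra, with \<open>p g \<in> {0, 1}\<close> the parity of the generator \<open>g\<close>.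
  The value of \<open>parity\<close> is meaningful on homogeneous elements only.\<close>

definition homogeneous :: "('g \<Rightarrow> nat) \<Rightarrow> nat \<Rightarrow> ('g word \<Rightarrow>\<^sub>0 'k::field) \<Rightarrow> bool" where
  "homogeneous p d x \<longleftrightarrow>
     (\<forall>w \<in> Poly_Mapping.keys x. sum_list (map p (letters w)) mod 2 = d)"

definition parity :: "('g \<Rightarrow> nat) \<Rightarrow> ('g word \<Rightarrow>\<^sub>0 'k::field) \<Rightarrow> nat" where
  "parity p x = (if homogeneous p 0 x then 0 else 1)"


section \<open>Modules over an associative algebra\<close>

definition is_alg_module ::
    "('k::field, 'a) module \<Rightarrow> ('b \<Rightarrow>\<^sub>0 'k) set \<Rightarrow> ('a \<Rightarrow> ('b \<Rightarrow>\<^sub>0 'k) \<Rightarrow> ('b \<Rightarrow>\<^sub>0 'k)) \<Rightarrow> bool" where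
  "is_alg_module A V act \<longleftrightarrow>
     0 \<in> V \<and> (\<forall>v\<in>V. \<forall>w\<in>V. v + w \<in> V) \<and> (\<forall>c. \<forall>v\<in>V. smul c v \<in> V) \<and>
     (\<forall>a\<in>carrier A. \<forall>v\<in>V. act a v \<in> V) \<and>
     (\<forall>a\<in>carrier A. \<forall>v\<in>V. \<forall>w\<in>V. act a (v + w) = act a v + act a w) \<and>
     (\<forall>a\<in>carrier A. \<forall>c. \<forall>v\<in>V. act a (smul c v) = smul c (act a v)) \<and>
     (\<forall>a\<in>carrier A. \<forall>b\<in>carrier A. \<forall>v\<in>V. act (a \<oplus>\<^bsub>A\<^esub> b) v = act a v + act b v) \<and>
     (\<forall>c. \<forall>a\<in>carrier A. \<forall>v\<in>V. act (c \<odot>\<^bsub>A\<^esub> a) v = smul c (act a v)) \<and>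
     (\<forall>a\<in>carrier A. \<forall>b\<in>carrier A. \<forall>v\<in>V. act (a \<otimes>\<^bsub>A\<^esub> b) v = act a (act b v)) \<and>
     (\<forall>v\<in>V. act \<one>\<^bsub>A\<^esub> v = v)"

definition irreducible_module ::
    "('k::field, 'a) module \<Rightarrow> ('b \<Rightarrow>\<^sub>0 'k) set \<Rightarrow> ('a \<Rightarrow> ('b \<Rightarrow>\<^sub>0 'k) \<Rightarrow> ('b \<Rightarrow>\<^sub>0 'k)) \<Rightarrow> bool" where
  "irreducible_module A V act \<longleftrightarrow>
     is_alg_module A V act \<and> V \<noteq> {0} \<and>
     (\<forall>W \<subseteq> V. is_alg_module A W act \<longrightarrow> W = {0} \<or> W = V)"


section \<open>The quantum supergroup\<close>

datatype uq_gen = GE nat | GF nat | GK nat | GKinv nat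

abbreviation uE :: "nat \<Rightarrow> (uq_gen word \<Rightarrow>\<^sub>0 Cq)" where "uE i \<equiv> gen (GE i)"
abbreviation uF :: "nat \<Rightarrow> (uq_gen word \<Rightarrow>\<^sub>0 Cq)" where "uF i \<equiv> gen (GF i)"
abbreviation uK :: "nat \<Rightarrow> (uq_gen word \<Rightarrow>\<^sub>0 Cq)" where "uK i \<equiv> gen (GK i)"
abbreviation uKinv :: "nat \<Rightarrow> (uq_gen word \<Rightarrow>\<^sub>0 Cq)" where "uKinv i \<equiv> gen (GKinv i)"

definition uq_gens :: "nat \<Rightarrow> nat \<Rightarrow> uq_gen set" where
  "uq_gens m n = (\<Union>i\<in>{1..m+n}. {GE i, GF i, GK i, GKinv i})"

text \<open>Meaningful only for indices in \<open>{1..m+n}\<close>.\<close>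

definition cartan :: "nat \<Rightarrow> nat \<Rightarrow> nat \<Rightarrow> nat \<Rightarrow> int" where
  "cartan m n i j =
     (if i = j then (if i = m then 0 else 2)
      else if j = i + 1 then (if i = m then 1 else -1)
      else if i = j + 1 then (if i = m + n then -2 else -1)
      else 0)"

text \<open>\<open>q\<^sub>i = q\<^bsup>d\<^sub>i\<^esup>\<close> with \<open>d\<^sub>i = -1\<close> for \<open>i \<le> m\<close>, \<open>d\<^sub>i = 1\<close> for \<open>m < i < m + n\<close>, and \<open>1/2\<close> for
  \<open>i = m + n\<close>.\<close>

definition qi :: "nat \<Rightarrow> nat \<Rightarrow> nat \<Rightarrow> Cq" where
  "qi m n i = (if i \<le> m then inverse qq else if i < m + n then qq else qhalf)"

definition theta1 :: "nat \<Rightarrow> nat \<Rightarrow> nat set" where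
  "theta1 m n = {m, m + n}"

fun uq_parity :: "nat \<Rightarrow> nat \<Rightarrow> uq_gen \<Rightarrow> nat" where
  "uq_parity m n (GE i) = (if i \<in> theta1 m n then 1 else 0)"
| "uq_parity m n (GF i) = (if i \<in> theta1 m n then 1 else 0)"
| "uq_parity m n (GK i) = 0"
| "uq_parity m n (GKinv i) = 0"

definition AdE :: "nat \<Rightarrow> nat \<Rightarrow> nat \<Rightarrow> (uq_gen word \<Rightarrow>\<^sub>0 Cq) \<Rightarrow> (uq_gen word \<Rightarrow>\<^sub>0 Cq)" where
  "AdE m n i x =
     uE i * x - (-1) ^ (uq_parity m n (GE i) * parity (uq_parity m n) x) * (uK i * x * uKinv i * uE i)"

definition AdF :: "nat \<Rightarrow> nat \<Rightarrow> nat \<Rightarrow> (uq_gen word \<Rightarrow>\<^sub>0 Cq) \<Rightarrow> (uq_gen word \<Rightarrow>\<^sub>0 Cq)" where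
  "AdF m n i x =
     uF i * x - (-1) ^ (uq_parity m n (GF i) * parity (uq_parity m n) x) * (uKinv i * x * uK i * uF i)"

definition uq_relators :: "nat \<Rightarrow> nat \<Rightarrow> (uq_gen word \<Rightarrow>\<^sub>0 Cq) set" where
  "uq_relators m n =
     (\<Union>i\<in>{1..m+n}. {uK i * uKinv i - 1, uKinv i * uK i - 1}) \<union>
     (\<Union>i\<in>{1..m+n}. \<Union>j\<in>{1..m+n}.
        {uK i * uK j - uK j * uK i,
         uK i * uE j * uKinv i - smul (qi m n i powi cartan m n i j) (uE j),
         uK i * uF j * uKinv i - smul (qi m n i powi (- cartan m n i j)) (uF j),
         uE i * uF j - (-1) ^ (uq_parity m n (GE i) * uq_parity m n (GF j)) * (uF j * uE i)
           - (if i = j then smul (1 / (qq - inverse qq)) (uK i - uKinv i) else 0)}) \<union>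
     {uE m * uE m, uF m * uF m} \<union>
     (\<Union>i\<in>{i\<in>{1..m+n}. cartan m n i i \<noteq> 0}. \<Union>j\<in>{1..m+n} - {i}.
        {(AdE m n i ^^ nat (1 - cartan m n i j)) (uE j),
         (AdF m n i ^^ nat (1 - cartan m n i j)) (uF j)}) \<union>
     (if m \<ge> 2 then
        {AdE m n m (AdE m n (m - 1) (AdE m n m (uE (m + 1)))),
         AdF m n m (AdF m n (m - 1) (AdF m n m (uF (m + 1))))}
      else {})"

text \<open>\<open>U\<^sub>q(osp(2m+1|2n), \<Theta>\<^sub>1)\<close> as an associative algebra; its \<open>\<int>\<^sub>2\<close>-grading is induced by
  \<^const>\<open>uq_parity\<close>.\<close>

definition Uq_osp :: "nat \<Rightarrow> nat \<Rightarrow> (Cq, (uq_gen word \<Rightarrow>\<^sub>0 Cq) set) module" where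
  "Uq_osp m n = presented_algebra (uq_gens m n) (uq_relators m n)"

definition uq_class :: "nat \<Rightarrow> nat \<Rightarrow> (uq_gen word \<Rightarrow>\<^sub>0 Cq) \<Rightarrow> (uq_gen word \<Rightarrow>\<^sub>0 Cq) set" where
  "uq_class m n = rel_class (uq_gens m n) (uq_relators m n)"


section \<open>The deformed Clifford superalgebra\<close>

datatype cl_gen =
  GPhi nat | GPhiD nat | GU nat | GUinv nat | GPsi nat | GPsiD nat | GV nat | GVinv nat

abbreviation cPhi :: "nat \<Rightarrow> (cl_gen word \<Rightarrow>\<^sub>0 Cq)" where "cPhi i \<equiv> gen (GPhi i)"
abbreviation cPhiD :: "nat \<Rightarrow> (cl_gen word \<Rightarrow>\<^sub>0 Cq)" where "cPhiD i \<equiv> gen (GPhiD i)"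
abbreviation cU :: "nat \<Rightarrow> (cl_gen word \<Rightarrow>\<^sub>0 Cq)" where "cU i \<equiv> gen (GU i)"
abbreviation cUinv :: "nat \<Rightarrow> (cl_gen word \<Rightarrow>\<^sub>0 Cq)" where "cUinv i \<equiv> gen (GUinv i)"
abbreviation cPsi :: "nat \<Rightarrow> (cl_gen word \<Rightarrow>\<^sub>0 Cq)" where "cPsi j \<equiv> gen (GPsi j)"
abbreviation cPsiD :: "nat \<Rightarrow> (cl_gen word \<Rightarrow>\<^sub>0 Cq)" where "cPsiD j \<equiv> gen (GPsiD j)"
abbreviation cV :: "nat \<Rightarrow> (cl_gen word \<Rightarrow>\<^sub>0 Cq)" where "cV j \<equiv> gen (GV j)"
abbreviation cVinv :: "nat \<Rightarrow> (cl_gen word \<Rightarrow>\<^sub>0 Cq)" where "cVinv j \<equiv> gen (GVinv j)"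

definition bos_gens :: "nat \<Rightarrow> cl_gen set" where
  "bos_gens m = (\<Union>i\<in>{1..m}. {GPhi i, GPhiD i, GU i, GUinv i})"

definition ferm_gens :: "nat \<Rightarrow> cl_gen set" where
  "ferm_gens n = (\<Union>j\<in>{1..n}. {GPsi j, GPsiD j, GV j, GVinv j})"

definition ferm_relators :: "nat \<Rightarrow> (cl_gen word \<Rightarrow>\<^sub>0 Cq) set" where
  "ferm_relators n =
     (\<Union>i\<in>{1..n}.
        {cV i * cVinv i - 1,
         cVinv i * cV i - 1,
         cPsi i * cPsiD i + smul qq (cPsiD i * cPsi i) - cVinv i,
         cPsi i * cPsiD i + smul (inverse qq) (cPsiD i * cPsi i) - cV i}) \<union>
     (\<Union>i\<in>{1..n}. \<Union>j\<in>{1..n}.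
        {cV i * cV j - cV j * cV i,
         cV i * cPsi j * cVinv i - smul (if i = j then qq else 1) (cPsi j),
         cV i * cPsiD j * cVinv i - smul (if i = j then inverse qq else 1) (cPsiD j),
         cPsi i * cPsi j + cPsi j * cPsi i,
         cPsiD i * cPsiD j + cPsiD j * cPsiD i}) \<union>
     (\<Union>i\<in>{1..n}. \<Union>j\<in>{1..n} - {i}. {cPsi i * cPsiD j + cPsiD j * cPsi i})"

definition bos_relators :: "nat \<Rightarrow> (cl_gen word \<Rightarrow>\<^sub>0 Cq) set" where
  "bos_relators m =
     (\<Union>i\<in>{1..m}.
        {cU i * cUinv i - 1,
         cUinv i * cU i - 1,
         cPhi i * cPhiD i - smul qq (cPhiD i * cPhi i) - cUinv i,
         cPhi i * cPhiD i - smul (inverse qq) (cPhiD i * cPhi i) - cU i}) \<union>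
     (\<Union>i\<in>{1..m}. \<Union>j\<in>{1..m}.
        {cU i * cU j - cU j * cU i,
         cU i * cPhi j * cUinv i - smul (if i = j then inverse qq else 1) (cPhi j),
         cU i * cPhiD j * cUinv i - smul (if i = j then qq else 1) (cPhiD j),
         cPhi i * cPhi j - cPhi j * cPhi i,
         cPhiD i * cPhiD j - cPhiD j * cPhiD i}) \<union>
     (\<Union>i\<in>{1..m}. \<Union>j\<in>{1..m} - {i}. {cPhi i * cPhiD j - cPhiD j * cPhi i})"

definition cl_relators :: "nat \<Rightarrow> nat \<Rightarrow> (cl_gen word \<Rightarrow>\<^sub>0 Cq) set" where
  "cl_relators m n =
     ferm_relators n \<union> bos_relators m \<union>
     (\<Union>b\<in>bos_gens m. \<Union>f\<in>ferm_gens n. {gen b * gen f - gen f * gen b})"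

definition Cl_q :: "nat \<Rightarrow> nat \<Rightarrow> (Cq, (cl_gen word \<Rightarrow>\<^sub>0 Cq) set) module" where
  "Cl_q m n = presented_algebra (bos_gens m \<union> ferm_gens n) (cl_relators m n)"

definition cl_class :: "nat \<Rightarrow> nat \<Rightarrow> (cl_gen word \<Rightarrow>\<^sub>0 Cq) \<Rightarrow> (cl_gen word \<Rightarrow>\<^sub>0 Cq) set" where
  "cl_class m n = rel_class (bos_gens m \<union> ferm_gens n) (cl_relators m n)"


section \<open>Fock space\<close>

text \<open>A tuple \<open>(t\<^sub>1, \<dots>, t\<^sub>m, \<tau>\<^sub>1, \<dots>, \<tau>\<^sub>n)\<close> is a function \<open>t\<close> supported on \<open>{1..m+n}\<close>, the fermionic
  entry \<open>\<tau>\<^sub>j\<close> being \<open>t (m + j)\<close>.\<close>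

definition fock_index :: "nat \<Rightarrow> nat \<Rightarrow> (nat \<Rightarrow> nat) set" where
  "fock_index m n = {t. (\<forall>i. i \<notin> {1..m+n} \<longrightarrow> t i = 0) \<and> (\<forall>j\<in>{1..n}. t (m + j) \<in> {0, 1})}"

definition ket :: "(nat \<Rightarrow> nat) \<Rightarrow> ((nat \<Rightarrow> nat) \<Rightarrow>\<^sub>0 Cq)" where
  "ket t = Poly_Mapping.single t 1"

definition vacuum :: "(nat \<Rightarrow> nat) \<Rightarrow>\<^sub>0 Cq" where
  "vacuum = ket (\<lambda>_. 0)"

definition Fock :: "nat \<Rightarrow> nat \<Rightarrow> ((nat \<Rightarrow> nat) \<Rightarrow>\<^sub>0 Cq) set" where
  "Fock m n = {v. Poly_Mapping.keys v \<subseteq> fock_index m n}"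

definition fermion_sign :: "nat \<Rightarrow> nat \<Rightarrow> (nat \<Rightarrow> nat) \<Rightarrow> Cq" where
  "fermion_sign m j t = (-1) ^ (\<Sum>l = 1..<j. t (m + l))"

fun cl_on_ket :: "nat \<Rightarrow> cl_gen \<Rightarrow> (nat \<Rightarrow> nat) \<Rightarrow> ((nat \<Rightarrow> nat) \<Rightarrow>\<^sub>0 Cq)" where
  "cl_on_ket m (GPhi i) t = smul (qnum (t i)) (ket (t(i := t i - 1)))"
| "cl_on_ket m (GPhiD i) t = ket (t(i := t i + 1))"
| "cl_on_ket m (GU i) t = smul (qq ^ t i) (ket t)"
| "cl_on_ket m (GUinv i) t = smul (inverse (qq ^ t i)) (ket t)"
| "cl_on_ket m (GPsi j) t =
     (if t (m + j) = 1 then smul (fermion_sign m j t) (ket (t(m + j := 0))) else 0)"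
| "cl_on_ket m (GPsiD j) t =
     (if t (m + j) = 0 then smul (fermion_sign m j t) (ket (t(m + j := 1))) else 0)"
| "cl_on_ket m (GV j) t = smul (inverse (qq ^ t (m + j))) (ket t)"
| "cl_on_ket m (GVinv j) t = smul (qq ^ t (m + j)) (ket t)"

text \<open>A class acts through any of its representatives; \<^const>\<open>the_elem\<close> extracts their common
  value.\<close>

definition fock_action ::
    "nat \<Rightarrow> nat \<Rightarrow> (cl_gen word \<Rightarrow>\<^sub>0 Cq) set \<Rightarrow> ((nat \<Rightarrow> nat) \<Rightarrow>\<^sub>0 Cq) \<Rightarrow> ((nat \<Rightarrow> nat) \<Rightarrow>\<^sub>0 Cq)" where
  "fock_action m n X v = the_elem ((\<lambda>x. free_action (cl_on_ket m) x v) ` X)"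


section \<open>The spinor representation\<close>

text \<open>The images of \<open>k\<^sub>i\<^sup>-\<^sup>1\<close> are the inverses of those of \<open>k\<^sub>i\<close>.\<close>

fun spinor_gen :: "nat \<Rightarrow> nat \<Rightarrow> uq_gen \<Rightarrow> (cl_gen word \<Rightarrow>\<^sub>0 Cq)" where
  "spinor_gen m n (GE i) =
     (if i < m then cPhi i * cPhiD (i + 1)
      else if i = m then cPhi m * cPsiD 1
      else if i < m + n then cPsi (i - m) * cPsiD (i - m + 1)
      else smul (sqrt_neg1 * inverse (qhalf - inverse qhalf)) (cPsi n))"
| "spinor_gen m n (GF i) =
     (if i < m then cPhi (i + 1) * cPhiD i
      else if i = m then cPhiD m * cPsi 1
      else if i < m + n then cPsi (i - m + 1) * cPsiD (i - m)
      else cPsiD n)"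
| "spinor_gen m n (GK i) =
     (if i < m then - (cU i * cUinv (i + 1))
      else if i = m then cU m * cVinv 1
      else if i < m + n then cV (i - m) * cVinv (i - m + 1)
      else smul (sqrt_neg1 * qhalf) (cV n))"
| "spinor_gen m n (GKinv i) =
     (if i < m then - (cU (i + 1) * cUinv i)
      else if i = m then cV 1 * cUinv m
      else if i < m + n then cV (i - m + 1) * cVinv (i - m)
      else smul (inverse (sqrt_neg1 * qhalf)) (cVinv n))"

definition spinor_hom ::
    "nat \<Rightarrow> nat \<Rightarrow> (uq_gen word \<Rightarrow>\<^sub>0 Cq) set \<Rightarrow> (cl_gen word \<Rightarrow>\<^sub>0 Cq) set" where
  "spinor_hom m n X = the_elem ((\<lambda>x. cl_class m n (free_lift (spinor_gen m n) x)) ` X)"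

definition spinor_action ::
    "nat \<Rightarrow> nat \<Rightarrow> (uq_gen word \<Rightarrow>\<^sub>0 Cq) set \<Rightarrow> ((nat \<Rightarrow> nat) \<Rightarrow>\<^sub>0 Cq) \<Rightarrow> ((nat \<Rightarrow> nat) \<Rightarrow>\<^sub>0 Cq)" where
  "spinor_action m n X v = fock_action m n (spinor_hom m n X) v"

text \<open>The weight \<open>wt\<close> is the list of the eigenvalues of \<open>k\<^sub>1, \<dots>, k\<^sub>m\<^sub>+\<^sub>n\<close>.\<close>

definition highest_weight_vector ::
    "nat \<Rightarrow> nat \<Rightarrow> ((nat \<Rightarrow> nat) \<Rightarrow>\<^sub>0 Cq) set \<Rightarrow>
     ((uq_gen word \<Rightarrow>\<^sub>0 Cq) set \<Rightarrow> ((nat \<Rightarrow> nat) \<Rightarrow>\<^sub>0 Cq) \<Rightarrow> ((nat \<Rightarrow> nat) \<Rightarrow>\<^sub>0 Cq)) \<Rightarrow>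
     ((nat \<Rightarrow> nat) \<Rightarrow>\<^sub>0 Cq) \<Rightarrow> Cq list \<Rightarrow> bool" where
  "highest_weight_vector m n V act w wt \<longleftrightarrow>
     length wt = m + n \<and> w \<in> V \<and> w \<noteq> 0 \<and>
     (\<forall>i\<in>{1..m+n}. act (uq_class m n (uE i)) w = 0 \<and>
                    act (uq_class m n (uK i)) w = smul (wt ! (i - 1)) w)"

end

theory Submission
  imports Defs
begin

text \<open>
  There are two things to prove: that the images of the generators really define an action of the
  quantum supergroup on the Fock space, and that this action has no proper nonzero submodule.

  Both algebras are given by generators and relations, and a class acts through any of its
  representatives. The action is therefore meaningful only if the relations of the Clifford
  algebra vanish on the Fock space (\<open>cl_relators_annihilate\<close>), and if the map on generators sends
  every relation of the quantum supergroup into the ideal of relations of the Clifford algebra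
  (\<open>respects_relators\<close>). The second point is the computational heart. Bosons and fermions are
  treated alike, as \<open>m + n\<close> sites carrying an annihilator \<open>a p\<close>, a creator \<open>ad p\<close> and a Cartan
  element \<open>h p\<close>; letters at different sites commute up to a scalar. After adding a fictitious
  last site carrying scalars only, every simple root vector has the form \<open>E p = a p * ad (p + 1)\<close>
  or \<open>F p = a (p + 1) * ad p\<close>, and each relation holds for one of three reasons: elements that
  commute up to scalars have products that do so as well; the letters at a fermionic site square
  to zero; or two adjacent root vectors share one site, where the oscillator relation applies
  (\<open>E_F_bracket\<close>, \<open>oscillator_serre\<close>, \<open>odd_triple_serre\<close>).

  For irreducibility, the eigenvalues of the \<open>k\<^sub>i\<close> separate the basis vectors because \<open>q\<close> is
  transcendental, so a nonzero submodule contains a basis vector (\<open>contains_ket\<close>). At the last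
  occupied site \<open>p\<close> of a basis vector, \<open>e\<^sub>p\<close> moves one quantum to the next site, or out of the
  system if \<open>p = m + n\<close>, and \<open>f\<^sub>p\<close> moves it back, both with nonzero coefficients
  (\<open>spinor_op_push_quantum\<close>). Each such move brings the quanta closer to the exit, so every basis
  vector leads to the vacuum and is recovered from it. Reading off the weight of the vacuum is
  then immediate.
\<close>

section \<open>Linear combinations and the free algebra\<close>

lemma lookup_smul [simp]: "Poly_Mapping.lookup (smul c v) b = c * Poly_Mapping.lookup v b"
  unfolding smul_def by (simp add: Poly_Mapping.map.rep_eq when_def)

lemma smul_simps [simp]:
  "smul c 0 = 0" "smul 0 v = 0" "smul 1 v = v" "smul a (smul b v) = smul (a * b) v"
  "smul c (- v) = - smul c v" "smul c (Poly_Mapping.single k d) = Poly_Mapping.single k (c * d)"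
  by (auto intro!: poly_mapping_eqI simp: lookup_single when_def mult.assoc)

lemma smul_distribs:
  "smul c (v + w) = smul c v + smul c w" "smul (a + b) v = smul a v + smul b v"
  "smul c (v - w) = smul c v - smul c w"
  by (auto intro!: poly_mapping_eqI simp: lookup_add lookup_minus algebra_simps)

lemma smul_minus_one: "smul (- 1) v = - v"
  by (auto intro!: poly_mapping_eqI)

lemma smul_minus_left: "smul (- c) v = - smul c v"
  by (auto intro!: poly_mapping_eqI)

lemma smul_left_diff: "smul a v - smul b v = smul (a - b) v"
  by (auto intro!: poly_mapping_eqI simp: lookup_minus left_diff_distrib)

lemma smul_left_add: "smul a v + smul b v = smul (a + b) v"
  by (simp add: smul_distribs)

lemma smul_sum: "smul c (\<Sum>i\<in>I. f i) = (\<Sum>i\<in>I. smul c (f i))"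
  by (auto intro!: poly_mapping_eqI simp: lookup_sum sum_distrib_left)

lemma keys_smul: "Poly_Mapping.keys (smul c v) \<subseteq> Poly_Mapping.keys v"
  by (auto simp: in_keys_iff)

lemma smul_conv_mult: "smul c (x :: 'a::monoid_add \<Rightarrow>\<^sub>0 'k::field) = Poly_Mapping.single 0 c * x"
  unfolding smul_def by (rule mult_map_scale_conv_mult)

lemma sum_single_lookup:
  "(\<Sum>b\<in>Poly_Mapping.keys v. Poly_Mapping.single b (Poly_Mapping.lookup v b)) = v"
  by (rule poly_mapping_eqI) (auto simp: lookup_sum lookup_single when_def in_keys_iff)

text \<open>Every statement about elements of a free algebra or of the Fock space that is linear in the
  element is reduced to basis vectors by this rule.\<close>

lemma linear_combination_induct [consumes 1, case_names zero add single]: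
  fixes v :: "'b \<Rightarrow>\<^sub>0 'k::field"
  assumes "Poly_Mapping.keys v \<subseteq> S" and "P 0"
    and "\<And>x y. P x \<Longrightarrow> P y \<Longrightarrow> P (x + y)"
    and "\<And>b c. b \<in> S \<Longrightarrow> P (Poly_Mapping.single b c)"
  shows "P v"
proof -
  have "P (\<Sum>b\<in>B. Poly_Mapping.single b (Poly_Mapping.lookup v b))" if "finite B" "B \<subseteq> S" for B
    using that by (induction B) (auto intro: assms)
  with assms(1) have "P (\<Sum>b\<in>Poly_Mapping.keys v. Poly_Mapping.single b (Poly_Mapping.lookup v b))"
    by simp
  then show ?thesis by (simp add: sum_single_lookup)
qed

lemmas poly_mapping_induct [case_names zero add single] =
  linear_combination_induct [OF subset_UNIV]

lemma linear_ext_superset: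
  assumes "finite S" "Poly_Mapping.keys v \<subseteq> S"
  shows "linear_ext h v = (\<Sum>b\<in>S. smul (Poly_Mapping.lookup v b) (h b))"
  unfolding linear_ext_def using assms
  by (intro sum.mono_neutral_left) (auto simp: in_keys_iff)

lemma linear_ext_zero [simp]: "linear_ext h 0 = 0"
  by (simp add: linear_ext_def)

lemma linear_ext_add: "linear_ext h (v + w) = linear_ext h v + linear_ext h w"
proof -
  let ?S = "Poly_Mapping.keys v \<union> Poly_Mapping.keys w"
  have "Poly_Mapping.keys (v + w) \<subseteq> ?S"
    by (rule keys_add)
  then show ?thesis
    by (simp add: linear_ext_superset[of ?S] lookup_add smul_distribs sum.distrib)
qed

lemma linear_ext_smul: "linear_ext h (smul c v) = smul c (linear_ext h v)"
  using keys_smul[of c v]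
  by (simp add: linear_ext_superset[of "Poly_Mapping.keys v"] smul_sum)

lemma linear_ext_single [simp]: "linear_ext h (Poly_Mapping.single b c) = smul c (h b)"
  by (simp add: linear_ext_superset[of "{b}"])

lemma linear_ext_ket [simp]: "linear_ext h (ket t) = h t"
  by (simp add: ket_def)

lemma letters_simps [simp]: "letters 0 = []" "letters (v + w) = letters v @ letters w"
  by (simp_all add: zero_word_def plus_word_def)

text \<open>Lifting to the free algebra and acting by the free algebra are both linear extensions of a
  function on words, so their linearity is inherited from \<^const>\<open>linear_ext\<close>.\<close>

lemma free_lift_conv_linear_ext:
  "free_lift h = linear_ext (\<lambda>w. prod_list (map h (letters w)))"
  by (simp add: fun_eq_iff free_lift_def linear_ext_def)

lemma free_lift_simps [simp]:
  "free_lift h 0 = 0" "free_lift h (x + y) = free_lift h x + free_lift h y"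
  "free_lift h (smul c x) = smul c (free_lift h x)"
  "free_lift h (gen g) = h g" "free_lift h 1 = 1"
  by (simp_all add: free_lift_conv_linear_ext linear_ext_add linear_ext_smul gen_def)
    (simp flip: single_one)

lemma free_lift_uminus [simp]: "free_lift h (- x) = - free_lift h x"
  using free_lift_simps(3)[of h "-1" x] by (simp add: smul_minus_one del: free_lift_simps(3))

lemma free_lift_diff [simp]: "free_lift h (x - y) = free_lift h x - free_lift h y"
  using free_lift_simps(2)[of h x "- y"] by (simp del: free_lift_simps(2))

lemma smul_mult_left: "smul c x * y = smul c (x * y)"
  and smul_mult_right: "x * smul c y = smul c (x * y)"
  for x y :: "'g word \<Rightarrow>\<^sub>0 'k::field"
proof -
  show "smul c x * y = smul c (x * y)"
    by (simp add: smul_conv_mult mult.assoc)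
  have "x * Poly_Mapping.single 0 c = Poly_Mapping.single 0 c * x"
  proof (induction x rule: poly_mapping_induct)
    case (add x y)
    then show ?case by (simp only: distrib_left distrib_right)
  qed (simp_all add: mult_single mult.commute)
  then show "x * smul c y = smul c (x * y)"
    by (metis smul_conv_mult mult.assoc)
qed

lemma sign_mult: "(- 1) ^ k * x = smul ((- 1) ^ k) x" for x :: "'g word \<Rightarrow>\<^sub>0 'k::field"
  by (cases "even k") (simp_all add: smul_minus_one)

lemma free_lift_mult [simp]: "free_lift h (x * y) = free_lift h x * free_lift h y"
proof -
  have single: "free_lift h (Poly_Mapping.single v c * y) =
      free_lift h (Poly_Mapping.single v c) * free_lift h y" for v c
  proof (induction y rule: poly_mapping_induct)
    case (add x y)
    then show ?case by (simp add: distrib_left)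
  next
    case (single w d)
    show ?case
      by (simp add: mult_single free_lift_conv_linear_ext smul_mult_left smul_mult_right
        mult.commute)
  qed simp_all
  show ?thesis
    by (induction x rule: poly_mapping_induct)
      (simp_all add: distrib_right single)
qed

lemma free_action_conv_linear_ext:
  "free_action h x v = linear_ext (\<lambda>w. foldr (\<lambda>g. linear_ext (h g)) (letters w) v) x"
  by (simp add: free_action_def linear_ext_def)

lemma free_action_simps [simp]:
  "free_action h 0 v = 0" "free_action h (x + y) v = free_action h x v + free_action h y v"
  "free_action h (smul c x) v = smul c (free_action h x v)"
  "free_action h (gen g) v = linear_ext (h g) v" "free_action h 1 v = v"
  by (simp_all add: free_action_conv_linear_ext linear_ext_add linear_ext_smul gen_def)
    (simp flip: single_one)

lemma free_action_uminus [simp]: "free_action h (- x) v = - free_action h x v"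
  using free_action_simps(3)[of h "-1" x] by (simp add: smul_minus_one del: free_action_simps(3))

lemma free_action_diff [simp]: "free_action h (x - y) v = free_action h x v - free_action h y v"
  using free_action_simps(2)[of h x "- y"] by (simp del: free_action_simps(2))

lemma foldr_linear_ext:
  "foldr (\<lambda>g. linear_ext (h g)) gs 0 = 0"
  "foldr (\<lambda>g. linear_ext (h g)) gs (v + w) =
    foldr (\<lambda>g. linear_ext (h g)) gs v + foldr (\<lambda>g. linear_ext (h g)) gs w"
  "foldr (\<lambda>g. linear_ext (h g)) gs (smul c v) = smul c (foldr (\<lambda>g. linear_ext (h g)) gs v)"
  by (induction gs) (simp_all add: linear_ext_add linear_ext_smul)

lemma free_action_vec:
  "free_action h x 0 = 0" "free_action h x (v + w) = free_action h x v + free_action h x w"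
  "free_action h x (smul c v) = smul c (free_action h x v)"
  by (simp_all add: free_action_def foldr_linear_ext smul_distribs sum.distrib smul_sum
    mult.commute)

lemma free_action_mult [simp]: "free_action h (x * y) v = free_action h x (free_action h y v)"
proof -
  have single: "free_action h (Poly_Mapping.single u c * y) v =
      free_action h (Poly_Mapping.single u c) (free_action h y v)" for u c
  proof (induction y rule: poly_mapping_induct)
    case (add x y)
    then show ?case by (simp add: distrib_left free_action_vec)
  next
    case (single w d)
    show ?case
      by (simp add: mult_single free_action_conv_linear_ext foldr_linear_ext)
  qed (simp_all add: free_action_vec)
  show ?thesis
    by (induction x rule: poly_mapping_induct)
      (simp_all add: distrib_right single)
qed

lemma carrier_free_algebra:
  "carrier (free_algebra G) = {x. \<forall>w\<in>Poly_Mapping.keys x. set (letters w) \<subseteq> G}"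
  by (simp add: free_algebra_def)

lemma free_algebra_ops [simp]:
  "mult (free_algebra G) = (*)" "one (free_algebra G) = 1" "zero (free_algebra G) = 0"
  "add (free_algebra G) = (+)" "module.smult (free_algebra G) = smul"
  by (simp_all add: free_algebra_def)

lemma free_algebra_closed [simp, intro]:
  fixes x :: "'g word \<Rightarrow>\<^sub>0 'k::field"
  shows
  "(0 :: 'g word \<Rightarrow>\<^sub>0 'k) \<in> carrier (free_algebra G)"
  "(1 :: 'g word \<Rightarrow>\<^sub>0 'k) \<in> carrier (free_algebra G)"
  "x \<in> carrier (free_algebra G) \<Longrightarrow> - x \<in> carrier (free_algebra G)"
  "x \<in> carrier (free_algebra G) \<Longrightarrow> smul c x \<in> carrier (free_algebra G)"
  "x \<in> carrier (free_algebra G) \<Longrightarrow> y \<in> carrier (free_algebra G) \<Longrightarrow> x + y \<in> carrier (free_algebra G)"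
  "x \<in> carrier (free_algebra G) \<Longrightarrow> y \<in> carrier (free_algebra G) \<Longrightarrow> x * y \<in> carrier (free_algebra G)"
proof -
  let ?W = "{w. set (letters w) \<subseteq> G}"
  have carrier: "z \<in> carrier (free_algebra G) \<longleftrightarrow> Poly_Mapping.keys z \<subseteq> ?W" for z :: "'g word \<Rightarrow>\<^sub>0 'k"
    by (auto simp: carrier_free_algebra)
  show "(0 :: 'g word \<Rightarrow>\<^sub>0 'k) \<in> carrier (free_algebra G)"
    by (simp add: carrier)
  show "(1 :: 'g word \<Rightarrow>\<^sub>0 'k) \<in> carrier (free_algebra G)"
    by (simp add: carrier)
  assume x: "x \<in> carrier (free_algebra G)"
  then show smul: "smul c x \<in> carrier (free_algebra G)" for c
    using keys_smul[of c x] by (simp add: carrier)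
  show "- x \<in> carrier (free_algebra G)"
    using smul[of "-1"] by (simp add: smul_minus_one)
  assume y: "y \<in> carrier (free_algebra G)"
  show "x + y \<in> carrier (free_algebra G)"
    using x y keys_add[of x y] unfolding carrier by blast
  have "{v + w |v w. v \<in> Poly_Mapping.keys x \<and> w \<in> Poly_Mapping.keys y} \<subseteq> ?W"
    using x y unfolding carrier by fastforce
  then show "x * y \<in> carrier (free_algebra G)"
    using keys_mult[of x y] unfolding carrier by (rule subset_trans[rotated])
qed

lemma free_algebra_diff_closed [simp, intro]:
  "x \<in> carrier (free_algebra G) \<Longrightarrow> y \<in> carrier (free_algebra G) \<Longrightarrow> x - y \<in> carrier (free_algebra G)"
  using free_algebra_closed(5)[of x G "- y"] by simp

lemma gen_in_free_algebra [simp]: "gen g \<in> carrier (free_algebra G) \<longleftrightarrow> g \<in> G"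
  by (simp add: carrier_free_algebra gen_def)

lemma free_lift_in_free_algebra:
  assumes "\<And>g. g \<in> G \<Longrightarrow> h g \<in> carrier (free_algebra H)" and "x \<in> carrier (free_algebra G)"
  shows "free_lift h x \<in> carrier (free_algebra H)"
proof -
  have word: "prod_list (map h gs) \<in> carrier (free_algebra H)" if "set gs \<subseteq> G" for gs
    using that by (induction gs) (auto intro: assms)
  from assms(2) have "Poly_Mapping.keys x \<subseteq> {w. set (letters w) \<subseteq> G}"
    by (auto simp: carrier_free_algebra)
  then show ?thesis
  proof (induction rule: linear_combination_induct)
    case (single w c)
    then show ?case by (simp add: free_lift_conv_linear_ext word free_algebra_closed)
  qed auto
qed

lemma free_lift_cong:
  assumes "x \<in> carrier (free_algebra G)" and "\<And>g. g \<in> G \<Longrightarrow> h g = h' g"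
  shows "free_lift h x = free_lift h' x"
proof -
  have "prod_list (map h (letters w)) = prod_list (map h' (letters w))"
    if "w \<in> Poly_Mapping.keys x" for w
    using that assms by (intro arg_cong[of _ _ prod_list] map_cong) (auto simp:
      carrier_free_algebra)
  then show ?thesis unfolding free_lift_def by (intro sum.cong) simp_all
qed

lemma free_lift_gen_id: "free_lift gen x = x"
  for x :: "'g word \<Rightarrow>\<^sub>0 'k::field"
proof -
  have "prod_list (map gen gs) = Poly_Mapping.single (Word gs) (1 :: 'k)" for gs :: "'g list"
    by (induction gs) (simp_all add: gen_def mult_single plus_word_def flip: single_one
      zero_word_def)
  then show ?thesis
    by (simp add: free_lift_def sum_single_lookup)
qed

lemma ring_free_algebra: "ring (free_algebra G)"
proof (rule ringI)
  show "abelian_group (free_algebra G)"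
  proof (rule abelian_groupI)
    fix x assume "x \<in> carrier (free_algebra G)"
    then show "\<exists>y\<in>carrier (free_algebra G). y \<oplus>\<^bsub>free_algebra G\<^esub> x = \<zero>\<^bsub>free_algebra G\<^esub>"
      by (intro bexI[of _ "- x"]) auto
  qed (auto simp: add.assoc add.commute)
  show "Group.monoid (free_algebra G)"
    by (rule monoidI) (auto simp: mult.assoc)
qed (auto simp: distrib_left distrib_right)

lemma ideal_free_algebraI:
  assumes "I \<subseteq> carrier (free_algebra G)" "0 \<in> I"
    and "\<And>x y. x \<in> I \<Longrightarrow> y \<in> I \<Longrightarrow> x + y \<in> I"
    and "\<And>x y. x \<in> I \<Longrightarrow> y \<in> carrier (free_algebra G) \<Longrightarrow> y * x \<in> I"
    and "\<And>x y. x \<in> I \<Longrightarrow> y \<in> carrier (free_algebra G) \<Longrightarrow> x * y \<in> I"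
  shows "ideal I (free_algebra G)"
proof (rule idealI)
  show "subgroup I (add_monoid (free_algebra G))"
  proof (rule group.subgroupI)
    show "Group.group (add_monoid (free_algebra G))"
      by (rule abelian_group.a_group[OF ring.is_abelian_group[OF ring_free_algebra]])
    fix x assume x: "x \<in> I"
    then have "- x \<in> I" using assms(4)[of x "- 1"] by auto
    moreover have "inv\<^bsub>add_monoid (free_algebra G)\<^esub> x = - x"
      using x assms(1)
      by (intro group.inv_equality abelian_group.a_group[OF ring.is_abelian_group[OF
        ring_free_algebra]])
        auto
    ultimately show "inv\<^bsub>add_monoid (free_algebra G)\<^esub> x \<in> I" by simp
  qed (use assms in auto)
qed (use assms ring_free_algebra in auto)

section \<open>Presented algebras\<close>

lemma ideal_Idl: "R \<subseteq> carrier (free_algebra G) \<Longrightarrow> ideal (Idl\<^bsub>free_algebra G\<^esub> R) (free_algebra G)"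
  by (rule ring.genideal_ideal[OF ring_free_algebra])

lemma Idl_closed:
  assumes "R \<subseteq> carrier (free_algebra G)"
  shows "0 \<in> Idl\<^bsub>free_algebra G\<^esub> R"
    and "x \<in> Idl\<^bsub>free_algebra G\<^esub> R \<Longrightarrow> x \<in> carrier (free_algebra G)"
    and "x \<in> Idl\<^bsub>free_algebra G\<^esub> R \<Longrightarrow> y \<in> Idl\<^bsub>free_algebra G\<^esub> R \<Longrightarrow> x + y \<in> Idl\<^bsub>free_algebra G\<^esub> R"
    and "x \<in> Idl\<^bsub>free_algebra G\<^esub> R \<Longrightarrow> z \<in> carrier (free_algebra G) \<Longrightarrow> x * z \<in> Idl\<^bsub>free_algebra G\<^esub> R"
    and "x \<in> Idl\<^bsub>free_algebra G\<^esub> R \<Longrightarrow> z \<in> carrier (free_algebra G) \<Longrightarrow> z * x \<in> Idl\<^bsub>free_algebra G\<^esub> R"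
    and "x \<in> Idl\<^bsub>free_algebra G\<^esub> R \<Longrightarrow> smul c x \<in> Idl\<^bsub>free_algebra G\<^esub> R"
    and "x \<in> Idl\<^bsub>free_algebra G\<^esub> R \<Longrightarrow> - x \<in> Idl\<^bsub>free_algebra G\<^esub> R"
    and "x \<in> Idl\<^bsub>free_algebra G\<^esub> R \<Longrightarrow> y \<in> Idl\<^bsub>free_algebra G\<^esub> R \<Longrightarrow> x - y \<in> Idl\<^bsub>free_algebra G\<^esub> R"
proof -
  interpret ideal "Idl\<^bsub>free_algebra G\<^esub> R" "free_algebra G"
    using assms by (rule ideal_Idl)
  show "0 \<in> Idl\<^bsub>free_algebra G\<^esub> R"
    using additive_subgroup.zero_closed[OF is_additive_subgroup] by simp
  show "x \<in> Idl\<^bsub>free_algebra G\<^esub> R \<Longrightarrow> x \<in> carrier (free_algebra G)"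
    using a_subset by auto
  show add: "x \<in> Idl\<^bsub>free_algebra G\<^esub> R \<Longrightarrow> y \<in> Idl\<^bsub>free_algebra G\<^esub> R \<Longrightarrow>
    x + y \<in> Idl\<^bsub>free_algebra G\<^esub> R" for x y
    using additive_subgroup.a_closed[OF is_additive_subgroup, of x y] by simp
  show "x \<in> Idl\<^bsub>free_algebra G\<^esub> R \<Longrightarrow> z \<in> carrier (free_algebra G) \<Longrightarrow> x * z \<in> Idl\<^bsub>free_algebra G\<^esub> R"
    using I_r_closed[of x z] by simp
  show left: "x \<in> Idl\<^bsub>free_algebra G\<^esub> R \<Longrightarrow> z \<in> carrier (free_algebra G) \<Longrightarrow>
    z * x \<in> Idl\<^bsub>free_algebra G\<^esub> R" for x z
    using I_l_closed[of x z] by simp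
  show smul: "x \<in> Idl\<^bsub>free_algebra G\<^esub> R \<Longrightarrow> smul c x \<in> Idl\<^bsub>free_algebra G\<^esub> R" for x c
    using left[of x "smul c 1"] by (simp add: smul_mult_left)
  show minus: "x \<in> Idl\<^bsub>free_algebra G\<^esub> R \<Longrightarrow> - x \<in> Idl\<^bsub>free_algebra G\<^esub> R" for x
    using smul[of x "-1"] by (simp add: smul_minus_one)
  show "x \<in> Idl\<^bsub>free_algebra G\<^esub> R \<Longrightarrow> y \<in> Idl\<^bsub>free_algebra G\<^esub> R \<Longrightarrow> x - y \<in> Idl\<^bsub>free_algebra G\<^esub> R"
    using add[of x "- y"] minus[of y] by simp
qed

lemma Idl_memI: "r \<in> R \<Longrightarrow> r \<in> Idl\<^bsub>free_algebra G\<^esub> R"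
  by (auto simp: genideal_def)

lemma Idl_subsetI:
  "ideal I (free_algebra G) \<Longrightarrow> R \<subseteq> I \<Longrightarrow> Idl\<^bsub>free_algebra G\<^esub> R \<subseteq> I"
  by (rule ring.genideal_minimal[OF ring_free_algebra])

text \<open>Cosets of the ideal of relations are handled through membership of differences from here
  on; the quotient structure of the library enters only in the next few lemmas.\<close>

lemma mem_rel_class: "y \<in> rel_class G R x \<longleftrightarrow> y - x \<in> Idl\<^bsub>free_algebra G\<^esub> R"
proof -
  have "y \<in> rel_class G R x \<longleftrightarrow> (\<exists>i\<in>Idl\<^bsub>free_algebra G\<^esub> R. y = i + x)"
    by (simp add: rel_class_def a_r_coset_def')
  then show ?thesis by (metis add_diff_cancel diff_add_cancel)
qed

lemma rel_class_eq_iff: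
  assumes "R \<subseteq> carrier (free_algebra G)"
  shows "rel_class G R x = rel_class G R y \<longleftrightarrow> x - y \<in> Idl\<^bsub>free_algebra G\<^esub> R"
proof
  assume "rel_class G R x = rel_class G R y"
  moreover have "x \<in> rel_class G R x"
    by (simp add: mem_rel_class Idl_closed[OF assms])
  ultimately show "x - y \<in> Idl\<^bsub>free_algebra G\<^esub> R"
    by (simp add: mem_rel_class)
next
  assume xy: "x - y \<in> Idl\<^bsub>free_algebra G\<^esub> R"
  have "z - x \<in> Idl\<^bsub>free_algebra G\<^esub> R \<longleftrightarrow> z - y \<in> Idl\<^bsub>free_algebra G\<^esub> R" for z
    using Idl_closed(3)[OF assms xy, of "z - x"] Idl_closed(8)[OF assms _ xy, of "z - y"]
    by (auto simp: algebra_simps)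
  then show "rel_class G R x = rel_class G R y"
    by (auto simp: mem_rel_class)
qed

text \<open>The form in which \<^const>\<open>the_elem\<close> is evaluated: a function that does not see the ideal can be
  computed on any representative.\<close>

lemma the_elem_rel_class:
  assumes "R \<subseteq> carrier (free_algebra G)"
    and "\<And>y. y - x \<in> Idl\<^bsub>free_algebra G\<^esub> R \<Longrightarrow> f y = f x"
  shows "the_elem (f ` rel_class G R x) = f x"
proof (rule the_elem_image_unique)
  show "rel_class G R x \<noteq> {}"
    using Idl_closed(1)[OF assms(1)] mem_rel_class[of x G R x] by auto
qed (auto simp: mem_rel_class assms)

lemma
  assumes "R \<subseteq> carrier (free_algebra G)"
  shows carrier_presented_algebra:
      "carrier (presented_algebra G R) = rel_class G R ` carrier (free_algebra G)"
    and presented_algebra_mult: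
      "x \<in> carrier (free_algebra G) \<Longrightarrow> y \<in> carrier (free_algebra G) \<Longrightarrow>
       rel_class G R x \<otimes>\<^bsub>presented_algebra G R\<^esub> rel_class G R y = rel_class G R (x * y)"
    and presented_algebra_add:
      "x \<in> carrier (free_algebra G) \<Longrightarrow> y \<in> carrier (free_algebra G) \<Longrightarrow>
       rel_class G R x \<oplus>\<^bsub>presented_algebra G R\<^esub> rel_class G R y = rel_class G R (x + y)"
    and presented_algebra_one: "\<one>\<^bsub>presented_algebra G R\<^esub> = rel_class G R 1"
    and presented_algebra_smult:
      "c \<odot>\<^bsub>presented_algebra G R\<^esub> rel_class G R x = rel_class G R (smul c x)"
proof -
  interpret ideal "Idl\<^bsub>free_algebra G\<^esub> R" "free_algebra G"
    using assms by (rule ideal_Idl)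
  show "carrier (presented_algebra G R) = rel_class G R ` carrier (free_algebra G)"
    by (auto simp: presented_algebra_def ring.defs FactRing_def A_RCOSETS_def' rel_class_def)
  show "rel_class G R x \<otimes>\<^bsub>presented_algebra G R\<^esub> rel_class G R y = rel_class G R (x * y)"
    if "x \<in> carrier (free_algebra G)" "y \<in> carrier (free_algebra G)"
    using rcoset_mult_add[OF that]
    by (simp add: presented_algebra_def ring.defs FactRing_def rel_class_def)
  show "rel_class G R x \<oplus>\<^bsub>presented_algebra G R\<^esub> rel_class G R y = rel_class G R (x + y)"
    if "x \<in> carrier (free_algebra G)" "y \<in> carrier (free_algebra G)"
    using a_rcos_sum[OF that]
    by (simp add: presented_algebra_def ring.defs FactRing_def rel_class_def)
  show "\<one>\<^bsub>presented_algebra G R\<^esub> = rel_class G R 1"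
    by (simp add: presented_algebra_def ring.defs FactRing_def rel_class_def)
  have "rel_class G R (smul c y) = rel_class G R (smul c x)" if "y \<in> rel_class G R x" for y
    using that Idl_closed(6)[OF assms, of "y - x" c]
    by (simp add: mem_rel_class rel_class_eq_iff[OF assms] smul_distribs)
  moreover have "x \<in> rel_class G R x"
    by (simp add: mem_rel_class Idl_closed[OF assms])
  ultimately have "(\<Union>y\<in>rel_class G R x. rel_class G R (smul c y)) = rel_class G R (smul c x)"
    by blast
  then show "c \<odot>\<^bsub>presented_algebra G R\<^esub> rel_class G R x = rel_class G R (smul c x)"
    unfolding presented_algebra_def ring.defs module.defs by simp
qed

text \<open>The elements that the lift sends into the target ideal form an ideal, so it is enough to
  test the relators.\<close>

lemma free_lift_Idl:
  assumes "\<And>g. g \<in> G \<Longrightarrow> h g \<in> carrier (free_algebra H)"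
    and "R \<subseteq> carrier (free_algebra G)" and "S \<subseteq> carrier (free_algebra H)"
    and "\<And>r. r \<in> R \<Longrightarrow> free_lift h r \<in> Idl\<^bsub>free_algebra H\<^esub> S"
    and "x \<in> Idl\<^bsub>free_algebra G\<^esub> R"
  shows "free_lift h x \<in> Idl\<^bsub>free_algebra H\<^esub> S"
proof -
  let ?I = "{x \<in> carrier (free_algebra G). free_lift h x \<in> Idl\<^bsub>free_algebra H\<^esub> S}"
  have lift: "free_lift h x \<in> carrier (free_algebra H)" if "x \<in> carrier (free_algebra G)" for x
    using assms(1) that by (rule free_lift_in_free_algebra)
  have "ideal ?I (free_algebra G)"
    by (intro ideal_free_algebraI) (auto intro: lift Idl_closed[OF assms(3)])
  moreover have "R \<subseteq> ?I"
    using assms by auto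
  ultimately show ?thesis
    using Idl_subsetI[of ?I G R] assms(5) by blast
qed

text \<open>Subspaces appear twice below: as the Fock space itself and as its submodules.\<close>

locale linear_subspace =
  fixes V :: "('b \<Rightarrow>\<^sub>0 'k::field) set"
  assumes zero_mem: "0 \<in> V"
    and add_mem: "v \<in> V \<Longrightarrow> w \<in> V \<Longrightarrow> v + w \<in> V"
    and smul_mem: "v \<in> V \<Longrightarrow> smul c v \<in> V"
begin

lemma uminus_mem: "v \<in> V \<Longrightarrow> - v \<in> V"
  using smul_mem[of v "-1"] by (simp add: smul_minus_one)

lemma diff_mem: "v \<in> V \<Longrightarrow> w \<in> V \<Longrightarrow> v - w \<in> V"
  using add_mem[of v "- w"] uminus_mem by simp

lemma free_action_mem:
  assumes gens: "\<And>g v. g \<in> G \<Longrightarrow> v \<in> V \<Longrightarrow> linear_ext (h g) v \<in> V"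
    and x: "x \<in> carrier (free_algebra G)" and v: "v \<in> V"
  shows "free_action h x v \<in> V"
proof -
  have word: "foldr (\<lambda>g. linear_ext (h g)) gs v \<in> V" if "set gs \<subseteq> G" for gs
    using that by (induction gs) (auto intro: v gens)
  from x have "Poly_Mapping.keys x \<subseteq> {w. set (letters w) \<subseteq> G}"
    by (auto simp: carrier_free_algebra)
  then show ?thesis
    by (induction rule: linear_combination_induct)
      (auto simp: zero_mem add_mem free_action_conv_linear_ext linear_ext_add intro!: smul_mem word)
qed

lemma free_action_Idl:
  assumes gens: "\<And>g v. g \<in> G \<Longrightarrow> v \<in> V \<Longrightarrow> linear_ext (h g) v \<in> V"
    and R: "R \<subseteq> carrier (free_algebra G)"
    and rel: "\<And>r v. r \<in> R \<Longrightarrow> v \<in> V \<Longrightarrow> free_action h r v = 0"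
    and x: "x \<in> Idl\<^bsub>free_algebra G\<^esub> R" and v: "v \<in> V"
  shows "free_action h x v = 0"
proof -
  let ?I = "{x \<in> carrier (free_algebra G). \<forall>v\<in>V. free_action h x v = 0}"
  have "ideal ?I (free_algebra G)"
    by (intro ideal_free_algebraI) (auto simp: free_action_vec free_action_mem[OF gens])
  moreover have "R \<subseteq> ?I"
    using R rel by auto
  ultimately show ?thesis
    using Idl_subsetI[of ?I G R] x v by blast
qed

end

section \<open>The ground field\<close>

text \<open>The indeterminate is transcendental: its powers are the fractions \<open>X\<^sup>k / 1\<close>, hence pairwise
  distinct. All nonvanishing statements about \<open>q\<close>-numbers rest on this.\<close>

lemma qhalf_power: "qhalf ^ k = Fract (monom 1 k) 1"
proof (induction k)
  case 0
  then show ?case by (simp add: One_fract_def)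
next
  case (Suc k)
  then show ?case
    by (simp add: qhalf_def mult.commute flip: monom_altdef) (simp add: monom_Suc)
qed

lemma qhalf_power_eq_iff: "qhalf ^ a = qhalf ^ b \<longleftrightarrow> a = b"
  by (auto simp: qhalf_power eq_fract monom_eq_iff')

lemma qq_power_eq_iff: "qq ^ a = qq ^ b \<longleftrightarrow> a = b"
  by (simp add: qq_def qhalf_power_eq_iff flip: power_mult)

lemma qhalf_nonzero [simp]: "qhalf \<noteq> 0"
  by (simp add: qhalf_def Zero_fract_def eq_fract)

lemma qq_nonzero [simp]: "qq \<noteq> 0"
  by (simp add: qq_def)

lemma qq_power_diff_nonzero:
  assumes "t > 0"
  shows "qq ^ t - inverse qq ^ t \<noteq> 0"
proof
  assume "qq ^ t - inverse qq ^ t = 0"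
  then have "qq ^ t * qq ^ t = 1"
    by (simp add: field_simps)
  then have "qq ^ (t + t) = qq ^ 0"
    by (simp add: power_add)
  with assms show False
    by (simp add: qq_power_eq_iff del: power_0)
qed

lemma qq_diff_nonzero: "qq - inverse qq \<noteq> 0"
  using qq_power_diff_nonzero[of 1] by simp

lemma qq_neq_inverse [simp]: "qq \<noteq> inverse qq"
  using qq_diff_nonzero by (simp del: qq_diff_nonzero)

lemma qnum_nonzero: "t > 0 \<Longrightarrow> qnum t \<noteq> 0"
  using qq_power_diff_nonzero[of t] by (simp add: qnum_def)

lemma qnum_simps [simp]: "qnum 0 = 0" "qnum (Suc 0) = 1"
  by (simp_all add: qnum_def)

lemma qhalf_diff_nonzero [simp]: "qhalf - inverse qhalf \<noteq> 0"
proof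
  assume "qhalf - inverse qhalf = 0"
  then have "qhalf ^ 2 = qhalf ^ 0"
    by (simp add: field_simps power2_eq_square)
  then show False
    by (simp add: qhalf_power_eq_iff del: power_0)
qed

lemma sqrt_neg1_square: "sqrt_neg1 * sqrt_neg1 = - 1"
  by (simp add: sqrt_neg1_def cst_def One_fract_def one_pCons)

lemma sqrt_neg1_nonzero [simp]: "sqrt_neg1 \<noteq> 0"
  using sqrt_neg1_square by auto

lemma two_nonzero: "(1 + 1 :: Cq) \<noteq> 0"
  by (simp add: One_fract_def Zero_fract_def eq_fract)

section \<open>Commutation up to scalars\<close>

text \<open>A unital associative algebra over a field, as a ring type with a scalar action; type class
  automation for rings is then available for noncommutative calculations.\<close>

locale assoc_algebra = vector_space scale
  for scale :: "'k::field \<Rightarrow> 'r::ring_1 \<Rightarrow> 'r" (infixr "\<bullet>" 75) +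
  assumes scale_mult_left: "(c \<bullet> x) * y = c \<bullet> (x * y)"
    and scale_mult_right: "x * (c \<bullet> y) = c \<bullet> (x * y)"
begin

text \<open>Commutation up to a scalar covers at once the weights \<open>k x k\<^sup>-\<^sup>1 = c x\<close>, the commuting
  bosons and the anticommuting fermions.\<close>

definition exchange :: "'k \<Rightarrow> 'r \<Rightarrow> 'r \<Rightarrow> bool" where
  "exchange c x y \<longleftrightarrow> x * y = c \<bullet> (y * x)"

text \<open>The \<open>c\<close>-commutator. If \<open>k\<^sub>i\<close> conjugates \<open>x\<close> to a multiple of itself, then the adjoint
  action of \<open>e\<^sub>i\<close> on \<open>x\<close> is such a bracket, with \<open>c\<close> the weight times a sign.\<close>

definition bracket :: "'k \<Rightarrow> 'r \<Rightarrow> 'r \<Rightarrow> 'r" where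
  "bracket c x y = x * y - c \<bullet> (y * x)"

lemmas scale_simps = scale_mult_left scale_mult_right scale_scale scale_right_distrib
  scale_right_diff_distrib scale_minus_right scale_minus_left scale_one

lemma exchange_sym: "exchange c x y \<Longrightarrow> c \<noteq> 0 \<Longrightarrow> exchange (inverse c) y x"
  by (simp add: exchange_def)

lemma exchange_mult_right:
  assumes "exchange c x y" "exchange d x z"
  shows "exchange (c * d) x (y * z)"
proof -
  have "x * (y * z) = (x * y) * z" by (simp add: mult.assoc)
  also have "\<dots> = c \<bullet> (y * (x * z))" using assms(1)
    by (simp add: exchange_def scale_simps mult.assoc)
  also have "\<dots> = (c * d) \<bullet> (y * z * x)" using assms(2)
    by (simp add: exchange_def scale_simps mult.assoc)
  finally show ?thesis by (simp add: exchange_def)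
qed

lemma exchange_mult_left:
  assumes "exchange c x z" "exchange d y z"
  shows "exchange (c * d) (x * y) z"
proof -
  have "x * y * z = x * (y * z)" by (simp add: mult.assoc)
  also have "\<dots> = d \<bullet> (x * z * y)" using assms(2) by (simp add: exchange_def scale_simps mult.assoc)
  also have "\<dots> = (c * d) \<bullet> (z * (x * y))"
    using assms(1) by (simp add: exchange_def scale_simps mult.assoc mult.commute)
  finally show ?thesis by (simp add: exchange_def)
qed

lemma exchange_scale_left: "exchange c x y \<Longrightarrow> exchange c (d \<bullet> x) y"
  and exchange_scale_right: "exchange c x y \<Longrightarrow> exchange c x (d \<bullet> y)"
  by (simp_all add: exchange_def scale_simps mult.commute)

lemma exchange_minus_left: "exchange c x y \<Longrightarrow> exchange c (- x) y"
  by (simp add: exchange_def scale_simps)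

lemma exchange_one [simp]: "exchange 1 1 x" "exchange 1 x 1"
  by (simp_all add: exchange_def)

lemma exchange_inverse_left:
  assumes "exchange c x y" "x * xi = 1" "xi * x = 1" "c \<noteq> 0"
  shows "exchange (inverse c) xi y"
proof -
  have "y * xi = (xi * x) * y * xi" by (simp add: assms)
  also have "\<dots> = xi * (x * y) * xi" by (simp add: mult.assoc)
  also have "\<dots> = c \<bullet> (xi * y * (x * xi))"
    using assms(1) by (simp add: exchange_def scale_simps mult.assoc)
  finally show ?thesis using assms by (simp add: exchange_def)
qed

lemma exchange_conjugate:
  assumes "exchange c x y" "x * xi = 1"
  shows "x * y * xi = c \<bullet> y"
  using assms by (simp add: exchange_def scale_simps mult.assoc)

lemma exchange_bracket:
  assumes "exchange c x y" "exchange d x z"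
  shows "exchange (c * d) x (bracket e y z)"
  using exchange_mult_right[OF assms] exchange_mult_right[OF assms(2,1)]
  by (simp add: exchange_def bracket_def scale_simps algebra_simps)

lemma exchange_bracket_zero: "exchange c x y \<Longrightarrow> bracket c x y = 0"
  by (simp add: exchange_def bracket_def)

text \<open>Each monomial of the double bracket contains \<open>x * x\<close> or \<open>x * y * x\<close>, whatever the
  coefficients are. This settles the quadratic Serre relations at the purely fermionic nodes.\<close>

lemma double_bracket_nilpotent:
  assumes "x * x = 0" "x * y * x = 0"
  shows "bracket d x (bracket c x y) = 0"
proof -
  have "x * (x * y) = 0" "x * (y * x) = 0" "y * x * x = 0"
    using assms by (simp_all add: mult.assoc flip: mult.assoc[of x x])
  then show ?thesis using assms by (simp add: bracket_def scale_simps algebra_simps)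
qed

text \<open>With three factors \<open>x\<close> around one \<open>y\<close>, two of them are always adjacent. This is the cubic
  Serre relation at the last node.\<close>

lemma triple_bracket_nilpotent:
  assumes "x * x = 0"
  shows "bracket e x (bracket d x (bracket c x y)) = 0"
proof -
  have "x * (x * t) = 0" for t
    using assms by (simp flip: mult.assoc)
  then show ?thesis using assms by (simp add: bracket_def scale_simps algebra_simps)
qed

lemma sandwich_nilpotent:
  assumes "exchange c w x" "x * x = 0"
  shows "x * w * x = 0"
  using assms(2) assms(1)[unfolded exchange_def]
  by (simp add: mult.assoc scale_simps flip: mult.assoc[of x x])

lemma exchange_of_conjugate:
  assumes "x * y * xi = c \<bullet> y" "xi * x = 1"
  shows "exchange c x y"
proof -
  have "x * y = (x * y * xi) * x" using assms(2) by (simp add: mult.assoc)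
  then show ?thesis using assms(1) by (simp add: exchange_def scale_simps)
qed

lemma exchange_commute: "exchange 1 x y \<Longrightarrow> x * y = y * x"
  by (simp add: exchange_def)

lemma exchange_commute_assoc: "exchange 1 x y \<Longrightarrow> x * (y * t) = y * (x * t)"
  using exchange_commute[of x y] by (simp flip: mult.assoc)

lemma exchange_assoc: "exchange c x y \<Longrightarrow> x * (y * t) = c \<bullet> (y * (x * t))"
  by (simp add: exchange_def scale_simps mult.assoc flip: mult.assoc[of x y])

lemma bracket_scale_right: "bracket c x (d \<bullet> y) = d \<bullet> bracket c x y"
  by (simp add: bracket_def scale_simps mult.commute)

lemma exchange_minus_right: "exchange c x y \<Longrightarrow> exchange c x (- y)"
  by (simp add: exchange_def scale_simps)

text \<open>Two neighbouring root vectors \<open>y * b1\<close> and \<open>b2 * w\<close> interact only at their common site,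
  where the inner bracket turns \<open>b1 * b2\<close> into the Cartan element \<open>k\<close>. The outer coefficient \<open>d\<close>
  is the scalar by which \<open>b1\<close> passes \<open>k\<close>, so the outer bracket vanishes.\<close>

lemma oscillator_serre:
  assumes b: "b1 * b2 - q \<bullet> (b2 * b1) = k" "exchange d b1 k"
    and y: "exchange 1 y b1" "exchange 1 y b2" "exchange 1 y k"
    and w: "exchange 1 w b1" "exchange 1 w b2" "exchange 1 w y"
  shows "bracket d (y * b1) (bracket q (y * b1) (b2 * w)) = 0"
proof -
  note comm = y(2)[THEN exchange_commute] y(2)[THEN exchange_commute_assoc]
    y(1)[THEN exchange_commute] y(1)[THEN exchange_commute_assoc]
    w[THEN exchange_commute] w[THEN exchange_commute_assoc]
  have "bracket q (y * b1) (b2 * w) = (b1 * b2 - q \<bullet> (b2 * b1)) * (y * w)"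
    by (simp add: bracket_def comm mult.assoc scale_simps left_diff_distrib)
  then have eq: "bracket q (y * b1) (b2 * w) = k * (y * w)"
    using b by simp
  have "exchange ((1 * (1 * 1)) * (d * (1 * 1))) (y * b1) (k * (y * w))"
    using y(1,3) w(1,3) b(2) exchange_sym[OF y(1)] exchange_sym[OF w(1)] exchange_sym[OF w(3)]
    by (intro exchange_mult_left exchange_mult_right) (auto simp: exchange_def)
  then show ?thesis
    unfolding eq by (intro exchange_bracket_zero) simp
qed

text \<open>Here three root vectors overlap at two sites: \<open>b1, b2\<close> live at the last bosonic site and
  \<open>c1, c2\<close> at the first fermionic one, while \<open>y\<close> and \<open>z\<close> are spectators on either side. The first
  bracket contracts \<open>c1, c2\<close> to a Cartan element, the second contracts \<open>b2, b1\<close>. What remains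
  commutes with \<open>b1 * c1\<close> up to \<open>e\<close>, since the factors \<open>q\<close> and \<open>q\<^sup>-\<^sup>1\<close> picked up from the two
  Cartan elements cancel. The sign \<open>e\<close> records whether \<open>z\<close> is fermionic.\<close>

lemma odd_triple_serre:
  assumes b: "b2 * b1 - q \<bullet> (b1 * b2) = kb" "exchange q b1 kb"
    and c: "c1 * c2 + inverse q \<bullet> (c2 * c1) = kc" "exchange (inverse q) c1 kc"
    and q: "q \<noteq> 0"
    and bc: "exchange 1 b1 c1" "exchange 1 b1 c2" "exchange 1 b2 kc" "exchange 1 b1 kc"
      "exchange 1 c1 kb"
    and z: "exchange e c1 z" "e * e = 1" "exchange 1 b1 z" "exchange 1 b2 z"
    and y: "exchange 1 y b1" "exchange 1 y b2" "exchange 1 y c1" "exchange 1 y kc" "exchange 1 y z"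
  shows "bracket e (b1 * c1) (bracket q (y * b2) (bracket (- (e * inverse q)) (b1 * c1) (c2 * z)))
    = 0"
proof -
  have "e \<noteq> 0" using z(2) by auto
  moreover have "inverse e = e" using z(2) by (simp add: inverse_unique)
  ultimately have zc: "exchange e z c1" using exchange_sym[OF z(1)] by simp
  have "c2 * z * (b1 * c1) = e \<bullet> (b1 * (c2 * c1) * z)"
  proof -
    have "c2 * z * (b1 * c1) = c2 * (z * b1) * c1" by (simp add: mult.assoc)
    also have "\<dots> = c2 * (b1 * z) * c1" by (simp add: exchange_commute[OF z(3)])
    also have "\<dots> = (b1 * c2) * (z * c1)" by (simp add: mult.assoc exchange_commute_assoc[OF bc(2)])
    also have "\<dots> = e \<bullet> (b1 * c2 * (c1 * z))" using zc by (simp add: exchange_def scale_simps)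
    finally show ?thesis by (simp add: mult.assoc)
  qed
  moreover have eqe: "e * (inverse q * e) = inverse q"
  proof -
    have "e * (inverse q * e) = (e * e) * inverse q" by (simp only: mult_ac)
    then show ?thesis by (simp add: z(2))
  qed
  ultimately have "bracket (- (e * inverse q)) (b1 * c1) (c2 * z) =
    b1 * (c1 * c2 + inverse q \<bullet> (c2 * c1)) * z"
    by (simp add: bracket_def scale_simps mult.assoc distrib_left distrib_right eqe)
  then have T1: "bracket (- (e * inverse q)) (b1 * c1) (c2 * z) = b1 * (kc * z)"
    using c by (simp add: mult.assoc)
  have "b1 * (kc * z) * (y * b2) = y * (b1 * b2) * (kc * z)"
  proof -
    have "b1 * (kc * z) * (y * b2) = (b1 * (kc * (z * y))) * b2" by (simp add: mult.assoc)
    also have "\<dots> = y * (b1 * (kc * (z * b2)))"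
      using exchange_commute[OF y(5)] y(1,4,5)[THEN exchange_commute_assoc]
        by (simp add: mult.assoc)
    also have "\<dots> = y * (b1 * (b2 * (kc * z)))"
      using exchange_commute[OF z(4)] bc(3)[THEN exchange_commute_assoc] by simp
    finally show ?thesis by (simp add: mult.assoc)
  qed
  then have "bracket q (y * b2) (b1 * (kc * z)) = y * (b2 * b1 - q \<bullet> (b1 * b2)) * (kc * z)"
    by (simp add: bracket_def scale_simps mult.assoc algebra_simps)
  then have T2: "bracket q (y * b2) (b1 * (kc * z)) = y * (kb * (kc * z))"
    using b by (simp add: mult.assoc)
  have "exchange ((1 * (q * (1 * 1))) * (1 * (1 * (inverse q * e)))) (b1 * c1) (y * (kb * (kc *
    z)))"
    using b(2) c(2) z(1,3) y bc exchange_sym[OF y(1)] exchange_sym[OF y(3)]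
    by (intro exchange_mult_left exchange_mult_right) (auto simp: exchange_def)
  then show ?thesis
    unfolding T1 T2 using q by (intro exchange_bracket_zero) (simp flip: mult.assoc[of q])
qed

end

section \<open>Relations in the deformed Clifford algebra\<close>

definition fermionic :: "nat \<Rightarrow> nat \<Rightarrow> nat \<Rightarrow> nat" where
  "fermionic m n p = (if m < p \<and> p \<le> m + n then 1 else 0)"

definition swap_sign :: "nat \<Rightarrow> nat \<Rightarrow> nat \<Rightarrow> nat \<Rightarrow> Cq" where
  "swap_sign m n p r = (- 1) ^ (fermionic m n p * fermionic m n r)"

text \<open>The scalar by which the Cartan element of a site passes its annihilator.\<close>

definition site_weight :: "nat \<Rightarrow> nat \<Rightarrow> Cq" where
  "site_weight m p = (if p \<le> m then inverse qq else qq)"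

lemma site_weight_nonzero [simp]: "site_weight m p \<noteq> 0"
  by (simp add: site_weight_def)

text \<open>The relations of the Clifford algebra with bosonic sites \<open>1, \<dots>, m\<close> and fermionic sites
  \<open>m + 1, \<dots>, m + n\<close> in one notation: \<open>a, ad, h, hi\<close> stand for \<open>\<phi>, \<phi>\<^sup>\<dagger>, u, u\<^sup>-\<^sup>1\<close> at a bosonic
  site and for \<open>\<psi>, \<psi>\<^sup>\<dagger>, v, v\<^sup>-\<^sup>1\<close> at a fermionic one. The values at \<open>m + n + 1\<close> are the scalars
  with which the last root vectors \<open>e\<^sub>m\<^sub>+\<^sub>n\<close> and \<open>f\<^sub>m\<^sub>+\<^sub>n\<close> fit the pattern of the others.\<close>

locale deformed_clifford = assoc_algebra scale
  for scale :: "Cq \<Rightarrow> 'r::ring_1 \<Rightarrow> 'r" (infixr "\<bullet>" 75) +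
  fixes m n :: nat and a ad h hi :: "nat \<Rightarrow> 'r"
  assumes m_pos: "1 \<le> m" and n_pos: "1 \<le> n"
    and a_last: "a (Suc (m + n)) = 1"
    and ad_last: "ad (Suc (m + n)) = (sqrt_neg1 * inverse (qhalf - inverse qhalf)) \<bullet> 1"
    and a_a: "p \<in> {1..m+n} \<Longrightarrow> r \<in> {1..m+n} \<Longrightarrow> exchange (swap_sign m n p r) (a p) (a r)"
    and ad_ad: "p \<in> {1..m+n} \<Longrightarrow> r \<in> {1..m+n} \<Longrightarrow> exchange (swap_sign m n p r) (ad p) (ad r)"
    and a_ad: "p \<in> {1..m+n} \<Longrightarrow> r \<in> {1..m+n} \<Longrightarrow> p \<noteq> r \<Longrightarrow> exchange (swap_sign m n p r) (a p) (ad r)"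
    and h_hi: "p \<in> {1..m+n} \<Longrightarrow> h p * hi p = 1" and hi_h: "p \<in> {1..m+n} \<Longrightarrow> hi p * h p = 1"
    and h_h: "p \<in> {1..m+n} \<Longrightarrow> r \<in> {1..m+n} \<Longrightarrow> exchange 1 (h p) (h r)"
    and h_a: "p \<in> {1..m+n} \<Longrightarrow> r \<in> {1..m+n} \<Longrightarrow>
      exchange (if p = r then site_weight m p else 1) (h p) (a r)"
    and h_ad: "p \<in> {1..m+n} \<Longrightarrow> r \<in> {1..m+n} \<Longrightarrow>
      exchange (if p = r then inverse (site_weight m p) else 1) (h p) (ad r)"
    and osc_hi: "p \<in> {1..m+n} \<Longrightarrow> a p * ad p - (swap_sign m n p p * qq) \<bullet> (ad p * a p) = hi p"
    and osc_h: "p \<in> {1..m+n} \<Longrightarrow> a p * ad p - (swap_sign m n p p * inverse qq) \<bullet> (ad p * a p) = h p"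
begin

definition E :: "nat \<Rightarrow> 'r" where "E p = a p * ad (Suc p)"
definition F :: "nat \<Rightarrow> 'r" where "F p = a (Suc p) * ad p"
definition K :: "nat \<Rightarrow> 'r" where
  "K p = (if p < m then - (h p * hi (Suc p)) else if p < m + n then h p * hi (Suc p)
          else (sqrt_neg1 * qhalf) \<bullet> h p)"
definition Ki :: "nat \<Rightarrow> 'r" where
  "Ki p = (if p < m then - (h (Suc p) * hi p) else if p < m + n then h (Suc p) * hi p
          else inverse (sqrt_neg1 * qhalf) \<bullet> hi p)"

lemma swap_sign_last [simp]: "swap_sign m n (Suc (m + n)) r = 1" "swap_sign m n r (Suc (m + n)) = 1"
  by (simp_all add: swap_sign_def fermionic_def)

lemma site_exchange:
  assumes "p \<in> {1..Suc (m + n)}" "r \<in> {1..Suc (m + n)}"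
  shows "exchange (swap_sign m n p r) (a p) (a r)"
    and "exchange (swap_sign m n p r) (ad p) (ad r)"
    and "p \<noteq> r \<Longrightarrow> exchange (swap_sign m n p r) (a p) (ad r)"
    and "p \<noteq> r \<Longrightarrow> exchange (swap_sign m n p r) (ad p) (a r)"
proof -
  have last: "exchange 1 (a (Suc (m + n))) x" "exchange 1 (ad (Suc (m + n))) x"
    "exchange 1 x (a (Suc (m + n)))" "exchange 1 x (ad (Suc (m + n)))" for x
    by (simp_all add: a_last ad_last exchange_scale_left exchange_scale_right)
  have cases: "p = Suc (m + n) \<or> r = Suc (m + n) \<or> p \<in> {1..m+n} \<and> r \<in> {1..m+n}"
    using assms by fastforce
  show "exchange (swap_sign m n p r) (a p) (a r)"
    using cases by (auto intro: a_a last)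
  show "exchange (swap_sign m n p r) (ad p) (ad r)"
    using cases by (auto intro: ad_ad last)
  show "exchange (swap_sign m n p r) (a p) (ad r)" if "p \<noteq> r"
    using cases a_ad[of p r] that by (auto intro: last)
  have "exchange (inverse (swap_sign m n r p)) (ad p) (a r)" if "p \<noteq> r" "p \<in> {1..m+n}"
    "r \<in> {1..m+n}"
    using a_ad[of r p] that by (intro exchange_sym) (auto simp: swap_sign_def)
  moreover have "inverse (swap_sign m n r p) = swap_sign m n p r"
    by (simp add: swap_sign_def mult.commute flip: power_inverse)
  ultimately show "exchange (swap_sign m n p r) (ad p) (a r)" if "p \<noteq> r"
    using cases that by (auto intro: last)
qed

text \<open>A fermionic letter anticommutes with itself, and \<open>2\<close> is invertible.\<close>

lemma fermionic_square_zero: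
  assumes "m < p" "p \<le> m + n"
  shows "a p * a p = 0" "ad p * ad p = 0"
proof -
  have zero: "x = 0" if "x = (- 1) \<bullet> x" for x
  proof -
    have "(1 + 1) \<bullet> x = 1 \<bullet> x + 1 \<bullet> x" by (rule scale_left_distrib)
    also have "\<dots> = 0" by (subst (2) that) simp
    finally show ?thesis using two_nonzero scale_eq_0_iff by blast
  qed
  have "swap_sign m n p p = - 1" using assms by (simp add: swap_sign_def fermionic_def)
  then show "a p * a p = 0" "ad p * ad p = 0"
    using site_exchange(1,2)[of p p] assms by (auto intro!: zero simp: exchange_def)
qed

text \<open>The sign in the supercommutator of two root vectors. Root vector \<open>p\<close> is made of letters at
  the sites \<open>p\<close> and \<open>p + 1\<close>, so it is odd if exactly one of the two is fermionic.\<close>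

definition node_sign :: "nat \<Rightarrow> nat \<Rightarrow> Cq" where
  "node_sign p r = (- 1) ^ (uq_parity m n (GE p) * uq_parity m n (GE r))"

lemma swap_sign_node:
  assumes "p \<in> {1..m+n}" "r \<in> {1..m+n}"
  shows "(swap_sign m n p r * swap_sign m n p (Suc r)) *
    (swap_sign m n (Suc p) r * swap_sign m n (Suc p) (Suc r)) = node_sign p r"
  using assms n_pos by (auto simp: swap_sign_def fermionic_def node_sign_def theta1_def)

text \<open>For \<open>p \<noteq> r\<close> no letter of \<open>E p\<close> meets its own conjugate in \<open>F r\<close>: a shared site carries two
  annihilators or two creators, which exchange like letters at distinct sites.\<close>

lemma E_F_exchange:
  assumes "p \<in> {1..m+n}" "r \<in> {1..m+n}" "p \<noteq> r"
  shows "exchange (node_sign p r) (E p) (F r)"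
proof -
  have "exchange ((swap_sign m n p (Suc r) * swap_sign m n p r) *
      (swap_sign m n (Suc p) (Suc r) * swap_sign m n (Suc p) r)) (E p) (F r)"
    unfolding E_def F_def using assms
    by (intro exchange_mult_left exchange_mult_right site_exchange) auto
  then show ?thesis
    by (simp add: mult_ac flip: swap_sign_node[OF assms(1,2)])
qed

lemma distant_nodes_exchange:
  assumes "p \<in> {1..m+n}" "r \<in> {1..m+n}" "p \<noteq> Suc r" "r \<noteq> Suc p"
  shows "exchange (node_sign p r) (E p) (E r)" and "exchange (node_sign p r) (F p) (F r)"
proof -
  have "exchange ((swap_sign m n p r * swap_sign m n p (Suc r)) *
      (swap_sign m n (Suc p) r * swap_sign m n (Suc p) (Suc r))) (E p) (E r)"
    unfolding E_def using assms
    by (intro exchange_mult_left exchange_mult_right site_exchange) auto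
  then show "exchange (node_sign p r) (E p) (E r)"
    by (simp add: mult_ac flip: swap_sign_node[OF assms(1,2)])
  have "exchange ((swap_sign m n (Suc p) (Suc r) * swap_sign m n (Suc p) r) *
      (swap_sign m n p (Suc r) * swap_sign m n p r)) (F p) (F r)"
    unfolding F_def using assms
    by (intro exchange_mult_left exchange_mult_right site_exchange) auto
  then show "exchange (node_sign p r) (F p) (F r)"
    by (simp add: mult_ac flip: swap_sign_node[OF assms(1,2)])
qed

lemma h_exchange:
  assumes "p \<in> {1..m+n}" "r \<in> {1..Suc (m + n)}"
  shows "exchange (if p = r then site_weight m p else 1) (h p) (a r)"
    and "exchange (if p = r then inverse (site_weight m p) else 1) (h p) (ad r)"
    and "exchange (if p = r then inverse (site_weight m p) else 1) (hi p) (a r)"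
    and "exchange (if p = r then site_weight m p else 1) (hi p) (ad r)"
proof -
  show h: "exchange (if p = r then site_weight m p else 1) (h p) (a r)"
    "exchange (if p = r then inverse (site_weight m p) else 1) (h p) (ad r)"
    using assms h_a[of p r] h_ad[of p r]
    by (cases "r = Suc (m + n)"; simp add: a_last ad_last exchange_scale_right)+
  show "exchange (if p = r then inverse (site_weight m p) else 1) (hi p) (a r)"
    "exchange (if p = r then site_weight m p else 1) (hi p) (ad r)"
    using exchange_inverse_left[OF h(1) h_hi hi_h] exchange_inverse_left[OF h(2) h_hi hi_h] assms
    by (auto split: if_splits)
qed

lemma h_hi_commute:
  assumes "p \<in> {1..m+n}" "r \<in> {1..m+n}"
  shows "exchange 1 (h p) (h r)" "exchange 1 (hi p) (h r)" "exchange 1 (h p) (hi r)"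
    "exchange 1 (hi p) (hi r)"
proof -
  show "exchange 1 (h p) (h r)" using assms h_h by blast
  have hih: "exchange 1 (hi p) (h r)" if "p \<in> {1..m+n}" "r \<in> {1..m+n}" for p r
    using exchange_inverse_left[OF h_h h_hi hi_h, of p r] that by simp
  then show "exchange 1 (hi p) (h r)" using assms by blast
  show hhi: "exchange 1 (h p) (hi r)"
    using exchange_sym[OF hih[OF assms(2,1)]] by simp
  show "exchange 1 (hi p) (hi r)"
    using exchange_inverse_left[OF hhi h_hi hi_h] assms by simp
qed

lemma K_Ki:
  assumes "p \<in> {1..m+n}"
  shows "K p * Ki p = 1" "Ki p * K p = 1"
proof -
  have "h p * hi r * (h r * hi p) = 1" if "p \<in> {1..m+n}" "r \<in> {1..m+n}" for p r
  proof -
    have "h p * hi r * (h r * hi p) = h p * (hi r * h r) * hi p" by (simp add: mult.assoc)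
    then show ?thesis using that by (simp add: hi_h h_hi)
  qed
  moreover have "inverse (sqrt_neg1 * qhalf) * (sqrt_neg1 * qhalf) = 1"
    "(sqrt_neg1 * qhalf) * inverse (sqrt_neg1 * qhalf) = 1"
    by (simp_all add: field_simps)
  ultimately show "K p * Ki p = 1" "Ki p * K p = 1"
    using assms by (auto simp: K_def Ki_def scale_simps h_hi hi_h simp del: inverse_mult_distrib)
qed

lemma K_K_commute:
  assumes "p \<in> {1..m+n}" "r \<in> {1..m+n}"
  shows "K p * K r = K r * K p"
proof -
  have h1: "exchange (1 * 1) (h p * hi (Suc p)) x" if "exchange 1 (h p) x"
    "exchange 1 (hi (Suc p)) x" for p x
    using that by (rule exchange_mult_left)
  have h2: "exchange (1 * 1) x (h p * hi (Suc p))" if "exchange 1 x (h p)"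
    "exchange 1 x (hi (Suc p))" for p x
    using that by (rule exchange_mult_right)
  have "exchange 1 (K p) (h r)" "exchange 1 (K p) (hi r)" if "p \<in> {1..m+n}" "r \<in> {1..m+n}" for p r
    using that h1[of p "h r"] h1[of p "hi r"] h_hi_commute[of p r] h_hi_commute[of "Suc p" r]
    by (auto simp: K_def intro!: exchange_minus_left exchange_scale_left)
  then have "exchange 1 (K p) (K r)"
    using assms h2[of "K p" r] exchange_scale_right[of 1 "K p" "h r"]
    by (auto simp: K_def[of r] exchange_def scale_simps)
  then show ?thesis by (simp add: exchange_def)
qed

text \<open>The scalar by which \<open>h p\<close> passes \<open>E r\<close>; only the sites \<open>r\<close> and \<open>r + 1\<close> contribute.\<close>

definition root_weight :: "nat \<Rightarrow> nat \<Rightarrow> Cq" where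
  "root_weight p r = (if p = r then site_weight m p else 1) * (if p =
    Suc r then inverse (site_weight m p) else 1)"

lemma qi_powi_cartan:
  assumes "p \<in> {1..m+n}" "r \<in> {1..m+n}"
  shows "qi m n p powi cartan m n p r = root_weight p r * (if p < m + n then inverse (root_weight
    (Suc p) r) else 1)"
    and "qi m n p powi (- cartan m n p r) = inverse (root_weight p r) * (if p < m + n then
      root_weight (Suc p) r else 1)"
  using assms m_pos n_pos
  by (auto simp: cartan_def root_weight_def qi_def site_weight_def qq_def power2_eq_square
    power_int_minus)
    (simp_all add: field_simps)

lemma h_root_vector_exchange:
  assumes "p \<in> {1..m+n}" "r \<in> {1..m+n}"
  shows "exchange (root_weight p r) (h p) (E r)" "exchange (inverse (root_weight p r)) (h p) (F r)"
    "exchange (inverse (root_weight p r)) (hi p) (E r)" "exchange (root_weight p r) (hi p) (F r)"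
proof -
  show E: "exchange (root_weight p r) (h p) (E r)"
    using exchange_mult_right[OF h_exchange(1)[of p r] h_exchange(2)[of p "Suc r"]] assms
    by (auto simp: root_weight_def E_def split: if_splits)
  show F: "exchange (inverse (root_weight p r)) (h p) (F r)"
    using exchange_mult_right[OF h_exchange(1)[of p "Suc r"] h_exchange(2)[of p r]] assms
    by (auto simp: root_weight_def F_def split: if_splits)
  have "root_weight p r \<noteq> 0" by (simp add: root_weight_def)
  then show "exchange (inverse (root_weight p r)) (hi p) (E r)"
    "exchange (root_weight p r) (hi p) (F r)"
    using exchange_inverse_left[OF E h_hi hi_h] exchange_inverse_left[OF F h_hi hi_h] assms by auto
qed

lemma K_root_vector_exchange:
  assumes "p \<in> {1..m+n}" "r \<in> {1..m+n}"
  shows "exchange (qi m n p powi cartan m n p r) (K p) (E r)"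
    and "exchange (qi m n p powi (- cartan m n p r)) (K p) (F r)"
  unfolding qi_powi_cartan[OF assms] K_def
  using assms exchange_mult_left[OF h_root_vector_exchange(1)[of p r] h_root_vector_exchange(3)[of
    "Suc p" r]]
    exchange_mult_left[OF h_root_vector_exchange(2)[of p r] h_root_vector_exchange(4)[of "Suc p" r]]
    h_root_vector_exchange(1,2)[of p r]
  by (auto intro!: exchange_minus_left exchange_scale_left)

text \<open>The two oscillator relations are linear equations for \<open>ad p * a p\<close> and \<open>a p * ad p\<close>; their
  determinant is \<open>q - q\<^sup>-\<^sup>1\<close> up to sign.\<close>

lemma number_operators:
  assumes "p \<in> {1..m+n}"
  shows "(qq - inverse qq) \<bullet> (ad p * a p) = swap_sign m n p p \<bullet> (h p - hi p)"
    and "(qq - inverse qq) \<bullet> (a p * ad p) = qq \<bullet> h p - inverse qq \<bullet> hi p"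
proof -
  let ?s = "swap_sign m n p p" and ?D = "qq - inverse qq"
  have s: "?s * ?s = 1" by (simp add: swap_sign_def fermionic_def)
  have diff: "h p - hi p = (?s * ?D) \<bullet> (ad p * a p)"
    using osc_hi[OF assms] osc_h[OF assms]
    by (simp add: algebra_simps scale_left_diff_distrib flip: osc_hi[OF assms] osc_h[OF assms])
  then show "?D \<bullet> (ad p * a p) = ?s \<bullet> (h p - hi p)"
    using s by (simp flip: mult.assoc)
  have "?D \<bullet> (a p * ad p) = ?D \<bullet> (hi p + (?s * qq) \<bullet> (ad p * a p))"
    using osc_hi[OF assms] by (simp add: algebra_simps)
  also have "\<dots> = ?D \<bullet> hi p + qq \<bullet> ((?s * ?D) \<bullet> (ad p * a p))"
    by (simp add: scale_simps mult_ac)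
  also have "\<dots> = qq \<bullet> h p - inverse qq \<bullet> hi p"
    by (simp add: scale_simps scale_left_diff_distrib flip: diff)
  finally show "?D \<bullet> (a p * ad p) = qq \<bullet> h p - inverse qq \<bullet> hi p" .
qed

text \<open>For \<open>p < m + n\<close> both \<open>E p * F p\<close> and \<open>F p * E p\<close> are products of a number operator at site
  \<open>p\<close> and one at site \<open>p + 1\<close>. Inserting the Cartan elements, the terms with \<open>h p * h (p + 1)\<close>
  and \<open>hi p * hi (p + 1)\<close> cancel and the mixed ones give \<open>K p - Ki p\<close>. At the last node there is
  only one site, and the normalising scalar of \<open>E\<close> is what makes the result equal to \<open>K - Ki\<close>.\<close>

lemma E_F_bracket:
  assumes "p \<in> {1..m+n}"
  shows "bracket (node_sign p p) (E p) (F p) = (1 / (qq - inverse qq)) \<bullet> (K p - Ki p)"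
proof -
  let ?D = "qq - inverse qq"
  show ?thesis
  proof (cases "p < m + n")
    case True
    let ?p = "Suc p" and ?s = "swap_sign m n p p" and ?s' = "swap_sign m n (Suc p) (Suc p)"
    have p': "?p \<in> {1..m+n}" using True by simp
    have EF: "E p * F p = (a p * ad p) * (ad ?p * a ?p)"
    proof -
      have "exchange (swap_sign m n p ?p * swap_sign m n p ?p) (ad p) (ad ?p * a ?p)"
        using assms p' by (intro exchange_mult_right site_exchange) auto
      then have "ad p * (ad ?p * a ?p) = ad ?p * a ?p * ad p"
        by (simp add: swap_sign_def exchange_def)
      then show ?thesis by (simp add: E_def F_def mult.assoc)
    qed
    have FE: "F p * E p = (ad p * a p) * (a ?p * ad ?p)"
    proof -
      have "exchange (swap_sign m n ?p p * swap_sign m n ?p p) (a ?p) (ad p * a p)"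
        using assms p' by (intro exchange_mult_right site_exchange) auto
      then have "a ?p * (ad p * a p) = ad p * a p * a ?p"
        by (simp add: swap_sign_def exchange_def)
      then show ?thesis by (simp add: E_def F_def flip: mult.assoc)
    qed
    \<comment> \<open>The sign of the supercommutator compensates the different statistics of the two sites.\<close>
    have sign: "node_sign p p * ?s = ?s'"
      using assms True by (auto simp: node_sign_def swap_sign_def fermionic_def theta1_def)
    have "?D \<bullet> (?D \<bullet> bracket (node_sign p p) (E p) (F p)) =
        (?D \<bullet> (a p * ad p)) * (?D \<bullet> (ad ?p * a ?p)) -
        node_sign p p \<bullet> ((?D \<bullet> (ad p * a p)) * (?D \<bullet> (a ?p * ad ?p)))"
      by (simp add: bracket_def EF FE scale_simps mult_ac)
    also have "\<dots> = ?s' \<bullet> ((qq \<bullet> h p - inverse qq \<bullet> hi p) * (h ?p - hi ?p) -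
        (h p - hi p) * (qq \<bullet> h ?p - inverse qq \<bullet> hi ?p))"
      unfolding number_operators[OF assms] number_operators[OF p'] sign[symmetric]
      by (simp only: scale_mult_left scale_mult_right scale_scale flip: scale_right_diff_distrib)
    also have "\<dots> = - (?s' \<bullet> (?D \<bullet> (h p * hi ?p - hi p * h ?p)))"
      by (simp add: scale_simps algebra_simps scale_left_diff_distrib)
    also have "\<dots> = ?D \<bullet> (K p - Ki p)"
      using True assms h_hi_commute(2)[OF assms p'] m_pos n_pos
      by (auto simp: K_def Ki_def swap_sign_def fermionic_def exchange_def scale_simps
        algebra_simps)
    finally have "?D \<bullet> bracket (node_sign p p) (E p) (F p) = K p - Ki p"
      using qq_diff_nonzero scale_cancel_left by blast
    then have "(1 / ?D) \<bullet> (?D \<bullet> bracket (node_sign p p) (E p) (F p)) = (1 / ?D) \<bullet> (K p - Ki p)"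
      by simp
    then show ?thesis using qq_diff_nonzero by simp
  next
    case False
    then have p: "p = m + n" using assms by simp
    let ?c = "sqrt_neg1 * inverse (qhalf - inverse qhalf)" and ?N = "m + n"
    have s: "swap_sign m n ?N ?N = - 1" "node_sign ?N ?N = - 1"
      using n_pos by (simp_all add: swap_sign_def fermionic_def node_sign_def theta1_def)
    have N: "?N \<in> {1..m+n}" using n_pos by simp
    have "?D \<bullet> bracket (- 1) (E ?N) (F ?N) = ?c \<bullet> (?D \<bullet> (a ?N * ad ?N) + ?D \<bullet> (ad ?N * a ?N))"
      by (simp add: bracket_def E_def F_def a_last ad_last scale_simps mult_ac)
    also have "\<dots> = (?c * (qq - 1)) \<bullet> h ?N + (?c * (1 - inverse qq)) \<bullet> hi ?N"
      unfolding number_operators[OF N] s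
      by (simp add: scale_simps scale_left_diff_distrib right_diff_distrib)
    also have "?c * (qq - 1) = sqrt_neg1 * qhalf"
      using qhalf_diff_nonzero by (simp add: qq_def field_simps power2_eq_square)
    also have "?c * (1 - inverse qq) = - inverse (sqrt_neg1 * qhalf)"
    proof -
      have "inverse sqrt_neg1 = - sqrt_neg1"
        using sqrt_neg1_square by (intro inverse_unique) simp
      then show ?thesis
        using qhalf_diff_nonzero by (simp add: qq_def field_simps power2_eq_square sqrt_neg1_square)
    qed
    also have "(sqrt_neg1 * qhalf) \<bullet> h ?N + (- inverse (sqrt_neg1 * qhalf)) \<bullet> hi ?N = K ?N - Ki ?N"
      by (simp add: K_def Ki_def)
    finally have "?D \<bullet> bracket (- 1) (E ?N) (F ?N) = K ?N - Ki ?N" .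
    then have "(1 / ?D) \<bullet> (?D \<bullet> bracket (- 1) (E ?N) (F ?N)) = (1 / ?D) \<bullet> (K ?N - Ki ?N)"
      by simp
    then show ?thesis using qq_diff_nonzero s p by simp
  qed
qed

text \<open>From node \<open>m\<close> on, a root vector contains at least one fermionic letter.\<close>

lemma root_vector_square_zero:
  assumes "m \<le> p" "p \<le> m + n"
  shows "E p * E p = 0" "F p * F p = 0"
proof -
  have "exchange (swap_sign m n (Suc p) p) (ad (Suc p)) (a p)"
    "exchange (swap_sign m n p (Suc p)) (ad p) (a (Suc p))"
    using assms m_pos by (auto intro!: site_exchange)
  then have "E p * E p = swap_sign m n (Suc p) p \<bullet> ((a p * a p) * (ad (Suc p) * ad (Suc p)))"
    "F p * F p = swap_sign m n p (Suc p) \<bullet> ((a (Suc p) * a (Suc p)) * (ad p * ad p))"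
    by (simp_all add: E_def F_def mult.assoc exchange_assoc scale_simps)
  moreover have "a p * a p = 0 \<or> ad (Suc p) * ad (Suc p) = 0" "a (Suc p) * a (Suc p) =
    0 \<or> ad p * ad p = 0"
    using fermionic_square_zero[of p] fermionic_square_zero[of "Suc p"] assms n_pos
    by (cases "p = m"; auto)+
  ultimately show "E p * E p = 0" "F p * F p = 0" by auto
qed

text \<open>The root vectors \<open>E p\<close> and \<open>E r\<close> share one site. The letter of \<open>E p\<close> at its other site can
  be moved through everything in between until it meets its second copy, and the square vanishes.\<close>

lemma root_vector_sandwich_zero:
  assumes "m < p" "p < m + n" "r \<in> {1..m+n}" "r = Suc p \<or> p = Suc r"
  shows "E p * E r * E p = 0" "F p * F r * F p = 0"
proof -
  have sq: "a p * a p = 0" "ad p * ad p = 0" "a (Suc p) * a (Suc p) = 0"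
    "ad (Suc p) * ad (Suc p) = 0"
    using fermionic_square_zero[of p] fermionic_square_zero[of "Suc p"] assms by auto
  from assms(4) show "E p * E r * E p = 0"
  proof
    assume r: "r = Suc p"
    have "exchange (swap_sign m n (Suc p) p * (swap_sign m n r p * swap_sign m n (Suc r) p))
      (ad (Suc p) * (a r * ad (Suc r))) (a p)"
      using assms r by (intro exchange_mult_left site_exchange) auto
    then have "a p * (ad (Suc p) * (a r * ad (Suc r))) * a p = 0"
      using sq by (intro sandwich_nilpotent)
    then show ?thesis by (simp add: E_def flip: mult.assoc)
  next
    assume r: "p = Suc r"
    have "exchange (swap_sign m n r (Suc p) * (swap_sign m n (Suc r) (Suc p) * swap_sign m n p
      (Suc p)))
      (a r * (ad (Suc r) * a p)) (ad (Suc p))"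
      using assms r by (intro exchange_mult_left site_exchange) auto
    then have "ad (Suc p) * (a r * (ad (Suc r) * a p)) * ad (Suc p) = 0"
      using sq by (intro sandwich_nilpotent)
    then show ?thesis by (simp add: E_def mult.assoc)
  qed
  from assms(4) show "F p * F r * F p = 0"
  proof
    assume r: "r = Suc p"
    have "exchange (swap_sign m n (Suc r) p * (swap_sign m n r p * swap_sign m n (Suc p) p))
      (a (Suc r) * (ad r * a (Suc p))) (ad p)"
      using assms r by (intro exchange_mult_left site_exchange) auto
    then have "ad p * (a (Suc r) * (ad r * a (Suc p))) * ad p = 0"
      using sq by (intro sandwich_nilpotent)
    then show ?thesis by (simp add: F_def mult.assoc)
  next
    assume r: "p = Suc r"
    have "exchange (swap_sign m n p (Suc p) * (swap_sign m n (Suc r) (Suc p) * swap_sign m n r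
      (Suc p)))
      (ad p * (a (Suc r) * ad r)) (a (Suc p))"
      using assms r by (intro exchange_mult_left site_exchange) auto
    then have "a (Suc p) * (ad p * (a (Suc r) * ad r)) * a (Suc p) = 0"
      using sq by (intro sandwich_nilpotent)
    then show ?thesis by (simp add: F_def flip: mult.assoc)
  qed
qed

lemma boson_exchange:
  assumes "p \<in> {1..m}" "r \<in> {1..Suc (m + n)}"
  shows "exchange 1 (a p) (a r)" "exchange 1 (ad p) (ad r)"
    "p \<noteq> r \<Longrightarrow> exchange 1 (a p) (ad r)" "p \<noteq> r \<Longrightarrow> exchange 1 (ad p) (a r)"
    "exchange 1 (a r) (a p)" "exchange 1 (ad r) (ad p)"
    "p \<noteq> r \<Longrightarrow> exchange 1 (a r) (ad p)" "p \<noteq> r \<Longrightarrow> exchange 1 (ad r) (a p)"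
proof -
  have s: "swap_sign m n p r = 1" "swap_sign m n r p = 1"
    using assms by (simp_all add: swap_sign_def fermionic_def)
  have p: "p \<in> {1..Suc (m + n)}" using assms by simp
  note ex = site_exchange[OF p assms(2), unfolded s] site_exchange[OF assms(2) p, unfolded s]
  show "exchange 1 (a p) (a r)" "exchange 1 (ad p) (ad r)"
    "exchange 1 (a r) (a p)" "exchange 1 (ad r) (ad p)"
    by (rule ex)+
  assume "p \<noteq> r"
  then show "exchange 1 (a p) (ad r)" "exchange 1 (ad p) (a r)"
    "exchange 1 (a r) (ad p)" "exchange 1 (ad r) (a p)"
    using ex by blast+
qed

lemma boson_relations:
  assumes "p \<in> {1..m}"
  shows "ad p * a p - qq \<bullet> (a p * ad p) = (- qq) \<bullet> h p" "a p * ad p - qq \<bullet> (ad p * a p) = hi p"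
    "exchange (inverse qq) (ad p) ((- qq) \<bullet> h p)" "exchange (inverse qq) (a p) (hi p)"
    "exchange qq (a p) ((- qq) \<bullet> h p)" "exchange qq (ad p) (hi p)"
proof -
  have p: "p \<in> {1..m+n}" "swap_sign m n p p = 1" using assms
    by (auto simp: swap_sign_def fermionic_def)
  show "a p * ad p - qq \<bullet> (ad p * a p) = hi p" using osc_hi[OF p(1)] p(2) by simp
  show "ad p * a p - qq \<bullet> (a p * ad p) = (- qq) \<bullet> h p"
    using p(2) by (simp add: scale_simps flip: osc_h[OF p(1)])
  show "exchange (inverse qq) (ad p) ((- qq) \<bullet> h p)" "exchange qq (a p) ((- qq) \<bullet> h p)"
    using exchange_sym[OF h_exchange(2)[OF p(1)], of p] exchange_sym[OF h_exchange(1)[OF p(1)], of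
      p] assms
    by (auto intro!: exchange_scale_right simp: site_weight_def simp del: scale_minus_left)
  show "exchange (inverse qq) (a p) (hi p)" "exchange qq (ad p) (hi p)"
    using exchange_sym[OF h_exchange(3)[OF p(1)], of p] exchange_sym[OF h_exchange(4)[OF p(1)], of
      p] assms
    by (auto simp: site_weight_def)
qed

lemma distinct_site_commute:
  assumes "s \<noteq> t" "s \<in> {1..m+n}" "t \<in> {1..Suc (m + n)}"
  shows "exchange 1 (a t) (- (c \<bullet> h s))" "exchange 1 (ad t) (- (c \<bullet> h s))"
    "exchange 1 (a t) (c \<bullet> hi s)" "exchange 1 (ad t) (c \<bullet> hi s)" "exchange 1 (a t) (hi s)"
      "exchange 1 (ad t) (hi s)"
    "exchange 1 (a t) (h s)" "exchange 1 (ad t) (h s)"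
  using exchange_sym[OF h_exchange(1)[OF assms(2,3)]] exchange_sym[OF h_exchange(2)[OF assms(2,3)]]
    exchange_sym[OF h_exchange(3)[OF assms(2,3)]] exchange_sym[OF h_exchange(4)[OF assms(2,3)]]
      assms(1)
  by (auto intro: exchange_scale_right exchange_minus_right)

text \<open>Both neighbours of a bosonic node are instances of \<open>oscillator_serre\<close>: the shared site is
  \<open>p + 1\<close> for \<open>r = p + 1\<close> and \<open>p\<close> for \<open>p = r + 1\<close>.\<close>

lemma boson_serre:
  assumes "p < m" "p \<in> {1..m+n}" "r \<in> {1..m+n}" "r = Suc p \<or> p = Suc r"
  shows "bracket (inverse qq) (E p) (bracket qq (E p) (E r)) = 0"
    and "bracket (inverse qq) (F p) (bracket qq (F p) (F r)) = 0"
proof -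
  from assms(4) show "bracket (inverse qq) (E p) (bracket qq (E p) (E r)) = 0"
  proof
    assume r: "r = Suc p"
    then have "r \<in> {1..m}" using assms by simp
    note this[THEN boson_relations(1)] this[THEN boson_relations(3)]
    note osc = oscillator_serre[OF this]
    have "bracket (inverse qq) (a p * ad r) (bracket qq (a p * ad r) (a r * ad (Suc r))) = 0"
      by (rule osc) (use assms r in \<open>auto intro: boson_exchange intro!: distinct_site_commute\<close>)
    then show ?thesis by (simp add: E_def r)
  next
    assume r: "p = Suc r"
    have "p \<in> {1..m}" using assms by simp
    note this[THEN boson_relations(2)] this[THEN boson_relations(4)]
    note osc = oscillator_serre[OF this]
    have "bracket (inverse qq) (ad (Suc p) * a p) (bracket qq (ad (Suc p) * a p) (ad p * a r)) = 0"
      by (rule osc) (use assms r in \<open>auto intro: boson_exchange intro!: distinct_site_commute\<close>)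
    moreover have "ad (Suc p) * a p = E p" "ad p * a r = E r"
      using assms r exchange_commute[OF boson_exchange(4)[of "Suc p" p]] exchange_commute[OF
        boson_exchange(4)[of p r]]
      by (auto simp: E_def)
    ultimately show ?thesis by simp
  qed
  from assms(4) show "bracket (inverse qq) (F p) (bracket qq (F p) (F r)) = 0"
  proof
    assume r: "r = Suc p"
    then have "r \<in> {1..m}" using assms by simp
    note this[THEN boson_relations(2)] this[THEN boson_relations(4)]
    note osc = oscillator_serre[OF this]
    have "bracket (inverse qq) (ad p * a r) (bracket qq (ad p * a r) (ad r * a (Suc r))) = 0"
      by (rule osc) (use assms r in \<open>auto intro: boson_exchange intro!: distinct_site_commute\<close>)
    moreover have "ad p * a r = F p" "ad r * a (Suc r) = F r"
      using assms r exchange_commute[OF boson_exchange(4)[of p r]] exchange_commute[OF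
        boson_exchange(4)[of r "Suc r"]]
      by (auto simp: F_def)
    ultimately show ?thesis by simp
  next
    assume r: "p = Suc r"
    have "p \<in> {1..m}" using assms by simp
    note this[THEN boson_relations(1)] this[THEN boson_relations(3)]
    note osc = oscillator_serre[OF this]
    have "bracket (inverse qq) (a (Suc p) * ad p) (bracket qq (a (Suc p) * ad p) (a p * ad r)) = 0"
      by (rule osc) (use assms r in \<open>auto intro: boson_exchange intro!: distinct_site_commute\<close>)
    then show ?thesis by (simp add: F_def r)
  qed
qed

text \<open>In \<open>odd_triple_serre\<close> the spectators are the letters at the sites \<open>m - 1\<close> and \<open>m + 2\<close>. The
  latter is the fictitious site if \<open>n = 1\<close>, which is why \<open>e\<close> depends on \<open>n\<close>.\<close>

lemma odd_node_serre:
  assumes "2 \<le> m"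
  defines "e \<equiv> swap_sign m n (Suc m) (Suc (Suc m))"
  shows "bracket e (E m) (bracket qq (E (m - 1)) (bracket (- (e * inverse qq)) (E m) (E (Suc m))))
    = 0"
    and "bracket e (F m) (bracket qq (F (m - 1)) (bracket (- (e * inverse qq)) (F m) (F (Suc m))))
      = 0"
proof -
  have m: "m \<in> {1..m}" "m - 1 \<in> {1..m}" using assms by simp_all
  have f: "Suc m \<in> {1..m+n}" "swap_sign m n (Suc m) (Suc m) = - 1"
    using n_pos by (simp_all add: swap_sign_def fermionic_def)
  have e: "e * e = 1" by (simp add: e_def swap_sign_def)
  have osc: "a (Suc m) * ad (Suc m) + inverse qq \<bullet> (ad (Suc m) * a (Suc m)) = h (Suc m)"
    "ad (Suc m) * a (Suc m) + inverse qq \<bullet> (a (Suc m) * ad (Suc m)) = inverse qq \<bullet> hi (Suc m)"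
    using osc_h[OF f(1)] f(2) by (auto simp: scale_simps simp flip: osc_hi[OF f(1)])
  have hc: "exchange (inverse qq) (a (Suc m)) (h (Suc m))"
    "exchange (inverse qq) (ad (Suc m)) (inverse qq \<bullet> hi (Suc m))"
    using exchange_sym[OF h_exchange(1)[OF f(1)], of "Suc m"] exchange_sym[OF h_exchange(4)[OF
      f(1)], of "Suc m"] f(1)
    by (auto intro!: exchange_scale_right simp: site_weight_def)
  have z: "exchange e (ad (Suc m)) (ad (Suc (Suc m)))" "exchange e (a (Suc m)) (a (Suc (Suc m)))"
    unfolding e_def using n_pos by (auto intro!: site_exchange)
  have "bracket e (a m * ad (Suc m)) (bracket qq (a (m - 1) * ad m)
      (bracket (- (e * inverse qq)) (a m * ad (Suc m)) (a (Suc m) * ad (Suc (Suc m))))) = 0"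
    by (rule odd_triple_serre[OF boson_relations(1)[OF m(1)] boson_relations(5)[OF m(1)] osc(2)
      hc(2)
          _ _ _ _ _ _ z(1) e])
      (use assms n_pos in \<open>auto intro: boson_exchange intro!: distinct_site_commute\<close>)
  then show "bracket e (E m) (bracket qq (E (m - 1)) (bracket (- (e * inverse qq)) (E m) (E (Suc
    m)))) = 0"
    using assms by (simp add: E_def)
  have "bracket e (ad m * a (Suc m)) (bracket qq (ad (m - 1) * a m)
      (bracket (- (e * inverse qq)) (ad m * a (Suc m)) (ad (Suc m) * a (Suc (Suc m))))) = 0"
    by (rule odd_triple_serre[OF boson_relations(2)[OF m(1)] boson_relations(6)[OF m(1)] osc(1)
      hc(1)
          _ _ _ _ _ _ z(2) e])
      (use assms n_pos in \<open>auto intro: boson_exchange intro!: distinct_site_commute\<close>)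
  moreover have "ad m * a (Suc m) = F m" "ad (m - 1) * a m = F (m - 1)"
    using assms n_pos exchange_commute[OF boson_exchange(4)[of m "Suc m"]] exchange_commute[OF
      boson_exchange(4)[of "m - 1" m]]
    by (auto simp: F_def)
  moreover have "ad (Suc m) * a (Suc (Suc m)) = e \<bullet> F (Suc m)"
    using site_exchange(4)[of "Suc m" "Suc (Suc m)"] n_pos by (auto simp: F_def e_def exchange_def)
  ultimately have "e \<bullet> bracket e (F m) (bracket qq (F (m - 1)) (bracket (- (e * inverse qq)) (F m)
    (F (Suc m)))) = 0"
    by (simp add: bracket_scale_right)
  then show "bracket e (F m) (bracket qq (F (m - 1)) (bracket (- (e * inverse qq)) (F m) (F (Suc
    m)))) = 0"
    using e by auto
qed

end

section \<open>The Fock space as a module over the Clifford algebra\<close>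

abbreviation cl_gens :: "nat \<Rightarrow> nat \<Rightarrow> cl_gen set" where
  "cl_gens m n \<equiv> bos_gens m \<union> ferm_gens n"

abbreviation cl_ideal :: "nat \<Rightarrow> nat \<Rightarrow> (cl_gen word \<Rightarrow>\<^sub>0 Cq) set" where
  "cl_ideal m n \<equiv> Idl\<^bsub>free_algebra (cl_gens m n)\<^esub> (cl_relators m n)"

lemma cl_relators_closed: "cl_relators m n \<subseteq> carrier (free_algebra (cl_gens m n))"
proof -
  have "ferm_relators n \<subseteq> carrier (free_algebra (cl_gens m n))"
    by (auto simp: ferm_relators_def ferm_gens_def intro!: free_algebra_closed
      free_algebra_diff_closed)
  moreover have "bos_relators m \<subseteq> carrier (free_algebra (cl_gens m n))"
    by (auto simp: bos_relators_def bos_gens_def intro!: free_algebra_closed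
      free_algebra_diff_closed)
  ultimately show ?thesis
    by (auto simp: cl_relators_def)
qed

interpretation Fock: linear_subspace "Fock m n"
proof
  fix v w :: "(nat \<Rightarrow> nat) \<Rightarrow>\<^sub>0 Cq" and c
  show "0 \<in> Fock m n" by (simp add: Fock_def)
  assume v: "v \<in> Fock m n"
  then show "smul c v \<in> Fock m n" using keys_smul[of c v] by (auto simp: Fock_def)
  assume "w \<in> Fock m n"
  with v show "v + w \<in> Fock m n" using keys_add[of v w] by (auto simp: Fock_def)
qed

lemma ket_in_Fock [simp]: "ket t \<in> Fock m n \<longleftrightarrow> t \<in> fock_index m n"
  by (simp add: Fock_def ket_def)

lemma ket_nonzero [simp]: "ket t \<noteq> 0"
proof
  assume "ket t = 0"
  then have "Poly_Mapping.lookup (ket t) t = 0" by simp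
  then show False by (simp add: ket_def)
qed

lemma vacuum_in_Fock: "vacuum \<in> Fock m n"
  by (simp add: vacuum_def fock_index_def)

lemma single_conv_ket: "Poly_Mapping.single t c = smul c (ket t)"
  by (simp add: ket_def)

lemma Fock_induct [consumes 1, case_names zero add smul ket]:
  assumes "v \<in> Fock m n" "P 0" "\<And>v w. P v \<Longrightarrow> P w \<Longrightarrow> P (v + w)"
    and "\<And>c v. P v \<Longrightarrow> P (smul c v)" and "\<And>t. t \<in> fock_index m n \<Longrightarrow> P (ket t)"
  shows "P v"
proof -
  from assms(1) have "Poly_Mapping.keys v \<subseteq> fock_index m n" by (simp add: Fock_def)
  then show ?thesis
    by (induction rule: linear_combination_induct) (auto intro: assms simp: single_conv_ket)
qed

lemma fock_index_boson: "t \<in> fock_index m n \<Longrightarrow> i \<in> {1..m} \<Longrightarrow> t(i := x) \<in> fock_index m n"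
  and fock_index_fermion: "t \<in> fock_index m n \<Longrightarrow> j \<in> {1..n} \<Longrightarrow> y \<in> {0, 1} \<Longrightarrow> t(m + j :=
    y) \<in> fock_index m n"
  by (auto simp: fock_index_def)

lemma cl_gens_Fock:
  assumes "g \<in> cl_gens m n" "v \<in> Fock m n"
  shows "linear_ext (cl_on_ket m g) v \<in> Fock m n"
  using assms(2)
proof (induction rule: Fock_induct)
  case (ket t)
  have "cl_on_ket m g t \<in> Fock m n"
    using assms(1) ket
    by (auto simp: bos_gens_def ferm_gens_def Fock.zero_mem fock_index_boson
        fock_index_fermion[of t m n _ 0] fock_index_fermion[of t m n _ 1, simplified]
        intro!: Fock.smul_mem)
  then show ?case by simp
qed (auto simp: linear_ext_add linear_ext_smul Fock.zero_mem intro: Fock.add_mem Fock.smul_mem)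

lemma fermion_sign_cong:
  assumes "\<And>l. l \<in> {1..<j} \<Longrightarrow> t (m + l) = t' (m + l)"
  shows "fermion_sign m j t = fermion_sign m j t'"
proof -
  have "(\<Sum>l = 1..<j. t (m + l)) = (\<Sum>l = 1..<j. t' (m + l))"
    using assms by (rule sum.cong[OF refl])
  then show ?thesis by (simp add: fermion_sign_def)
qed

lemma fermion_sign_upd:
  "i \<le> m \<Longrightarrow> fermion_sign m j (t(i := x)) = fermion_sign m j t"
  "j \<le> i \<Longrightarrow> fermion_sign m j (t(m + i := x)) = fermion_sign m j t"
  by (auto intro!: fermion_sign_cong)

text \<open>This change of sign is the source of the anticommutation of fermions at distinct sites.\<close>

lemma fermion_sign_flip:
  assumes "1 \<le> i" "i < j"
  shows "t (m + i) = 0 \<Longrightarrow> fermion_sign m j (t(m + i := Suc 0)) = - fermion_sign m j t"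
    and "t (m + i) = Suc 0 \<Longrightarrow> fermion_sign m j (t(m + i := 0)) = - fermion_sign m j t"
proof -
  have "(\<Sum>l = 1..<j. (t(m + i := x)) (m + l)) = x + (\<Sum>l\<in>{1..<j} - {i}. t (m + l))" for x
    using assms by (subst sum.remove[of _ i]) (auto intro!: sum.cong)
  moreover have "(\<Sum>l = 1..<j. t (m + l)) = t (m + i) + (\<Sum>l\<in>{1..<j} - {i}. t (m + l))"
    using assms by (subst sum.remove[of _ i]) auto
  ultimately show
    "t (m + i) = 0 \<Longrightarrow> fermion_sign m j (t(m + i := Suc 0)) = - fermion_sign m j t"
    "t (m + i) = Suc 0 \<Longrightarrow> fermion_sign m j (t(m + i := 0)) = - fermion_sign m j t"
    by (simp_all add: fermion_sign_def)
qed

lemma fermion_sign_square [simp]: "fermion_sign m j t * fermion_sign m j t = 1"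
  by (simp add: fermion_sign_def flip: power_add)

lemma fermion_sign_nonzero [simp]: "fermion_sign m j t \<noteq> 0"
  by (simp add: fermion_sign_def)

lemma qnum_mult: "(qq - inverse qq) * qnum t = qq ^ t - inverse qq ^ t"
  using qq_diff_nonzero by (simp add: qnum_def)

lemma qnum_Suc: "qnum (Suc t) - qq * qnum t = inverse (qq ^ t)"
  "qnum (Suc t) - inverse qq * qnum t = qq ^ t"
proof -
  have "(qq - inverse qq) * (qnum (Suc t) - c * qnum t) =
      (qq ^ Suc t - inverse qq ^ Suc t) - c * (qq ^ t - inverse qq ^ t)" for c
    by (simp only: right_diff_distrib[of "qq - inverse qq"
      "qnum (Suc t)"] mult.left_commute[of _ c] qnum_mult)
  note step = this
  have "(qq - inverse qq) * (qnum (Suc t) - qq * qnum t) = (qq - inverse qq) * inverse (qq ^ t)"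
    "(qq - inverse qq) * (qnum (Suc t) - inverse qq * qnum t) = (qq - inverse qq) * qq ^ t"
    unfolding step by (simp_all add: algebra_simps power_inverse)
  then show "qnum (Suc t) - qq * qnum t = inverse (qq ^ t)"
    "qnum (Suc t) - inverse qq * qnum t = qq ^ t"
    using qq_diff_nonzero mult_left_cancel by blast+
qed

text \<open>At an empty site the annihilator lowers the occupation number \<open>0\<close> to \<open>0\<close> by truncated
  subtraction; this does no harm because the coefficient \<^term>\<open>qnum 0\<close> vanishes. The local fact \<open>num\<close>
  expresses that the number operator is diagonal in both cases.\<close>

lemma bos_relators_annihilate_ket:
  assumes "r \<in> bos_relators m"
  shows "free_action (cl_on_ket m) r (ket t) = 0"
proof -
  let ?act = "\<lambda>x. free_action (cl_on_ket m) x (ket t)"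
  have num: "smul (qnum (t i)) (ket (t(i := Suc (t i - Suc 0)))) = smul (qnum (t i)) (ket t)" for i
    by (cases "t i") (auto simp: fun_upd_idem)
  have "?act (cU i * cUinv i - 1) = 0" "?act (cUinv i * cU i - 1) = 0"
    "?act (cU i * cU j - cU j * cU i) = 0" for i j
    by (simp_all add: linear_ext_smul mult.commute)
  moreover have "?act (cPhi i * cPhiD i - smul qq (cPhiD i * cPhi i) - cUinv i) = 0"
    "?act (cPhi i * cPhiD i - smul (inverse qq) (cPhiD i * cPhi i) - cU i) = 0" for i
  proof -
    have "?act (cPhi i * cPhiD i) = smul (qnum (Suc (t i))) (ket t)"
      by simp
    moreover have "?act (cPhiD i * cPhi i) = smul (qnum (t i)) (ket t)"
      by (simp add: linear_ext_smul num)
    moreover have "?act (cUinv i) = smul (inverse (qq ^ t i)) (ket t)"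
      "?act (cU i) = smul (qq ^ t i) (ket t)"
      by simp_all
    ultimately show "?act (cPhi i * cPhiD i - smul qq (cPhiD i * cPhi i) - cUinv i) = 0"
      "?act (cPhi i * cPhiD i - smul (inverse qq) (cPhiD i * cPhi i) - cU i) = 0"
      by (simp_all only: free_action_diff free_action_simps smul_simps smul_left_diff qnum_Suc
        diff_self)
  qed
  moreover have "?act (cU i * cPhi j * cUinv i - smul (if i =
    j then inverse qq else 1) (cPhi j)) = 0"
    "?act (cU i * cPhiD j * cUinv i - smul (if i = j then qq else 1) (cPhiD j)) = 0" for i j
  proof -
    have cancel: "x * (inverse x * y) = y" if "x \<noteq> 0" for x y :: Cq
      using that by (simp add: field_simps)
    show "?act (cU i * cPhi j * cUinv i - smul (if i = j then inverse qq else 1) (cPhi j)) = 0"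
      by (cases "t j") (auto simp: linear_ext_smul mult_ac cancel)
    show "?act (cU i * cPhiD j * cUinv i - smul (if i = j then qq else 1) (cPhiD j)) = 0"
      by (auto simp: linear_ext_smul mult_ac cancel)
  qed
  moreover have "?act (cPhi i * cPhi j - cPhi j * cPhi i) = 0"
    "?act (cPhiD i * cPhiD j - cPhiD j * cPhiD i) = 0" for i j
  proof -
    have twist: "t(i := x, j := y) = t(j := y, i := x)" if "i \<noteq> j" for x y
      using that by (rule fun_upd_twist)
    show "?act (cPhi i * cPhi j - cPhi j * cPhi i) = 0"
      "?act (cPhiD i * cPhiD j - cPhiD j * cPhiD i) = 0"
      by (cases "i = j"; simp add: linear_ext_smul twist mult.commute)+
  qed
  moreover have "?act (cPhi i * cPhiD j - cPhiD j * cPhi i) = 0" if "j \<noteq> i" for i j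
    using that by (simp add: linear_ext_smul fun_upd_twist[OF that])
  ultimately show ?thesis
    using assms unfolding bos_relators_def
    by (elim UnE UN_E insertE emptyE DiffE) (simp_all only: singleton_iff)
qed

lemma ferm_relators_annihilate_ket:
  assumes "r \<in> ferm_relators n" "t \<in> fock_index m n"
  shows "free_action (cl_on_ket m) r (ket t) = 0"
proof -
  let ?act = "\<lambda>x. free_action (cl_on_ket m) x (ket t)"
  have t: "t (m + i) = 0 \<or> t (m + i) = Suc 0" if "i \<in> {1..n}" for i
    using assms(2) that by (auto simp: fock_index_def)
  have cancel: "qq * (inverse qq * x) = x" for x
    by (simp add: field_simps)
  have idem: "t(m + i := 0) = t" if "t (m + i) = 0" for i
    using that by (auto simp: fun_eq_iff)
  have idem': "t(m + i := Suc 0) = t" if "t (m + i) = Suc 0" for i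
    using that by (auto simp: fun_eq_iff)
  have "?act (cV i * cVinv i - 1) = 0" "?act (cVinv i * cV i - 1) = 0"
    "?act (cV i * cV j - cV j * cV i) = 0" for i j
    by (simp_all add: linear_ext_smul mult.commute)
  moreover have "?act (cPsi i * cPsiD i + smul qq (cPsiD i * cPsi i) - cVinv i) = 0"
    "?act (cPsi i * cPsiD i + smul (inverse qq) (cPsiD i * cPsi i) - cV i) = 0" if "i \<in> {1..n}"
      for i
  proof -
    have upd: "fermion_sign m i (t(m + i := x)) = fermion_sign m i t" for x
      by (simp add: fermion_sign_upd)
    have "?act (cPsi i * cPsiD i) = (if t (m + i) = 0 then ket t else 0)"
      by (simp add: linear_ext_smul upd idem)
    moreover have "?act (cPsiD i * cPsi i) = (if t (m + i) = Suc 0 then ket t else 0)"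
      by (simp add: linear_ext_smul upd idem')
    moreover have "?act (cVinv i) = smul (qq ^ t (m + i)) (ket t)"
      "?act (cV i) = smul (inverse (qq ^ t (m + i))) (ket t)"
      by simp_all
    ultimately show "?act (cPsi i * cPsiD i + smul qq (cPsiD i * cPsi i) - cVinv i) = 0"
      "?act (cPsi i * cPsiD i + smul (inverse qq) (cPsiD i * cPsi i) - cV i) = 0"
      unfolding free_action_diff free_action_simps(2,3)
      using t[OF that] by auto
  qed
  moreover have "?act (cV i * cPsi j * cVinv i - smul (if i = j then qq else 1) (cPsi j)) = 0"
    "?act (cV i * cPsiD j * cVinv i - smul (if i = j then inverse qq else 1) (cPsiD j)) = 0"
    if "i \<in> {1..n}" "j \<in> {1..n}" for i j
    using t[OF that(1)] t[OF that(2)] by (auto simp: linear_ext_smul cancel mult.commute)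
  moreover have "?act (cPsi i * cPsi j + cPsi j * cPsi i) = 0"
    "?act (cPsiD i * cPsiD j + cPsiD j * cPsiD i) = 0"
    "i \<noteq> j \<Longrightarrow> ?act (cPsi i * cPsiD j + cPsiD j * cPsi i) = 0"
    if "i \<in> {1..n}" "j \<in> {1..n}" for i j
  proof -
    consider "i = j" | "i < j" | "j < i" by linarith
    note trichotomy = this
    have twist: "t(m + i := x, m + j := y) = t(m + j := y, m + i := x)" if "i \<noteq> j" for x y
      using that by (simp add: fun_upd_twist)
    show "?act (cPsi i * cPsi j + cPsi j * cPsi i) = 0"
      using t[OF that(1)] t[OF that(2)] that
      by (cases rule: trichotomy)
        (auto simp: linear_ext_smul fermion_sign_upd fermion_sign_flip twist smul_left_add)
    show "?act (cPsiD i * cPsiD j + cPsiD j * cPsiD i) = 0"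
      using t[OF that(1)] t[OF that(2)] that
      by (cases rule: trichotomy)
        (auto simp: linear_ext_smul fermion_sign_upd fermion_sign_flip twist smul_left_add)
    show "?act (cPsi i * cPsiD j + cPsiD j * cPsi i) = 0" if "i \<noteq> j"
      using t[OF \<open>i \<in> {1..n}\<close>] t[OF \<open>j \<in> {1..n}\<close>] that \<open>i \<in> {1..n}\<close> \<open>j \<in> {1..n}\<close>
      by (cases rule: trichotomy)
        (auto simp: linear_ext_smul fermion_sign_upd fermion_sign_flip twist smul_left_add)
  qed
  ultimately show ?thesis
    using assms(1) unfolding ferm_relators_def
    by (elim UnE UN_E insertE emptyE DiffE) (simp_all only: singleton_iff not_sym)
qed

lemma mixed_relators_annihilate_ket:
  assumes "b \<in> bos_gens m" "f \<in> ferm_gens n"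
  shows "free_action (cl_on_ket m) (gen b * gen f - gen f * gen b) (ket t) = 0"
proof -
  obtain i where i: "i \<in> {1..m}" "b = GPhi i \<or> b = GPhiD i \<or> b = GU i \<or> b = GUinv i"
    using assms(1) by (auto simp: bos_gens_def)
  obtain j where j: "j \<in> {1..n}" "f = GPsi j \<or> f = GPsiD j \<or> f = GV j \<or> f = GVinv j"
    using assms(2) by (auto simp: ferm_gens_def)
  have neq: "m + j \<noteq> i" "i \<noteq> m + j" using i j by auto
  have upd: "t(i := x, m + j := y) = t(m + j := y, i := x)" for x y
    using neq by (auto simp: fun_eq_iff)
  have sign: "fermion_sign m j (t(i := x)) = fermion_sign m j t" for x
    using i by (simp add: fermion_sign_upd)
  show ?thesis
    using i(2) j(2) by (elim disjE) (simp_all add: linear_ext_smul upd sign neq mult.commute)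
qed

lemma cl_relators_annihilate:
  assumes "r \<in> cl_relators m n" "v \<in> Fock m n"
  shows "free_action (cl_on_ket m) r v = 0"
  using assms(2)
proof (induction rule: Fock_induct)
  case (ket t)
  then show ?case
    using assms(1) bos_relators_annihilate_ket ferm_relators_annihilate_ket
      mixed_relators_annihilate_ket
    by (auto simp: cl_relators_def)
qed (simp_all add: free_action_vec)

lemma cl_ideal_annihilates:
  "x \<in> cl_ideal m n \<Longrightarrow> v \<in> Fock m n \<Longrightarrow> free_action (cl_on_ket m) x v = 0"
  by (rule Fock.free_action_Idl[OF cl_gens_Fock cl_relators_closed cl_relators_annihilate])

text \<open>The Fock space shows that the Clifford algebra is not the zero ring.\<close>

lemma one_not_in_cl_ideal: "1 \<notin> cl_ideal m n"
proof
  assume "1 \<in> cl_ideal m n"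
  then have "vacuum = 0"
    using cl_ideal_annihilates[OF _ vacuum_in_Fock] by fastforce
  then show False by (simp add: vacuum_def)
qed

section \<open>The presented Clifford algebra as a type\<close>

text \<open>The relations of the quantum supergroup must hold in the presented algebra itself, for all
  ranks \<open>m\<close> and \<open>n\<close>. To calculate there with ring operations, the presented algebra has to be a
  type, and a type cannot depend on the variables \<open>m\<close> and \<open>n\<close>. The way out is a fixed choice of
  the ranks: \<open>test_rank\<close> is a pair for which the relations fail, if there is any. Once they are
  shown to hold for this one pair, they hold for all.\<close>

definition respects_relators :: "nat \<Rightarrow> nat \<Rightarrow> bool" where
  "respects_relators m n \<longleftrightarrow> (\<forall>r\<in>uq_relators m n. free_lift (spinor_gen m n) r \<in> cl_ideal m n)"

definition test_rank :: "nat \<times> nat" where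
  "test_rank = (SOME (m, n). 1 \<le> m \<and> 1 \<le> n \<and> \<not> respects_relators m n)"

abbreviation m0 :: nat where "m0 \<equiv> fst test_rank"
abbreviation n0 :: nat where "n0 \<equiv> snd test_rank"

text \<open>The type of words contains letters of all indices, while the ideal of relations lives in
  the free algebra on the generators of the given ranks. Sending all other letters to \<open>0\<close>
  retracts the former onto the latter, and the preimage of the ideal is an ideal of the whole
  ring.\<close>

definition restrict_letters :: "(cl_gen word \<Rightarrow>\<^sub>0 Cq) \<Rightarrow> (cl_gen word \<Rightarrow>\<^sub>0 Cq)" where
  "restrict_letters = free_lift (\<lambda>g. if g \<in> cl_gens m0 n0 then gen g else 0)"

lemma restrict_letters_closed: "restrict_letters x \<in> carrier (free_algebra (cl_gens m0 n0))"
  unfolding restrict_letters_def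
  by (rule free_lift_in_free_algebra[of UNIV])
    (simp_all del: Un_iff, simp add: carrier_free_algebra)

lemma restrict_letters_id: "x \<in> carrier (free_algebra (cl_gens m0 n0)) \<Longrightarrow> restrict_letters x = x"
proof -
  assume "x \<in> carrier (free_algebra (cl_gens m0 n0))"
  then have "restrict_letters x = free_lift gen x"
    unfolding restrict_letters_def by (rule free_lift_cong) (simp del: Un_iff)
  then show ?thesis by (simp add: free_lift_gen_id)
qed

definition cl_kernel :: "(cl_gen word \<Rightarrow>\<^sub>0 Cq) set" where
  "cl_kernel = {x. restrict_letters x \<in> cl_ideal m0 n0}"

lemma cl_kernel_closed:
  "0 \<in> cl_kernel" "x \<in> cl_kernel \<Longrightarrow> y \<in> cl_kernel \<Longrightarrow> x + y \<in> cl_kernel"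
  "x \<in> cl_kernel \<Longrightarrow> - x \<in> cl_kernel" "x \<in> cl_kernel \<Longrightarrow> smul c x \<in> cl_kernel"
  "x \<in> cl_kernel \<Longrightarrow> z * x \<in> cl_kernel" "x \<in> cl_kernel \<Longrightarrow> x * z \<in> cl_kernel"
proof -
  note closed = Idl_closed[OF cl_relators_closed[of m0 n0]]
  have hom: "restrict_letters 0 = 0" "restrict_letters (x + y) =
    restrict_letters x + restrict_letters y"
    "restrict_letters (- x) = - restrict_letters x" "restrict_letters (smul c x) =
      smul c (restrict_letters x)"
    "restrict_letters (z * x) = restrict_letters z * restrict_letters x"
    "restrict_letters (x * z) = restrict_letters x * restrict_letters z"
    by (simp_all only: restrict_letters_def free_lift_simps free_lift_uminus free_lift_mult)
  show "0 \<in> cl_kernel" "x \<in> cl_kernel \<Longrightarrow> y \<in> cl_kernel \<Longrightarrow> x + y \<in> cl_kernel"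
    "x \<in> cl_kernel \<Longrightarrow> - x \<in> cl_kernel" "x \<in> cl_kernel \<Longrightarrow> smul c x \<in> cl_kernel"
    "x \<in> cl_kernel \<Longrightarrow> z * x \<in> cl_kernel" "x \<in> cl_kernel \<Longrightarrow> x * z \<in> cl_kernel"
    by (simp_all only: cl_kernel_def mem_Collect_eq hom closed restrict_letters_closed)
qed

lemma cl_kernel_iff:
  "x \<in> carrier (free_algebra (cl_gens m0 n0)) \<Longrightarrow> x \<in> cl_kernel \<longleftrightarrow> x \<in> cl_ideal m0 n0"
  by (simp add: cl_kernel_def restrict_letters_id)

quotient_type cliff = "cl_gen word \<Rightarrow>\<^sub>0 Cq" / "\<lambda>x y. x - y \<in> cl_kernel"
proof (rule equivpI)
  show "reflp (\<lambda>x y. x - y \<in> cl_kernel)"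
    by (auto intro!: reflpI simp: cl_kernel_closed)
  show "symp (\<lambda>x y. x - y \<in> cl_kernel)"
    by (auto intro!: sympI dest: cl_kernel_closed(3))
  show "transp (\<lambda>x y. x - y \<in> cl_kernel)"
    by (rule transpI) (use cl_kernel_closed(2) in \<open>fastforce simp: algebra_simps\<close>)
qed

instantiation cliff :: ring_1
begin

lift_definition zero_cliff :: cliff is 0 .
lift_definition one_cliff :: cliff is 1 .
lift_definition plus_cliff :: "cliff \<Rightarrow> cliff \<Rightarrow> cliff" is "(+)"
  using cl_kernel_closed(2) by (metis add_diff_add)
lift_definition uminus_cliff :: "cliff \<Rightarrow> cliff" is uminus
  using cl_kernel_closed(3) by (metis minus_diff_minus)
lift_definition minus_cliff :: "cliff \<Rightarrow> cliff \<Rightarrow> cliff" is "(-)"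
proof -
  fix x x' y y' :: "cl_gen word \<Rightarrow>\<^sub>0 Cq"
  assume "x - x' \<in> cl_kernel" "y - y' \<in> cl_kernel"
  then have "(x - x') + - (y - y') \<in> cl_kernel" by (intro cl_kernel_closed)
  then show "x - y - (x' - y') \<in> cl_kernel" by (simp add: algebra_simps)
qed
lift_definition times_cliff :: "cliff \<Rightarrow> cliff \<Rightarrow> cliff" is "(*)"
proof -
  fix x x' y y' :: "cl_gen word \<Rightarrow>\<^sub>0 Cq"
  assume "x - x' \<in> cl_kernel" "y - y' \<in> cl_kernel"
  then have "(x - x') * y + x' * (y - y') \<in> cl_kernel" by (intro cl_kernel_closed)
  then show "x * y - x' * y' \<in> cl_kernel" by (simp add: algebra_simps)
qed

instance
proof
  fix x y z :: cliff
  obtain x' y' z' where "x = abs_cliff x'" "y = abs_cliff y'" "z = abs_cliff z'"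
    by (metis Quotient3_abs_rep[OF Quotient3_cliff])
  note reps = this plus_cliff.abs_eq minus_cliff.abs_eq uminus_cliff.abs_eq times_cliff.abs_eq
  show "x + y + z = x + (y + z)" "x + y = y + x"
    "x * y * z = x * (y * z)" "(x + y) * z = x * z + y * z" "x * (y + z) = x * y + x * z"
    by (simp_all only: reps algebra_simps)
  show "x - y = x + - y"
    by (simp only: reps diff_conv_add_uminus)
  show "0 + x = x" "- x + x = 0"
    by (simp_all only: reps zero_cliff.abs_eq add_0_left left_minus)
  show "(0 :: cliff) \<noteq> 1"
  proof
    assume "(0 :: cliff) = 1"
    then have "0 - 1 \<in> cl_kernel"
      by (simp only: zero_cliff.abs_eq one_cliff.abs_eq cliff.abs_eq_iff)
    then have "1 \<in> cl_kernel"
      using cl_kernel_closed(3) by fastforce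
    then show False
      using one_not_in_cl_ideal by (simp add: cl_kernel_iff free_algebra_closed)
  qed
  show "1 * x = x" "x * 1 = x"
    by (simp_all only: reps one_cliff.abs_eq mult_1_left mult_1_right)
qed

end

definition cliff_scale :: "Cq \<Rightarrow> cliff \<Rightarrow> cliff" where
  "cliff_scale c x = abs_cliff (smul c 1) * x"

lemma cliff_scale_abs: "cliff_scale c (abs_cliff x) = abs_cliff (smul c x)"
  by (simp add: cliff_scale_def times_cliff.abs_eq smul_mult_left)

lemmas cliff_ops_abs = plus_cliff.abs_eq minus_cliff.abs_eq uminus_cliff.abs_eq times_cliff.abs_eq
  cliff_scale_abs one_cliff.abs_eq zero_cliff.abs_eq

interpretation cliff: assoc_algebra cliff_scale
proof
  fix c d :: Cq and x y :: cliff
  obtain x' y' where "x = abs_cliff x'" "y = abs_cliff y'"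
    by (metis Quotient3_abs_rep[OF Quotient3_cliff])
  then show "cliff_scale c (x + y) = cliff_scale c x + cliff_scale c y"
    "cliff_scale (c + d) x = cliff_scale c x + cliff_scale d x"
    "cliff_scale c (cliff_scale d x) = cliff_scale (c * d) x" "cliff_scale 1 x = x"
    "cliff_scale c x * y = cliff_scale c (x * y)" "x * cliff_scale c y = cliff_scale c (x * y)"
    by (simp_all add: cliff_ops_abs smul_distribs smul_mult_left smul_mult_right)
qed

lemma abs_cliff_eq_0_iff: "abs_cliff x = 0 \<longleftrightarrow> x \<in> cl_kernel"
  unfolding zero_cliff.abs_eq cliff.abs_eq_iff by (simp only: diff_0_right)

lemma abs_cliff_relator: "r \<in> cl_relators m0 n0 \<Longrightarrow> abs_cliff r = 0"
  unfolding abs_cliff_eq_0_iff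
  by (subst cl_kernel_iff) (rule subsetD[OF cl_relators_closed] Idl_memI; assumption)+

definition site_a :: "nat \<Rightarrow> cliff" where
  "site_a p = (if p \<le> m0 then abs_cliff (cPhi p) else
    if p \<le> m0 + n0 then abs_cliff (cPsi (p - m0)) else 1)"
definition site_ad :: "nat \<Rightarrow> cliff" where
  "site_ad p = (if p \<le> m0 then abs_cliff (cPhiD p) else
    if p \<le> m0 + n0 then abs_cliff (cPsiD (p - m0))
     else cliff_scale (sqrt_neg1 * inverse (qhalf - inverse qhalf)) 1)"
definition site_h :: "nat \<Rightarrow> cliff" where
  "site_h p = (if p \<le> m0 then abs_cliff (cU p) else abs_cliff (cV (p - m0)))"
definition site_hi :: "nat \<Rightarrow> cliff" where
  "site_hi p = (if p \<le> m0 then abs_cliff (cUinv p) else abs_cliff (cVinv (p - m0)))"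

lemma mixed_exchange:
  assumes "b \<in> bos_gens m0" "f \<in> ferm_gens n0"
  shows "cliff.exchange 1 (abs_cliff (gen b)) (abs_cliff (gen f))"
    and "cliff.exchange 1 (abs_cliff (gen f)) (abs_cliff (gen b))"
proof -
  have "gen b * gen f - gen f * gen b \<in> cl_relators m0 n0"
    using assms by (auto simp: cl_relators_def)
  from abs_cliff_relator[OF this]
  show "cliff.exchange 1 (abs_cliff (gen b)) (abs_cliff (gen f))"
    "cliff.exchange 1 (abs_cliff (gen f)) (abs_cliff (gen b))"
    by (simp_all add: cliff.exchange_def flip: cliff_ops_abs)
qed

lemma bos_exchange:
  assumes "i \<in> {1..m0}" "j \<in> {1..m0}"
  shows "cliff.exchange 1 (abs_cliff (cPhi i)) (abs_cliff (cPhi j))"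
    "cliff.exchange 1 (abs_cliff (cPhiD i)) (abs_cliff (cPhiD j))"
    "i \<noteq> j \<Longrightarrow> cliff.exchange 1 (abs_cliff (cPhi i)) (abs_cliff (cPhiD j))"
    "abs_cliff (cU i) * abs_cliff (cUinv i) = 1" "abs_cliff (cUinv i) * abs_cliff (cU i) = 1"
    "cliff.exchange 1 (abs_cliff (cU i)) (abs_cliff (cU j))"
    "cliff.exchange (if i = j then inverse qq else 1) (abs_cliff (cU i)) (abs_cliff (cPhi j))"
    "cliff.exchange (if i = j then qq else 1) (abs_cliff (cU i)) (abs_cliff (cPhiD j))"
    "abs_cliff (cPhi i) * abs_cliff (cPhiD i) - cliff_scale qq (abs_cliff (cPhiD i) * abs_cliff
      (cPhi i)) = abs_cliff (cUinv i)"
    "abs_cliff (cPhi i) * abs_cliff (cPhiD i) - cliff_scale (inverse qq) (abs_cliff (cPhiD i) *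
      abs_cliff (cPhi i)) = abs_cliff (cU i)"
proof -
  have rel: "abs_cliff r = 0" if "r \<in> bos_relators m0" for r
    using that by (intro abs_cliff_relator) (simp add: cl_relators_def)
  have "abs_cliff (cU i * cUinv i - 1) = 0" "abs_cliff (cUinv i * cU i - 1) = 0"
    "abs_cliff (cPhi i * cPhiD i - smul qq (cPhiD i * cPhi i) - cUinv i) = 0"
    "abs_cliff (cPhi i * cPhiD i - smul (inverse qq) (cPhiD i * cPhi i) - cU i) = 0"
    "abs_cliff (cU i * cU j - cU j * cU i) = 0"
    "abs_cliff (cU i * cPhi j * cUinv i - smul (if i = j then inverse qq else 1) (cPhi j)) = 0"
    "abs_cliff (cU i * cPhiD j * cUinv i - smul (if i = j then qq else 1) (cPhiD j)) = 0"
    "abs_cliff (cPhi i * cPhi j - cPhi j * cPhi i) = 0"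
    "abs_cliff (cPhiD i * cPhiD j - cPhiD j * cPhiD i) = 0"
    by (rule rel, use assms in \<open>unfold bos_relators_def, blast\<close>)+
  note rels = this[unfolded cliff_ops_abs[symmetric] right_minus_eq]
  show "cliff.exchange 1 (abs_cliff (cPhi i)) (abs_cliff (cPhi j))"
    "cliff.exchange 1 (abs_cliff (cPhiD i)) (abs_cliff (cPhiD j))"
    "cliff.exchange 1 (abs_cliff (cU i)) (abs_cliff (cU j))"
    using rels by (simp_all add: cliff.exchange_def)
  show "abs_cliff (cU i) * abs_cliff (cUinv i) = 1" "abs_cliff (cUinv i) * abs_cliff (cU i) = 1"
    "abs_cliff (cPhi i) * abs_cliff (cPhiD i) - cliff_scale qq (abs_cliff (cPhiD i) * abs_cliff
      (cPhi i)) = abs_cliff (cUinv i)"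
    "abs_cliff (cPhi i) * abs_cliff (cPhiD i) - cliff_scale (inverse qq) (abs_cliff (cPhiD i) *
      abs_cliff (cPhi i)) = abs_cliff (cU i)"
    by (fact rels)+
  show "cliff.exchange (if i = j then inverse qq else 1) (abs_cliff (cU i)) (abs_cliff (cPhi j))"
    "cliff.exchange (if i = j then qq else 1) (abs_cliff (cU i)) (abs_cliff (cPhiD j))"
    by (rule cliff.exchange_of_conjugate; fact rels)+
  assume "i \<noteq> j"
  then have "abs_cliff (cPhi i * cPhiD j - cPhiD j * cPhi i) = 0"
    by (intro rel, use assms in \<open>unfold bos_relators_def, blast\<close>)
  then show "cliff.exchange 1 (abs_cliff (cPhi i)) (abs_cliff (cPhiD j))"
    by (simp add: cliff.exchange_def flip: cliff_ops_abs)
qed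

lemma ferm_exchange:
  assumes "i \<in> {1..n0}" "j \<in> {1..n0}"
  shows "cliff.exchange (- 1) (abs_cliff (cPsi i)) (abs_cliff (cPsi j))"
    "cliff.exchange (- 1) (abs_cliff (cPsiD i)) (abs_cliff (cPsiD j))"
    "i \<noteq> j \<Longrightarrow> cliff.exchange (- 1) (abs_cliff (cPsi i)) (abs_cliff (cPsiD j))"
    "abs_cliff (cV i) * abs_cliff (cVinv i) = 1" "abs_cliff (cVinv i) * abs_cliff (cV i) = 1"
    "cliff.exchange 1 (abs_cliff (cV i)) (abs_cliff (cV j))"
    "cliff.exchange (if i = j then qq else 1) (abs_cliff (cV i)) (abs_cliff (cPsi j))"
    "cliff.exchange (if i = j then inverse qq else 1) (abs_cliff (cV i)) (abs_cliff (cPsiD j))"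
    "abs_cliff (cPsi i) * abs_cliff (cPsiD i) + cliff_scale qq (abs_cliff (cPsiD i) * abs_cliff
      (cPsi i)) = abs_cliff (cVinv i)"
    "abs_cliff (cPsi i) * abs_cliff (cPsiD i) + cliff_scale (inverse qq) (abs_cliff (cPsiD i) *
      abs_cliff (cPsi i)) = abs_cliff (cV i)"
proof -
  have rel: "abs_cliff r = 0" if "r \<in> ferm_relators n0" for r
    using that by (intro abs_cliff_relator) (simp add: cl_relators_def)
  have "abs_cliff (cV i * cVinv i - 1) = 0" "abs_cliff (cVinv i * cV i - 1) = 0"
    "abs_cliff (cPsi i * cPsiD i + smul qq (cPsiD i * cPsi i) - cVinv i) = 0"
    "abs_cliff (cPsi i * cPsiD i + smul (inverse qq) (cPsiD i * cPsi i) - cV i) = 0"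
    "abs_cliff (cV i * cV j - cV j * cV i) = 0"
    "abs_cliff (cV i * cPsi j * cVinv i - smul (if i = j then qq else 1) (cPsi j)) = 0"
    "abs_cliff (cV i * cPsiD j * cVinv i - smul (if i = j then inverse qq else 1) (cPsiD j)) = 0"
    "abs_cliff (cPsi i * cPsi j + cPsi j * cPsi i) = 0"
    "abs_cliff (cPsiD i * cPsiD j + cPsiD j * cPsiD i) = 0"
    by (rule rel, use assms in \<open>unfold ferm_relators_def, blast\<close>)+
  note rels = this[unfolded cliff_ops_abs[symmetric] right_minus_eq]
  show "cliff.exchange (- 1) (abs_cliff (cPsi i)) (abs_cliff (cPsi j))"
    "cliff.exchange (- 1) (abs_cliff (cPsiD i)) (abs_cliff (cPsiD j))"
    "cliff.exchange 1 (abs_cliff (cV i)) (abs_cliff (cV j))"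
    using rels by (simp_all add: cliff.exchange_def eq_neg_iff_add_eq_0)
  show "abs_cliff (cV i) * abs_cliff (cVinv i) = 1" "abs_cliff (cVinv i) * abs_cliff (cV i) = 1"
    "abs_cliff (cPsi i) * abs_cliff (cPsiD i) + cliff_scale qq (abs_cliff (cPsiD i) * abs_cliff
      (cPsi i)) = abs_cliff (cVinv i)"
    "abs_cliff (cPsi i) * abs_cliff (cPsiD i) + cliff_scale (inverse qq) (abs_cliff (cPsiD i) *
      abs_cliff (cPsi i)) = abs_cliff (cV i)"
    by (fact rels)+
  show "cliff.exchange (if i = j then qq else 1) (abs_cliff (cV i)) (abs_cliff (cPsi j))"
    "cliff.exchange (if i = j then inverse qq else 1) (abs_cliff (cV i)) (abs_cliff (cPsiD j))"
    by (rule cliff.exchange_of_conjugate; fact rels)+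
  assume "i \<noteq> j"
  then have "abs_cliff (cPsi i * cPsiD j + cPsiD j * cPsi i) = 0"
    by (intro rel, use assms in \<open>unfold ferm_relators_def, blast\<close>)
  then show "cliff.exchange (- 1) (abs_cliff (cPsi i)) (abs_cliff (cPsiD j))"
    by (simp add: cliff.exchange_def eq_neg_iff_add_eq_0 flip: cliff_ops_abs)
qed

lemma deformed_clifford_cliff:
  assumes "1 \<le> m0" "1 \<le> n0"
  shows "deformed_clifford cliff_scale m0 n0 site_a site_ad site_h site_hi"
proof (unfold_locales)
  note site_defs = site_a_def site_ad_def site_h_def site_hi_def swap_sign_def fermionic_def
    site_weight_def
  have gens: "GPhi p \<in> bos_gens m0" "GPhiD p \<in> bos_gens m0" "GU p \<in> bos_gens m0"
    "GUinv p \<in> bos_gens m0"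
    if "p \<in> {1..m0 + n0}" "p \<le> m0" for p
    using that by (auto simp: bos_gens_def)
  have gens': "GPsi (p - m0) \<in> ferm_gens n0" "GPsiD (p - m0) \<in> ferm_gens n0"
    "GV (p - m0) \<in> ferm_gens n0" "GVinv (p - m0) \<in> ferm_gens n0"
    if "p \<in> {1..m0 + n0}" "\<not> p \<le> m0" for p
    using that by (auto simp: ferm_gens_def)
  have bos: "p \<in> {1..m0}" if "p \<in> {1..m0 + n0}" "p \<le> m0" for p
    using that by auto
  have ferm: "p - m0 \<in> {1..n0}" if "p \<in> {1..m0 + n0}" "\<not> p \<le> m0" for p
    using that by auto
  have eq: "p - m0 = r - m0 \<longleftrightarrow> p = r" if "\<not> p \<le> m0" "\<not> r \<le> m0" for p r
    using that by auto
  fix p r assume p: "p \<in> {1..m0 + n0}"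
  show "site_h p * site_hi p = 1" "site_hi p * site_h p = 1"
    using p bos_exchange(4,5)[OF bos bos] ferm_exchange(4,5)[OF ferm ferm] by (auto simp: site_defs)
  show "site_a p * site_ad p - cliff_scale (swap_sign m0 n0 p p * qq) (site_ad p * site_a p) =
    site_hi p"
    "site_a p * site_ad p - cliff_scale (swap_sign m0 n0 p p * inverse qq) (site_ad p * site_a p)
      = site_h p"
    using p bos_exchange(9,10)[OF bos bos] ferm_exchange(9,10)[OF ferm ferm]
      by (auto simp: site_defs)
  assume r: "r \<in> {1..m0 + n0}"
  show "cliff.exchange (swap_sign m0 n0 p r) (site_a p) (site_a r)"
    using p r bos_exchange(1)[OF bos[OF p] bos[OF r]] ferm_exchange(1)[OF ferm[OF p] ferm[OF r]]
      eq[of p r]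
    by (cases "p \<le> m0"; cases "r \<le> m0") (simp_all add: site_defs mixed_exchange gens gens' split:
      if_splits)
  show "cliff.exchange (swap_sign m0 n0 p r) (site_ad p) (site_ad r)"
    using p r bos_exchange(2)[OF bos[OF p] bos[OF r]] ferm_exchange(2)[OF ferm[OF p] ferm[OF r]]
      eq[of p r]
    by (cases "p \<le> m0"; cases "r \<le> m0") (simp_all add: site_defs mixed_exchange gens gens' split:
      if_splits)
  show "cliff.exchange (swap_sign m0 n0 p r) (site_a p) (site_ad r)" if "p \<noteq> r"
    using p r that bos_exchange(3)[OF bos[OF p] bos[OF r]] ferm_exchange(3)[OF ferm[OF p] ferm[OF
      r]] eq[of p r]
    by (cases "p \<le> m0"; cases "r \<le> m0") (simp_all add: site_defs mixed_exchange gens gens' split: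
      if_splits)
  show "cliff.exchange 1 (site_h p) (site_h r)"
    using p r bos_exchange(6)[OF bos[OF p] bos[OF r]] ferm_exchange(6)[OF ferm[OF p] ferm[OF r]]
      eq[of p r]
    by (cases "p \<le> m0"; cases "r \<le> m0") (simp_all add: site_defs mixed_exchange gens gens' split:
      if_splits)
  show "cliff.exchange (if p = r then site_weight m0 p else 1) (site_h p) (site_a r)"
    using p r bos_exchange(7)[OF bos[OF p] bos[OF r]] ferm_exchange(7)[OF ferm[OF p] ferm[OF r]]
      eq[of p r]
    by (cases "p \<le> m0"; cases "r \<le> m0") (simp_all add: site_defs mixed_exchange gens gens' split:
      if_splits)
  show "cliff.exchange (if p = r then inverse (site_weight m0 p) else 1) (site_h p) (site_ad r)"
    using p r bos_exchange(8)[OF bos[OF p] bos[OF r]] ferm_exchange(8)[OF ferm[OF p] ferm[OF r]]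
      eq[of p r]
    by (cases "p \<le> m0"; cases "r \<le> m0") (simp_all add: site_defs mixed_exchange gens gens' split:
      if_splits)
qed (use assms in \<open>auto simp: site_a_def site_ad_def\<close>)

section \<open>The spinor homomorphism respects the relations of the quantum supergroup\<close>

lemma homogeneous_mult:
  assumes "homogeneous p d x" "homogeneous p e y"
  shows "homogeneous p ((d + e) mod 2) (x * y)"
  unfolding homogeneous_def
proof
  fix w assume "w \<in> Poly_Mapping.keys (x * y)"
  then obtain u v where "u \<in> Poly_Mapping.keys x" "v \<in> Poly_Mapping.keys y" "w = u + v"
    using keys_mult[of x y] by blast
  then have "sum_list (map p (letters u)) mod 2 = d" "sum_list (map p (letters v)) mod 2 = e"
    "sum_list (map p (letters w)) = sum_list (map p (letters u)) + sum_list (map p (letters v))"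
    using assms by (auto simp: homogeneous_def)
  then show "sum_list (map p (letters w)) mod 2 = (d + e) mod 2"
    by (metis mod_add_eq)
qed

lemma homogeneous_diff: "homogeneous p d x \<Longrightarrow> homogeneous p d y \<Longrightarrow> homogeneous p d (x - y)"
  using keys_diff[of x y] by (auto simp: homogeneous_def)

lemma homogeneous_smul: "homogeneous p d x \<Longrightarrow> homogeneous p d (smul c x)"
  using keys_smul[of c x] by (auto simp: homogeneous_def)

lemma homogeneous_gen: "p g < 2 \<Longrightarrow> homogeneous p (p g) (gen g :: _ \<Rightarrow>\<^sub>0 'k::field)"
  by (auto simp: homogeneous_def gen_def)

text \<open>The element \<open>0\<close> is homogeneous of both degrees and has to be excluded. In an adjoint action on \<open>0\<close>
  the sign does not matter, since it multiplies \<open>0\<close>.\<close>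

lemma parity_homogeneous:
  assumes "homogeneous p d x" "d < 2" "x \<noteq> 0"
  shows "parity p x = d"
proof -
  obtain w where "w \<in> Poly_Mapping.keys x"
    using assms(3) by (metis keys_eq_empty ex_in_conv)
  then show ?thesis
    using assms(1,2) by (auto simp: parity_def homogeneous_def)
qed

lemma uq_parity_less: "uq_parity m n g < 2"
  by (cases g) simp_all

text \<open>The sign in an iterated adjoint action can thus be computed from the degrees of the
  generators alone, without knowing which of the intermediate elements vanish.\<close>

lemma Ad_homogeneous:
  assumes "homogeneous (uq_parity m n) d x" "d < 2"
  shows "AdE m n i x = uE i * x - smul ((- 1) ^ (uq_parity m n (GE i) * d)) (uK i * x * uKinv i *
    uE i)"
    and "AdF m n i x = uF i * x - smul ((- 1) ^ (uq_parity m n (GF i) * d)) (uKinv i * x * uK i *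
      uF i)"
    and "homogeneous (uq_parity m n) ((uq_parity m n (GE i) + d) mod 2) (AdE m n i x)"
    and "homogeneous (uq_parity m n) ((uq_parity m n (GF i) + d) mod 2) (AdF m n i x)"
proof -
  show E: "AdE m n i x = uE i * x - smul ((- 1) ^ (uq_parity m n (GE i) * d)) (uK i * x * uKinv i
    * uE i)"
    and F: "AdF m n i x = uF i * x - smul ((- 1) ^ (uq_parity m n (GF i) * d)) (uKinv i * x * uK i
      * uF i)"
    using parity_homogeneous[OF assms] by (cases "x = 0"; simp add: AdE_def AdF_def sign_mult)+
  have g: "homogeneous (uq_parity m n) (uq_parity m n (GE i)) (uE i)"
    "homogeneous (uq_parity m n) (uq_parity m n (GF i)) (uF i)"
    "homogeneous (uq_parity m n) 0 (uK i)" "homogeneous (uq_parity m n) 0 (uKinv i)"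
    using homogeneous_gen[of "uq_parity m n", OF uq_parity_less, of "GE i"]
      homogeneous_gen[of "uq_parity m n", OF uq_parity_less, of "GF i"]
      homogeneous_gen[of "uq_parity m n", OF uq_parity_less, of "GK i"]
      homogeneous_gen[of "uq_parity m n", OF uq_parity_less, of "GKinv i"] by simp_all
  note prod = homogeneous_mult[OF homogeneous_mult[OF homogeneous_mult]]
  show "homogeneous (uq_parity m n) ((uq_parity m n (GE i) + d) mod 2) (AdE m n i x)"
    unfolding E using homogeneous_mult[OF g(1) assms(1)] prod[OF g(3) assms(1) g(4) g(1)]
    by (intro homogeneous_diff homogeneous_smul) (simp_all add: mod_simps add.commute)
  show "homogeneous (uq_parity m n) ((uq_parity m n (GF i) + d) mod 2) (AdF m n i x)"
    unfolding F using homogeneous_mult[OF g(2) assms(1)] prod[OF g(4) assms(1) g(3) g(2)]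
    by (intro homogeneous_diff homogeneous_smul) (simp_all add: mod_simps add.commute)
qed

text \<open>Where nilpotency makes the coefficients irrelevant, it suffices that there is some sign.\<close>

lemma Ad_explicit:
  "\<exists>s. AdE m n i x = uE i * x - smul s (uK i * x * uKinv i * uE i)"
  "\<exists>s. AdF m n i x = uF i * x - smul s (uKinv i * x * uK i * uF i)"
  unfolding AdE_def AdF_def sign_mult by blast+

lemma uq_gens_iff [simp]:
  "GE i \<in> uq_gens m n \<longleftrightarrow> i \<in> {1..m+n}" "GF i \<in> uq_gens m n \<longleftrightarrow> i \<in> {1..m+n}"
  "GK i \<in> uq_gens m n \<longleftrightarrow> i \<in> {1..m+n}" "GKinv i \<in> uq_gens m n \<longleftrightarrow> i \<in> {1..m+n}"
  by (auto simp: uq_gens_def)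

lemma uq_relators_closed:
  assumes "1 \<le> m" "1 \<le> n"
  shows "uq_relators m n \<subseteq> carrier (free_algebra (uq_gens m n))"
proof -
  let ?C = "carrier (free_algebra (uq_gens m n)) :: (uq_gen word \<Rightarrow>\<^sub>0 Cq) set"
  have Ad: "AdE m n i x \<in> ?C" "AdF m n i x \<in> ?C" if "i \<in> {1..m+n}" "x \<in> ?C" for i x
    using that by (auto simp: AdE_def AdF_def sign_mult)
  have pow: "(AdE m n i ^^ k) x \<in> ?C" "(AdF m n i ^^ k) x \<in> ?C" if "i \<in> {1..m+n}" "x \<in> ?C" for i x k
    using that by (induction k) (auto intro: Ad)
  have gens: "uE i \<in> ?C" "uF i \<in> ?C" "uK i \<in> ?C" "uKinv i \<in> ?C" if "i \<in> {1..m+n}" for i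
    using that by simp_all
  have "r \<in> ?C" if "r \<in> uq_relators m n" for r
    using that unfolding uq_relators_def
    by (elim UnE UN_E insertE)
      (use assms in \<open>auto simp: sign_mult split: if_splits intro!: Ad pow gens free_algebra_closed
        free_algebra_diff_closed\<close>)
  then show ?thesis by blast
qed

text \<open>The four formulas for the images of the generators: bosonic nodes, the odd node \<open>m\<close>,
  fermionic nodes, and the last node.\<close>

lemma node_cases:
  assumes "i \<in> {1..m+n}" "1 \<le> (n :: nat)"
  obtains "1 \<le> i" "i < m" | "i = m" | j where "1 \<le> j" "j < n" "i = m + j" | "i = m + n"
proof -
  have "i < m \<or> i = m \<or> (\<exists>j. 1 \<le> j \<and> j < n \<and> i = m + j) \<or> i = m + n"
    using assms by (cases "m < i"; cases "i < m + n") (auto intro!: exI[of _ "i - m"])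
  then show ?thesis using assms that by auto
qed

lemma spinor_gen_closed:
  assumes "1 \<le> m" "1 \<le> n" "g \<in> uq_gens m n"
  shows "spinor_gen m n g \<in> carrier (free_algebra (cl_gens m n))"
proof -
  have "cPhi i \<in> carrier (free_algebra (cl_gens m n))"
    "cPhiD i \<in> carrier (free_algebra (cl_gens m n))"
    "cU i \<in> carrier (free_algebra (cl_gens m n))" "cUinv i \<in> carrier (free_algebra (cl_gens m n))"
    if "i \<in> {1..m}" for i
    using that by (auto simp: bos_gens_def)
  moreover have "cPsi i \<in> carrier (free_algebra (cl_gens m n))"
    "cPsiD i \<in> carrier (free_algebra (cl_gens m n))"
    "cV i \<in> carrier (free_algebra (cl_gens m n))" "cVinv i \<in> carrier (free_algebra (cl_gens m n))"
    if "i \<in> {1..n}" for i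
    using that by (auto simp: ferm_gens_def)
  moreover obtain i where i: "i \<in> {1..m+n}" "g = GE i \<or> g = GF i \<or> g = GK i \<or> g = GKinv i"
    using assms(3) by (auto simp: uq_gens_def)
  ultimately show ?thesis
    using i(2) assms by (cases rule: node_cases[OF i(1) assms(2)]) (auto simp del:
      gen_in_free_algebra)
qed

context
  assumes ranks: "1 \<le> m0" "1 \<le> n0"
begin

interpretation dc: deformed_clifford cliff_scale m0 n0 site_a site_ad site_h site_hi
  using ranks by (rule deformed_clifford_cliff)

text \<open>The relators of the quantum supergroup lie in the ideal of the Clifford algebra as soon as this
  map annihilates them.\<close>

definition rho :: "(uq_gen word \<Rightarrow>\<^sub>0 Cq) \<Rightarrow> cliff" where
  "rho x = abs_cliff (free_lift (spinor_gen m0 n0) x)"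

lemma rho_simps:
  "rho (x + y) = rho x + rho y" "rho (x - y) = rho x - rho y" "rho (- x) = - rho x"
  "rho (x * y) = rho x * rho y" "rho (smul c x) = cliff_scale c (rho x)" "rho 1 = 1" "rho 0 = 0"
  by (simp_all add: rho_def cliff_ops_abs)

lemma rho_gens:
  assumes "i \<in> {1..m0 + n0}"
  shows "rho (uE i) = dc.E i" "rho (uF i) = dc.F i" "rho (uK i) = dc.K i" "rho (uKinv i) = dc.Ki i"
proof -
  \<comment> \<open>At the odd node the image of \<open>f\<^sub>m\<close> has its two letters in the opposite order.\<close>
  have F: "site_a (Suc m0) * site_ad m0 = site_ad m0 * site_a (Suc m0)"
    using dc.boson_exchange(4)[of m0 "Suc m0"] ranks by (simp add: cliff.exchange_def)
  show "rho (uE i) = dc.E i"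
    using ranks by (cases rule: node_cases[OF assms ranks(2)])
      (simp_all add: rho_def dc.E_def site_a_def site_ad_def cliff.scale_mult_right flip:
        cliff_ops_abs)
  show "rho (uF i) = dc.F i"
    using ranks F by (cases rule: node_cases[OF assms ranks(2)])
      (simp_all add: rho_def dc.F_def site_a_def site_ad_def cliff.scale_mult_right flip:
        cliff_ops_abs)
  show "rho (uK i) = dc.K i"
    using ranks by (cases rule: node_cases[OF assms ranks(2)])
      (simp_all add: rho_def dc.K_def site_h_def site_hi_def cliff.scale_mult_right flip:
        cliff_ops_abs)
  show "rho (uKinv i) = dc.Ki i"
    using ranks by (cases rule: node_cases[OF assms ranks(2)])
      (simp_all add: rho_def dc.Ki_def site_h_def site_hi_def cliff.scale_mult_right flip:
        cliff_ops_abs)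
qed

text \<open>The adjoint action of \<open>f\<^sub>i\<close> conjugates with \<open>k\<^sub>i\<^sup>-\<^sup>1\<close>, so that it involves the same scalars
  as the adjoint action of \<open>e\<^sub>i\<close>.\<close>

lemma Ki_F_exchange:
  assumes "p \<in> {1..m0 + n0}" "r \<in> {1..m0 + n0}"
  shows "cliff.exchange (qi m0 n0 p powi cartan m0 n0 p r) (dc.Ki p) (dc.F r)"
  using cliff.exchange_inverse_left[OF dc.K_root_vector_exchange(2)[OF assms] dc.K_Ki[OF assms(1)]]
  by (simp add: power_int_minus qi_def)

lemma rho_Ad:
  assumes "i \<in> {1..m0 + n0}"
  shows "cliff.exchange c (dc.K i) (rho x) \<Longrightarrow>
      rho (uE i * x - smul s (uK i * x * uKinv i * uE i)) = cliff.bracket (s * c) (dc.E i) (rho x)"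
    and "cliff.exchange c (dc.Ki i) (rho x) \<Longrightarrow>
      rho (uF i * x - smul s (uKinv i * x * uK i * uF i)) = cliff.bracket (s * c) (dc.F i) (rho x)"
  using cliff.exchange_conjugate[of c "dc.K i" "rho x" "dc.Ki i"]
    cliff.exchange_conjugate[of c "dc.Ki i" "rho x" "dc.K i"] dc.K_Ki[OF assms]
  by (simp_all add: rho_simps rho_gens[OF assms] cliff.bracket_def cliff.scale_mult_left)

lemma rho_Ad_exchange:
  assumes "i \<in> {1..m0 + n0}" "p \<in> {1..m0 + n0}"
  shows "cliff.exchange c (dc.K i) (rho x) \<Longrightarrow> cliff.exchange d (dc.K p) (rho x) \<Longrightarrow>
      cliff.exchange (qi m0 n0 p powi cartan m0 n0 p i * d) (dc.K p) (rho (AdE m0 n0 i x))"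
    and "cliff.exchange c (dc.Ki i) (rho x) \<Longrightarrow> cliff.exchange d (dc.Ki p) (rho x) \<Longrightarrow>
      cliff.exchange (qi m0 n0 p powi cartan m0 n0 p i * d) (dc.Ki p) (rho (AdF m0 n0 i x))"
proof -
  obtain s where s: "AdE m0 n0 i x = uE i * x - smul s (uK i * x * uKinv i * uE i)"
    using Ad_explicit by blast
  show "cliff.exchange c (dc.K i) (rho x) \<Longrightarrow> cliff.exchange d (dc.K p) (rho x) \<Longrightarrow>
      cliff.exchange (qi m0 n0 p powi cartan m0 n0 p i * d) (dc.K p) (rho (AdE m0 n0 i x))"
    unfolding s by (subst rho_Ad(1)[OF assms(1)], assumption)
      (rule cliff.exchange_bracket[OF dc.K_root_vector_exchange(1)[OF assms(2,1)]])
  obtain s where s: "AdF m0 n0 i x = uF i * x - smul s (uKinv i * x * uK i * uF i)"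
    using Ad_explicit by blast
  show "cliff.exchange c (dc.Ki i) (rho x) \<Longrightarrow> cliff.exchange d (dc.Ki p) (rho x) \<Longrightarrow>
      cliff.exchange (qi m0 n0 p powi cartan m0 n0 p i * d) (dc.Ki p) (rho (AdF m0 n0 i x))"
    unfolding s by (subst rho_Ad(2)[OF assms(1)], assumption)
      (rule cliff.exchange_bracket[OF Ki_F_exchange[OF assms(2,1)]])
qed

lemma rho_Ad_some:
  assumes "i \<in> {1..m0 + n0}"
  shows "cliff.exchange c (dc.K i) (rho x) \<Longrightarrow> \<exists>s. rho (AdE m0 n0 i x) =
    cliff.bracket s (dc.E i) (rho x)"
    and "cliff.exchange c (dc.Ki i) (rho x) \<Longrightarrow> \<exists>s. rho (AdF m0 n0 i x) =
      cliff.bracket s (dc.F i) (rho x)"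
  using Ad_explicit(1)[of m0 n0 i x] Ad_explicit(2)[of m0 n0 i x] rho_Ad[OF assms, of c x] by metis+

lemma rho_Ad_homogeneous:
  assumes "i \<in> {1..m0 + n0}" "homogeneous (uq_parity m0 n0) d x" "d < 2"
  shows "cliff.exchange c (dc.K i) (rho x) \<Longrightarrow>
      rho (AdE m0 n0 i x) = cliff.bracket ((- 1) ^ (uq_parity m0 n0 (GE i) * d) * c) (dc.E i) (rho
        x)"
    and "cliff.exchange c (dc.Ki i) (rho x) \<Longrightarrow>
      rho (AdF m0 n0 i x) = cliff.bracket ((- 1) ^ (uq_parity m0 n0 (GF i) * d) * c) (dc.F i) (rho
        x)"
  using rho_Ad[OF assms(1), of c x] by (simp_all only: Ad_homogeneous(1,2)[OF assms(2,3)])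

lemma rho_Ad_even:
  assumes "i \<in> {1..m0 + n0}" "i \<noteq> m0" "i \<noteq> m0 + n0"
  shows "cliff.exchange c (dc.K i) (rho x) \<Longrightarrow> rho (AdE m0 n0 i x) = cliff.bracket c (dc.E i) (rho x)"
    and "cliff.exchange c (dc.Ki i) (rho x) \<Longrightarrow> rho (AdF m0 n0 i x) =
      cliff.bracket c (dc.F i) (rho x)"
  using rho_Ad[OF assms(1), of c x 1] assms(2,3) by (simp_all add: AdE_def AdF_def theta1_def)

lemma homogeneous_uq_gen: "homogeneous (uq_parity m n) (uq_parity m n g) (gen g :: uq_gen word \<Rightarrow>\<^sub>0
  Cq)"
  by (rule homogeneous_gen) (rule uq_parity_less)

text \<open>Distant nodes exchange; at the last node \<open>E * E = 0\<close> kills the cubic bracket; at bosonic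
  nodes the scalars work out to \<open>q\<close> and \<open>q\<^sup>-\<^sup>1\<close> as in \<open>boson_serre\<close>; at the remaining fermionic
  nodes all monomials of the double bracket vanish.\<close>

lemma rho_serre:
  assumes i: "i \<in> {1..m0 + n0}" and j: "j \<in> {1..m0 + n0}" and ij: "i \<noteq> j" "i \<noteq> m0"
  shows "rho ((AdE m0 n0 i ^^ nat (1 - cartan m0 n0 i j)) (uE j)) = 0"
    and "rho ((AdF m0 n0 i ^^ nat (1 - cartan m0 n0 i j)) (uF j)) = 0"
proof -
  \<comment> \<open>The weights of \<open>e\<^sub>j\<close> and of \<open>e\<^sub>i\<close> itself under \<open>k\<^sub>i\<close>.\<close>
  define c where "c = qi m0 n0 i powi cartan m0 n0 i j"
  define d where "d = qi m0 n0 i powi cartan m0 n0 i i"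
  have E: "cliff.exchange c (dc.K i) (rho (uE j))" and F: "cliff.exchange c (dc.Ki i) (rho (uF j))"
    using dc.K_root_vector_exchange(1)[OF i j] Ki_F_exchange[OF i j]
      by (simp_all add: rho_gens[OF j] c_def)
  note AdE = rho_Ad_exchange(1)[OF i i, folded d_def]
  note AdF = rho_Ad_exchange(2)[OF i i, folded d_def]
  have E2: "cliff.exchange (d * c) (dc.K i) (rho (AdE m0 n0 i (uE j)))"
    and F2: "cliff.exchange (d * c) (dc.Ki i) (rho (AdF m0 n0 i (uF j)))"
    by (rule AdE[OF E E], rule AdF[OF F F])
  have "rho ((AdE m0 n0 i ^^ nat (1 - cartan m0 n0 i j)) (uE j)) = 0 \<and>
    rho ((AdF m0 n0 i ^^ nat (1 - cartan m0 n0 i j)) (uF j)) = 0"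
  proof (cases "j = Suc i \<or> i = Suc j")
    case False
    then have cartan: "cartan m0 n0 i j = 0" using ij by (simp add: cartan_def)
    then have "c = 1" by (simp add: c_def)
    then have "rho (AdE m0 n0 i (uE j)) = cliff.bracket (dc.node_sign i j) (dc.E i) (dc.E j)"
      "rho (AdF m0 n0 i (uF j)) = cliff.bracket (dc.node_sign i j) (dc.F i) (dc.F j)"
      using rho_Ad_homogeneous(1)[OF i homogeneous_uq_gen uq_parity_less E]
        rho_Ad_homogeneous(2)[OF i homogeneous_uq_gen uq_parity_less F]
      by (simp_all add: dc.node_sign_def rho_gens[OF j])
    then show ?thesis
      using dc.distant_nodes_exchange[OF i j] False cliff.exchange_bracket_zero
        by (simp add: cartan)
  next
    case adjacent: True
    show ?thesis
    proof (cases "i = m0 + n0")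
      case True
      have cartan: "nat (1 - cartan m0 n0 i j) = Suc (Suc (Suc 0))"
        using True adjacent j by (auto simp: cartan_def)
      have E3: "cliff.exchange (d * (d * c)) (dc.K i) (rho (AdE m0 n0 i (AdE m0 n0 i (uE j))))"
        and F3: "cliff.exchange (d * (d * c)) (dc.Ki i) (rho (AdF m0 n0 i (AdF m0 n0 i (uF j))))"
        by (rule AdE[OF E2 E2], rule AdF[OF F2 F2])
      have "dc.E i * dc.E i = 0" "dc.F i * dc.F i = 0"
        using dc.root_vector_square_zero[of i] True by auto
      then show ?thesis
        using rho_Ad_some(1)[OF i E] rho_Ad_some(1)[OF i E2] rho_Ad_some(1)[OF i E3]
          rho_Ad_some(2)[OF i F] rho_Ad_some(2)[OF i F2] rho_Ad_some(2)[OF i F3]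
        unfolding cartan by (auto simp: cliff.triple_bracket_nilpotent)
    next
      case False
      have cartan: "nat (1 - cartan m0 n0 i j) = Suc (Suc 0)" "cartan m0 n0 i j = - 1"
        "cartan m0 n0 i i = 2"
        using False adjacent i ij by (auto simp: cartan_def)
      have rho: "rho ((AdE m0 n0 i ^^ nat (1 - cartan m0 n0 i j)) (uE j)) =
          cliff.bracket (d * c) (dc.E i) (cliff.bracket c (dc.E i) (dc.E j))"
        "rho ((AdF m0 n0 i ^^ nat (1 - cartan m0 n0 i j)) (uF j)) =
          cliff.bracket (d * c) (dc.F i) (cliff.bracket c (dc.F i) (dc.F j))"
        unfolding cartan
        using rho_Ad_even(1)[OF i ij(2) False E] rho_Ad_even(1)[OF i ij(2) False E2]
          rho_Ad_even(2)[OF i ij(2) False F] rho_Ad_even(2)[OF i ij(2) False F2]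
        by (simp_all add: rho_gens[OF j] numeral_2_eq_2)
      show ?thesis
      proof (cases "i < m0")
        case True
        have "c = qq" "d * c = inverse qq"
          using True by (auto simp: c_def d_def cartan qi_def power_int_minus power2_eq_square)
        then show ?thesis
          unfolding rho using dc.boson_serre[OF True i j adjacent] by simp
      next
        case False
        then have m: "m0 < i" "i < m0 + n0" using ij i \<open>i \<noteq> m0 + n0\<close> by auto
        show ?thesis
          unfolding rho using m dc.root_vector_square_zero[of i] dc.root_vector_sandwich_zero[OF m
            j adjacent]
          by (simp add: cliff.double_bracket_nilpotent)
      qed
    qed
  qed
  then show "rho ((AdE m0 n0 i ^^ nat (1 - cartan m0 n0 i j)) (uE j)) = 0"
    "rho ((AdF m0 n0 i ^^ nat (1 - cartan m0 n0 i j)) (uF j)) = 0" by auto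
qed

text \<open>Only the scalars have to be matched with \<open>odd_node_serre\<close>. The three weights are \<open>q\<^sup>-\<^sup>1\<close>,
  \<open>q\<close> and \<open>1\<close>, and the two signs follow from the degrees \<open>p\<close> of \<open>e\<^sub>m\<^sub>+\<^sub>1\<close> and \<open>1 + p\<close> of the
  iterated brackets; \<open>e\<^sub>m\<^sub>+\<^sub>1\<close> is odd only for \<open>n = 1\<close>, when it is the last root vector.\<close>

lemma rho_odd_serre:
  assumes "2 \<le> m0"
  shows "rho (AdE m0 n0 m0 (AdE m0 n0 (m0 - 1) (AdE m0 n0 m0 (uE (m0 + 1))))) = 0"
    and "rho (AdF m0 n0 m0 (AdF m0 n0 (m0 - 1) (AdF m0 n0 m0 (uF (m0 + 1))))) = 0"
proof -
  define e where "e = swap_sign m0 n0 (Suc m0) (Suc (Suc m0))"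
  have I: "m0 \<in> {1..m0 + n0}" "m0 - 1 \<in> {1..m0 + n0}" "Suc m0 \<in> {1..m0 + n0}"
    using assms ranks by auto
  have ev: "m0 - 1 \<noteq> m0" "m0 - 1 \<noteq> m0 + n0" using assms by auto
  have w: "qi m0 n0 m0 powi cartan m0 n0 m0 (Suc m0) = inverse qq"
    "qi m0 n0 m0 powi cartan m0 n0 m0 m0 = 1"
    "qi m0 n0 m0 powi cartan m0 n0 m0 (m0 - 1) = qq"
    "qi m0 n0 (m0 - 1) powi cartan m0 n0 (m0 - 1) (Suc m0) = 1"
    "qi m0 n0 (m0 - 1) powi cartan m0 n0 (m0 - 1) m0 = qq"
    using assms ranks by (auto simp: qi_def cartan_def power_int_minus)
  define p where "p = uq_parity m0 n0 (GE (Suc m0))"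
  have p: "p < 2" "uq_parity m0 n0 (GF (Suc m0)) = p"
    unfolding p_def by (rule uq_parity_less) simp
  have odd: "uq_parity m0 n0 (GE m0) = 1" "uq_parity m0 n0 (GF m0) = 1"
    "uq_parity m0 n0 (GE (m0 - 1)) = 0" "uq_parity m0 n0 (GF (m0 - 1)) = 0"
    using ev by (simp_all add: theta1_def)
  have e: "(- 1) ^ p = - e" "(- 1) ^ ((1 + p) mod 2) = e"
    using ranks by (cases "n0 = 1"; auto simp: p_def e_def swap_sign_def fermionic_def theta1_def)+
  have lt: "(1 + p) mod 2 < 2" by simp
  let ?x1 = "AdE m0 n0 m0 (uE (Suc m0))"
  let ?x2 = "AdE m0 n0 (m0 - 1) ?x1"
  have x0: "cliff.exchange (inverse qq) (dc.K m0) (rho (uE (Suc m0)))"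
    "cliff.exchange 1 (dc.K (m0 - 1)) (rho (uE (Suc m0)))"
    using dc.K_root_vector_exchange(1)[OF I(1) I(3)] dc.K_root_vector_exchange(1)[OF I(2) I(3)]
      by (simp_all add: rho_gens[OF I(3)] w del: One_nat_def)
  have x1: "cliff.exchange (inverse qq) (dc.K m0) (rho ?x1)"
    "cliff.exchange qq (dc.K (m0 - 1)) (rho ?x1)"
    using rho_Ad_exchange(1)[OF I(1) I(1) x0(1) x0(1)] rho_Ad_exchange(1)[OF I(1) I(2) x0]
      by (simp_all add: w del: One_nat_def)
  have x2: "cliff.exchange 1 (dc.K m0) (rho ?x2)"
    using rho_Ad_exchange(1)[OF I(2) I(1) x1(2) x1(1)] by (simp add: w del: One_nat_def)
  have h1: "homogeneous (uq_parity m0 n0) ((1 + p) mod 2) ?x1"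
    using Ad_homogeneous(3)[OF homogeneous_uq_gen uq_parity_less, of m0 n0 m0 "GE (Suc m0)"]
      by (simp only: odd p_def)
  have h2: "homogeneous (uq_parity m0 n0) ((1 + p) mod 2) ?x2"
    using Ad_homogeneous(3)[OF h1, of "m0 - 1"]
      by (simp only: odd add_0_left mod_mod_trivial mod_less_divisor zero_less_numeral simp_thms)
  have "rho ?x1 = cliff.bracket (- (e * inverse qq)) (dc.E m0) (dc.E (Suc m0))"
    using rho_Ad_homogeneous(1)[OF I(1) homogeneous_uq_gen uq_parity_less x0(1)]
    by (simp only: odd p_def[symmetric] mult_1 e rho_gens[OF I(3)] mult_minus_left)
  moreover have "rho ?x2 = cliff.bracket qq (dc.E (m0 - 1)) (rho ?x1)"
    by (rule rho_Ad_even(1)[OF I(2) ev x1(2)])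
  moreover have "rho (AdE m0 n0 m0 ?x2) = cliff.bracket e (dc.E m0) (rho ?x2)"
    using rho_Ad_homogeneous(1)[OF I(1) h2 lt x2] by (simp only: odd e mult_1 mult_1_right)
  ultimately show "rho (AdE m0 n0 m0 (AdE m0 n0 (m0 - 1) (AdE m0 n0 m0 (uE (m0 + 1))))) = 0"
    using dc.odd_node_serre(1)[OF assms] by (simp flip: e_def)
  let ?y1 = "AdF m0 n0 m0 (uF (Suc m0))"
  let ?y2 = "AdF m0 n0 (m0 - 1) ?y1"
  have y0: "cliff.exchange (inverse qq) (dc.Ki m0) (rho (uF (Suc m0)))"
    "cliff.exchange 1 (dc.Ki (m0 - 1)) (rho (uF (Suc m0)))"
    using Ki_F_exchange[OF I(1) I(3)] Ki_F_exchange[OF I(2) I(3)]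
      by (simp_all add: rho_gens[OF I(3)] w del: One_nat_def)
  have y1: "cliff.exchange (inverse qq) (dc.Ki m0) (rho ?y1)"
    "cliff.exchange qq (dc.Ki (m0 - 1)) (rho ?y1)"
    using rho_Ad_exchange(2)[OF I(1) I(1) y0(1) y0(1)] rho_Ad_exchange(2)[OF I(1) I(2) y0]
      by (simp_all add: w del: One_nat_def)
  have y2: "cliff.exchange 1 (dc.Ki m0) (rho ?y2)"
    using rho_Ad_exchange(2)[OF I(2) I(1) y1(2) y1(1)] by (simp add: w del: One_nat_def)
  have h1: "homogeneous (uq_parity m0 n0) ((1 + p) mod 2) ?y1"
    using Ad_homogeneous(4)[OF homogeneous_uq_gen uq_parity_less, of m0 n0 m0 "GF (Suc m0)"]
      by (simp only: odd p(2))
  have h2: "homogeneous (uq_parity m0 n0) ((1 + p) mod 2) ?y2"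
    using Ad_homogeneous(4)[OF h1, of "m0 - 1"]
      by (simp only: odd add_0_left mod_mod_trivial mod_less_divisor zero_less_numeral simp_thms)
  have "rho ?y1 = cliff.bracket (- (e * inverse qq)) (dc.F m0) (dc.F (Suc m0))"
    using rho_Ad_homogeneous(2)[OF I(1) homogeneous_uq_gen uq_parity_less y0(1)]
    by (simp only: odd p(2) mult_1 e rho_gens[OF I(3)] mult_minus_left)
  moreover have "rho ?y2 = cliff.bracket qq (dc.F (m0 - 1)) (rho ?y1)"
    by (rule rho_Ad_even(2)[OF I(2) ev y1(2)])
  moreover have "rho (AdF m0 n0 m0 ?y2) = cliff.bracket e (dc.F m0) (rho ?y2)"
    using rho_Ad_homogeneous(2)[OF I(1) h2 lt y2] by (simp only: odd e mult_1 mult_1_right)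
  ultimately show "rho (AdF m0 n0 m0 (AdF m0 n0 (m0 - 1) (AdF m0 n0 m0 (uF (m0 + 1))))) = 0"
    using dc.odd_node_serre(2)[OF assms] by (simp flip: e_def)
qed

lemma rho_uq_relator:
  assumes "r \<in> uq_relators m0 n0"
  shows "rho r = 0"
proof -
  let ?I = "{1..m0 + n0}"
  have KK: "rho (uK i * uKinv i - 1) = 0" "rho (uKinv i * uK i - 1) = 0" if "i \<in> ?I" for i
    using dc.K_Ki[OF that] by (simp_all add: rho_simps rho_gens[OF that])
  have two: "rho (uK i * uK j - uK j * uK i) = 0"
    "rho (uK i * uE j * uKinv i - smul (qi m0 n0 i powi cartan m0 n0 i j) (uE j)) = 0"
    "rho (uK i * uF j * uKinv i - smul (qi m0 n0 i powi (- cartan m0 n0 i j)) (uF j)) = 0"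
    "rho (uE i * uF j - (-1) ^ (uq_parity m0 n0 (GE i) * uq_parity m0 n0 (GF j)) * (uF j * uE i)
           - (if i = j then smul (1 / (qq - inverse qq)) (uK i - uKinv i) else 0)) = 0"
    if i: "i \<in> ?I" and j: "j \<in> ?I" for i j
  proof -
    show "rho (uK i * uK j - uK j * uK i) = 0"
      using dc.K_K_commute[OF i j] by (simp add: rho_simps rho_gens[OF i] rho_gens[OF j])
    show "rho (uK i * uE j * uKinv i - smul (qi m0 n0 i powi cartan m0 n0 i j) (uE j)) = 0"
      "rho (uK i * uF j * uKinv i - smul (qi m0 n0 i powi (- cartan m0 n0 i j)) (uF j)) = 0"
      using cliff.exchange_conjugate[OF dc.K_root_vector_exchange(1)[OF i j] dc.K_Ki(1)[OF i]]
        cliff.exchange_conjugate[OF dc.K_root_vector_exchange(2)[OF i j] dc.K_Ki(1)[OF i]]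
      by (simp_all add: rho_simps rho_gens[OF i] rho_gens[OF j])
    have "rho (uE i * uF j - (-1) ^ (uq_parity m0 n0 (GE i) * uq_parity m0 n0 (GF j)) * (uF j * uE
      i)) =
        cliff.bracket (dc.node_sign i j) (dc.E i) (dc.F j)"
      by (simp only: sign_mult rho_simps rho_gens[OF i] rho_gens[OF j] cliff.bracket_def
        dc.node_sign_def uq_parity.simps)
    also have "\<dots> = rho (if i = j then smul (1 / (qq - inverse qq)) (uK i - uKinv i) else 0)"
      using dc.E_F_bracket[OF i] cliff.exchange_bracket_zero[OF dc.E_F_exchange[OF i j]]
      by (cases "i = j") (simp_all add: rho_simps rho_gens[OF i] rho_gens[OF j])
    finally show "rho (uE i * uF j - (-1) ^ (uq_parity m0 n0 (GE i) * uq_parity m0 n0 (GF j)) *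
      (uF j * uE i)
           - (if i = j then smul (1 / (qq - inverse qq)) (uK i - uKinv i) else 0)) = 0"
      by (simp only: rho_simps(2) diff_self)
  qed
  have m: "m0 \<in> ?I" using ranks by simp
  have sq: "rho (uE m0 * uE m0) = 0" "rho (uF m0 * uF m0) = 0"
    using dc.root_vector_square_zero[of m0] by (simp_all add: rho_simps rho_gens[OF m])
  have im: "i \<noteq> m0" if "cartan m0 n0 i i \<noteq> 0" for i
    using that by (auto simp: cartan_def)
  note serre = rho_serre[OF _ _ _ im]
  show ?thesis
    using assms unfolding uq_relators_def
    by (elim UnE UN_E insertE emptyE)
      (simp_all only: KK two sq,
        auto simp: rho_odd_serre[simplified] serre KK two sq split: if_splits)
qed

lemma respects_relators_test_rank: "respects_relators m0 n0"
  unfolding respects_relators_def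
proof
  fix r assume r: "r \<in> uq_relators m0 n0"
  then have "r \<in> carrier (free_algebra (uq_gens m0 n0))"
    using uq_relators_closed[OF ranks] by blast
  then have "free_lift (spinor_gen m0 n0) r \<in> carrier (free_algebra (cl_gens m0 n0))"
    by (rule free_lift_in_free_algebra[rotated]) (rule spinor_gen_closed[OF ranks])
  moreover have "abs_cliff (free_lift (spinor_gen m0 n0) r) = 0"
    using rho_uq_relator[OF r] unfolding rho_def .
  ultimately show "free_lift (spinor_gen m0 n0) r \<in> cl_ideal m0 n0"
    by (simp only: abs_cliff_eq_0_iff cl_kernel_iff)
qed

end

lemma respects_relators:
  assumes "1 \<le> m" "1 \<le> n"
  shows "respects_relators m n"
proof (rule ccontr)
  assume "\<not> respects_relators m n"
  then have "case (m, n) of (m, n) \<Rightarrow> 1 \<le> m \<and> 1 \<le> n \<and> \<not> respects_relators m n"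
    using assms by simp
  then have "case test_rank of (m, n) \<Rightarrow> 1 \<le> m \<and> 1 \<le> n \<and> \<not> respects_relators m n"
    unfolding test_rank_def by (rule someI)
  then show False
    using respects_relators_test_rank by (simp add: case_prod_beta)
qed

section \<open>The spinor module\<close>

text \<open>On the Fock space this agrees with the action of the class of \<open>x\<close>, which reduces everything
  below to words.\<close>

definition spinor_op :: "nat \<Rightarrow> nat \<Rightarrow> (uq_gen word \<Rightarrow>\<^sub>0 Cq) \<Rightarrow> ((nat \<Rightarrow> nat) \<Rightarrow>\<^sub>0 Cq) \<Rightarrow> ((nat \<Rightarrow> nat)
  \<Rightarrow>\<^sub>0 Cq)" where
  "spinor_op m n x v = free_action (cl_on_ket m) (free_lift (spinor_gen m n) x) v"

lemma fock_action_cl_class: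
  assumes "v \<in> Fock m n"
  shows "fock_action m n (cl_class m n x) v = free_action (cl_on_ket m) x v"
  unfolding fock_action_def cl_class_def
proof (rule the_elem_rel_class[OF cl_relators_closed])
  fix y assume "y - x \<in> cl_ideal m n"
  then have "free_action (cl_on_ket m) (y - x) v = 0"
    using assms by (rule cl_ideal_annihilates)
  then show "free_action (cl_on_ket m) y v = free_action (cl_on_ket m) x v"
    by simp
qed

lemma spinor_hom_uq_class:
  assumes "1 \<le> m" "1 \<le> n"
  shows "spinor_hom m n (uq_class m n x) = cl_class m n (free_lift (spinor_gen m n) x)"
  unfolding spinor_hom_def uq_class_def
proof (rule the_elem_rel_class[OF uq_relators_closed[OF assms]])
  fix y assume y: "y - x \<in> Idl\<^bsub>free_algebra (uq_gens m n)\<^esub> (uq_relators m n)"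
  have "free_lift (spinor_gen m n) (y - x) \<in> cl_ideal m n"
  proof (rule free_lift_Idl)
    show "uq_relators m n \<subseteq> carrier (free_algebra (uq_gens m n))"
      using assms by (rule uq_relators_closed)
    show "cl_relators m n \<subseteq> carrier (free_algebra (cl_gens m n))"
      by (rule cl_relators_closed)
    show "spinor_gen m n g \<in> carrier (free_algebra (cl_gens m n))" if "g \<in> uq_gens m n" for g
      using assms that by (rule spinor_gen_closed)
    show "free_lift (spinor_gen m n) r \<in> cl_ideal m n" if "r \<in> uq_relators m n" for r
      using respects_relators[OF assms] that unfolding respects_relators_def by blast
  qed (rule y)
  then show "cl_class m n (free_lift (spinor_gen m n) y) =
    cl_class m n (free_lift (spinor_gen m n) x)"
    by (simp add: cl_class_def rel_class_eq_iff[OF cl_relators_closed])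
qed

lemma spinor_action_uq_class:
  assumes "1 \<le> m" "1 \<le> n" "v \<in> Fock m n"
  shows "spinor_action m n (uq_class m n x) v = spinor_op m n x v"
  by (simp add: spinor_action_def spinor_hom_uq_class[OF assms(1,2)] fock_action_cl_class[OF
    assms(3)] spinor_op_def)

lemma spinor_op_Fock:
  assumes "1 \<le> m" "1 \<le> n" "x \<in> carrier (free_algebra (uq_gens m n))" "v \<in> Fock m n"
  shows "spinor_op m n x v \<in> Fock m n"
  unfolding spinor_op_def
proof (rule Fock.free_action_mem[OF cl_gens_Fock])
  show "free_lift (spinor_gen m n) x \<in> carrier (free_algebra (cl_gens m n))"
    by (rule free_lift_in_free_algebra[OF spinor_gen_closed[OF assms(1,2)] assms(3)])
qed (use assms in auto)

lemma carrier_Uq_osp: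
  assumes "1 \<le> m" "1 \<le> n"
  shows "carrier (Uq_osp m n) = uq_class m n ` carrier (free_algebra (uq_gens m n))"
  unfolding Uq_osp_def uq_class_def by (rule carrier_presented_algebra[OF uq_relators_closed[OF
    assms]])

lemma Fock_is_alg_module:
  assumes "1 \<le> m" "1 \<le> n"
  shows "is_alg_module (Uq_osp m n) (Fock m n) (spinor_action m n)"
proof -
  note closed = uq_relators_closed[OF assms]
  note ops = presented_algebra_add[OF closed] presented_algebra_mult[OF closed]
    presented_algebra_one[OF closed] presented_algebra_smult[OF closed]
  note ops = ops[folded uq_class_def Uq_osp_def]
  note act = spinor_action_uq_class[OF assms]
  have lin: "spinor_op m n x (v + w) = spinor_op m n x v + spinor_op m n x w"
    "spinor_op m n x (smul c v) = smul c (spinor_op m n x v)"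
    "spinor_op m n (x + y) v = spinor_op m n x v + spinor_op m n y v"
    "spinor_op m n (x * y) v = spinor_op m n x (spinor_op m n y v)"
    "spinor_op m n (smul c x) v = smul c (spinor_op m n x v)" "spinor_op m n 1 v = v" for x y v w c
    by (simp_all add: spinor_op_def free_action_vec)
  show ?thesis
    unfolding is_alg_module_def carrier_Uq_osp[OF assms]
    by (intro conjI ballI allI; (elim imageE)?;
      simp add: Fock.zero_mem Fock.add_mem Fock.smul_mem act ops lin spinor_op_Fock[OF assms])
qed

definition K_eigenvalue :: "nat \<Rightarrow> nat \<Rightarrow> (nat \<Rightarrow> nat) \<Rightarrow> nat \<Rightarrow> Cq" where
  "K_eigenvalue m n t i =
     (if i < m then - (qq ^ t i * inverse (qq ^ t (Suc i)))
      else if i = m then qq ^ t i * qq ^ t (Suc i)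
      else if i < m + n then inverse (qq ^ t i) * qq ^ t (Suc i)
      else sqrt_neg1 * qhalf * inverse (qq ^ t i))"

lemma spinor_op_K_ket:
  assumes "i \<in> {1..m+n}" "1 \<le> n"
  shows "spinor_op m n (uK i) (ket t) = smul (K_eigenvalue m n t i) (ket t)"
  using assms(2)
  by (cases rule: node_cases[OF assms])
    (simp_all add: spinor_op_def K_eigenvalue_def linear_ext_smul mult.commute smul_minus_left)

lemma lookup_spinor_op_K:
  assumes "i \<in> {1..m+n}" "1 \<le> n" "v \<in> Fock m n"
  shows "Poly_Mapping.lookup (spinor_op m n (uK i) v) s =
    K_eigenvalue m n s i * Poly_Mapping.lookup v s"
  using assms(3)
proof (induction rule: Fock_induct)
  case (ket t)
  then show ?case
    by (simp add: spinor_op_K_ket[OF assms(1,2)]) (simp add: ket_def lookup_single when_def)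
qed (simp_all add: spinor_op_def free_action_vec lookup_add algebra_simps)

text \<open>The eigenvalue of the last \<open>k\<^sub>i\<close> determines the occupation number of the last site. Every
  other eigenvalue combines those of two neighbouring sites, so the numbers are recovered from
  right to left.\<close>

lemma K_eigenvalues_separate:
  assumes n: "1 \<le> n" and st: "s \<in> fock_index m n" "t \<in> fock_index m n"
    and eq: "\<And>i. i \<in> {1..m+n} \<Longrightarrow> K_eigenvalue m n s i = K_eigenvalue m n t i"
  shows "s = t"
proof -
  have "s i = t i" if "1 \<le> i" "i \<le> m + n" for i
    using that(2,1)
  proof (induction rule: inc_induct)
    case base
    have "K_eigenvalue m n s (m + n) = K_eigenvalue m n t (m + n)"
      using n by (intro eq) simp
    then show ?case
      using n by (simp add: K_eigenvalue_def qq_power_eq_iff)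
  next
    case (step i)
    then have "K_eigenvalue m n s i = K_eigenvalue m n t i" "s (Suc i) = t (Suc i)"
      by (auto intro: eq)
    then show ?case
      using step by (auto simp: K_eigenvalue_def qq_power_eq_iff split: if_splits)
  qed
  moreover have "s i = t i" if "i \<notin> {1..m+n}" for i
    using st that unfolding fock_index_def by simp
  ultimately have "s i = t i" for i
    by (cases "i \<in> {1..m+n}") simp_all
  then show "s = t" by blast
qed

text \<open>The next site is set to \<open>1\<close> rather than increased because it is empty wherever this is used;
  at the last site the quantum leaves the system.\<close>

definition push_quantum :: "nat \<Rightarrow> nat \<Rightarrow> (nat \<Rightarrow> nat) \<Rightarrow> (nat \<Rightarrow> nat)" where
  "push_quantum N p t = (if p < N then t(p := t p - 1, Suc p := 1) else t(p := t p - 1))"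

text \<open>The coefficients are a \<open>q\<close>-number of the occupied site, fermionic signs, and at the last
  node the normalising scalar. On the way back the occupation number at site \<open>p + 1\<close> is \<open>1\<close> and
  \<open>[1] = 1\<close>.\<close>

lemma spinor_op_push_quantum:
  assumes p: "p \<in> {1..m+n}" and n: "1 \<le> n" and t: "t \<in> fock_index m n"
    and top: "t p \<noteq> 0" "t (Suc p) = 0"
  shows "\<exists>c. c \<noteq> 0 \<and> spinor_op m n (uE p) (ket t) = smul c (ket (push_quantum (m + n) p t))"
    and "\<exists>c. c \<noteq> 0 \<and> spinor_op m n (uF p) (ket (push_quantum (m + n) p t)) = smul c (ket t)"
proof -
  have bin: "t (m + j) = 1" if "p = m + j" "j \<in> {1..n}" for j
  proof -
    have "t (m + j) \<in> {0, 1}" using t that(2) unfolding fock_index_def by blast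
    then show ?thesis using top(1) that(1) by simp
  qed
  note op = spinor_op_def push_quantum_def linear_ext_smul
  from n have "(\<exists>c. c \<noteq> 0 \<and> spinor_op m n (uE p) (ket t) =
    smul c (ket (push_quantum (m + n) p t))) \<and>
    (\<exists>c. c \<noteq> 0 \<and> spinor_op m n (uF p) (ket (push_quantum (m + n) p t)) = smul c (ket t))"
  proof (cases rule: node_cases[OF p n])
    case 1
    have upd: "t(Suc p := 1, p := t p - 1) = t(p := t p - 1, Suc p := 1)"
      "t(p := Suc (t p - 1), Suc p := 0) = t"
      using top by (auto simp: fun_eq_iff)
    have "spinor_op m n (uE p) (ket t) = smul (qnum (t p)) (ket (push_quantum (m + n) p t))"
      using 1 top upd(1) by (simp add: op)
    moreover have "spinor_op m n (uF p) (ket (push_quantum (m + n) p t)) = smul 1 (ket t)"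
      using 1 upd(2) by (simp add: op fun_upd_twist[of p "Suc p"])
    ultimately show ?thesis
      using qnum_nonzero[of "t p"] top by (intro conjI; metis neq0_conv zero_neq_one)
  next
    case 2
    have upd: "t(Suc m := 1, m := t m - 1) = t(m := t m - 1, Suc m := 1)"
      "t(m := Suc (t m - 1), Suc m := 0) = t"
      using top 2 by (auto simp: fun_eq_iff)
    let ?T = "push_quantum (m + n) p t"
    have "spinor_op m n (uE p) (ket t) = smul (fermion_sign m 1 t * qnum (t p)) (ket ?T)"
      using 2 n top upd(1) by (simp add: op)
    moreover have "spinor_op m n (uF p) (ket ?T) = smul (fermion_sign m 1 ?T) (ket t)"
      using 2 n upd(2) by (simp add: op fun_upd_twist[of m "Suc m"])
    moreover have "fermion_sign m 1 t * qnum (t p) \<noteq> 0"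
      using qnum_nonzero[of "t p"] top by simp
    ultimately show ?thesis
      using fermion_sign_nonzero by blast
  next
    case (3 j)
    \<comment> \<open>A fermionic site that is occupied holds exactly one quantum.\<close>
    have tj: "t (m + j) = Suc 0" using bin[of j] 3 by simp
    let ?T = "t(m + j := 0, Suc (m + j) := Suc 0)"
    have upd: "t(Suc (m + j) := Suc 0, m + j := 0) = ?T" "t(m + j := Suc 0, Suc (m + j) := 0) = t"
      using top 3 tj by (auto simp: fun_eq_iff)
    have T: "push_quantum (m + n) p t = ?T"
      using 3 tj by (simp add: push_quantum_def)
    have "spinor_op m n (uE p) (ket t) =
        smul (fermion_sign m (Suc j) t * fermion_sign m j (t(Suc (m + j) := Suc 0))) (ket ?T)"
      using 3 top tj upd(1) by (simp add: op)
    moreover have "spinor_op m n (uF p) (ket ?T) =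
        smul (fermion_sign m j ?T * fermion_sign m (Suc j) (?T(m + j := Suc 0))) (ket t)"
      using 3 upd(2) by (simp add: op fun_upd_twist[of "m + j" "Suc (m + j)"])
    moreover have "fermion_sign m (Suc j) t * fermion_sign m j (t(Suc (m + j) := Suc 0)) \<noteq> 0"
      "fermion_sign m j ?T * fermion_sign m (Suc j) (?T(m + j := Suc 0)) \<noteq> 0"
      by simp_all
    ultimately show ?thesis
      unfolding T by blast
  next
    case 4
    have tn: "t (m + n) = Suc 0" using bin[of n] 4 n by simp
    let ?T = "t(m + n := 0)"
    have T: "push_quantum (m + n) p t = ?T" and upd: "t(m + n := Suc 0) = t"
      using 4 tn by (auto simp: push_quantum_def fun_eq_iff)
    have "spinor_op m n (uE p) (ket t) =
        smul (sqrt_neg1 * inverse (qhalf - inverse qhalf) * fermion_sign m n t) (ket ?T)"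
      using 4 n tn by (simp add: op)
    moreover have "spinor_op m n (uF p) (ket ?T) = smul (fermion_sign m n ?T) (ket t)"
      using 4 n upd by (simp add: op)
    moreover have "sqrt_neg1 * inverse (qhalf - inverse qhalf) * fermion_sign m n t \<noteq> 0"
      using qhalf_diff_nonzero by simp
    ultimately show ?thesis
      unfolding T using fermion_sign_nonzero by blast
  qed
  then show "\<exists>c. c \<noteq> 0 \<and> spinor_op m n (uE p) (ket t) = smul c (ket (push_quantum (m + n) p t))"
    "\<exists>c. c \<noteq> 0 \<and> spinor_op m n (uF p) (ket (push_quantum (m + n) p t)) = smul c (ket t)"
    by auto
qed

lemma push_quantum_fock_index:
  assumes "p \<in> {1..m+n}" "t \<in> fock_index m n"
  shows "push_quantum (m + n) p t \<in> fock_index m n"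
proof -
  have "push_quantum (m + n) p t i = 0" if "i \<notin> {1..m+n}" for i
  proof -
    have "t i = 0" using assms(2) that unfolding fock_index_def by simp
    then show ?thesis using assms(1) that by (auto simp: push_quantum_def)
  qed
  moreover have "push_quantum (m + n) p t (m + j) \<in> {0, 1}" if "j \<in> {1..n}" for j
  proof -
    have "t (m + j) = 0 \<or> t (m + j) = 1" using assms(2) that unfolding fock_index_def by simp
    then show ?thesis by (auto simp: push_quantum_def)
  qed
  ultimately show ?thesis unfolding fock_index_def by blast
qed

text \<open>The total number of steps that the quanta have to make until all of them have left the
  system; it is the measure for both inductions below.\<close>

definition depth :: "nat \<Rightarrow> (nat \<Rightarrow> nat) \<Rightarrow> nat" where
  "depth N t = (\<Sum>i = 1..N. t i * (Suc N - i))"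

lemma depth_upd:
  assumes "p \<in> {1..N}"
  shows "depth N (t(p := x)) + t p * (Suc N - p) = depth N t + x * (Suc N - p)"
proof -
  have "depth N s = s p * (Suc N - p) + (\<Sum>i\<in>{1..N} - {p}. s i * (Suc N - i))" for s
    unfolding depth_def using assms by (simp add: sum.remove[of _ p])
  from this[of t] this[of "t(p := x)"] show ?thesis by simp
qed

lemma depth_push_quantum:
  assumes p: "p \<in> {1..N}" and top: "t p \<noteq> 0" "t (Suc p) = 0"
  shows "depth N (push_quantum N p t) < depth N t"
proof -
  obtain x where x: "t p = Suc x" using top(1) not0_implies_Suc by blast
  have 1: "depth N (t(p := x)) + (Suc N - p) = depth N t"
    using depth_upd[OF p, of t x] x by simp
  show ?thesis
  proof (cases "p < N")
    case True
    have "depth N (t(p := x, Suc p := 1)) = depth N (t(p := x)) + (N - p)"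
      using depth_upd[of "Suc p" N "t(p := x)" 1] True top(2) by simp
    then show ?thesis using 1 True x by (simp add: push_quantum_def)
  next
    case False
    then show ?thesis using 1 p x by (simp add: push_quantum_def)
  qed
qed

lemma topmost_site:
  assumes "t \<in> fock_index m n" "t \<noteq> (\<lambda>_. 0)"
  obtains p where "p \<in> {1..m+n}" "t p \<noteq> 0" "t (Suc p) = 0"
proof -
  let ?S = "{i. t i \<noteq> 0}"
  have "\<forall>i. i \<notin> {1..m+n} \<longrightarrow> t i = 0" using assms(1) by (simp add: fock_index_def)
  then have S: "?S \<subseteq> {1..m+n}" by (metis (mono_tags) mem_Collect_eq subsetI)
  then have fin: "finite ?S" by (rule finite_subset) simp
  have "?S \<noteq> {}" using assms(2) by (auto simp: fun_eq_iff)
  with fin have "Max ?S \<in> ?S" by (rule Max_in)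
  moreover have "Suc (Max ?S) \<notin> ?S"
    using Max_ge[OF fin, of "Suc (Max ?S)"] by linarith
  ultimately show ?thesis
    using that[OF subsetD[OF S]] by blast
qed

locale spinor_submodule = linear_subspace W for W :: "((nat \<Rightarrow> nat) \<Rightarrow>\<^sub>0 Cq) set" +
  fixes m n :: nat
  assumes n: "1 \<le> n" and W_Fock: "W \<subseteq> Fock m n"
    and op_mem: "g \<in> uq_gens m n \<Longrightarrow> w \<in> W \<Longrightarrow> spinor_op m n (gen g) w \<in> W"
begin

lemma ket_of_scaled: "smul c (ket t) \<in> W \<Longrightarrow> c \<noteq> 0 \<Longrightarrow> ket t \<in> W"
  using smul_mem[of "smul c (ket t)" "inverse c"] by simp

text \<open>A nonzero vector with the least number of terms has a single term: if it had two, some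
  \<open>k\<^sub>i\<close> would have different eigenvalues on them, and \<open>k\<^sub>i w - \<kappa> w\<close> would be a shorter nonzero
  vector.\<close>

lemma contains_ket:
  assumes "W \<noteq> {0}"
  obtains t where "t \<in> fock_index m n" "ket t \<in> W"
proof -
  have "\<exists>w. w \<in> W \<and> w \<noteq> 0" using assms zero_mem by blast
  then obtain w where w: "w \<in> W" "w \<noteq> 0"
    and least: "\<And>v. v \<in> W \<Longrightarrow> v \<noteq> 0 \<Longrightarrow> card (Poly_Mapping.keys w) \<le> card (Poly_Mapping.keys v)"
    using ex_has_least_nat[of "\<lambda>w. w \<in> W \<and> w \<noteq> 0" _ "\<lambda>w. card (Poly_Mapping.keys w)"] by blast
  obtain t where t: "t \<in> Poly_Mapping.keys w"
    using w(2) by (metis keys_eq_empty ex_in_conv)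
  have index: "Poly_Mapping.keys w \<subseteq> fock_index m n"
    using w(1) W_Fock by (auto simp: Fock_def)
  have "s = t" if s: "s \<in> Poly_Mapping.keys w" for s
  proof (rule ccontr)
    assume "s \<noteq> t"
    then obtain i where i: "i \<in> {1..m+n}" "K_eigenvalue m n s i \<noteq> K_eigenvalue m n t i"
      using K_eigenvalues_separate[OF n] s t index by blast
    let ?v = "spinor_op m n (uK i) w - smul (K_eigenvalue m n t i) w"
    have "w \<in> Fock m n" using w(1) W_Fock by blast
    from lookup_spinor_op_K[OF i(1) n this]
    have lookup: "Poly_Mapping.lookup ?v r =
        (K_eigenvalue m n r i - K_eigenvalue m n t i) * Poly_Mapping.lookup w r" for r
      by (simp add: lookup_minus left_diff_distrib)
    have "?v \<in> W"
      using i(1) w(1) by (intro diff_mem op_mem smul_mem) auto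
    moreover have "s \<in> Poly_Mapping.keys ?v"
      using s i(2) by (simp add: in_keys_iff lookup)
    then have "?v \<noteq> 0" by auto
    moreover have "Poly_Mapping.keys ?v \<subseteq> Poly_Mapping.keys w - {t}"
      by (auto simp: in_keys_iff lookup)
    then have "card (Poly_Mapping.keys ?v) < card (Poly_Mapping.keys w)"
      using t by (intro psubset_card_mono) auto
    ultimately show False using least by fastforce
  qed
  then have "Poly_Mapping.keys w = {t}" using t by blast
  then have "w = Poly_Mapping.single t (Poly_Mapping.lookup w t)"
    using sum_single_lookup[of w] by simp
  then have "smul (Poly_Mapping.lookup w t) (ket t) \<in> W"
    using w(1) by (simp flip: single_conv_ket)
  moreover have "Poly_Mapping.lookup w t \<noteq> 0"
    using t by (simp add: in_keys_iff)
  ultimately have "ket t \<in> W" by (rule ket_of_scaled)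
  with that t index show ?thesis by blast
qed

lemma vacuum_of_ket:
  assumes "t \<in> fock_index m n" "ket t \<in> W"
  shows "vacuum \<in> W"
  using assms
proof (induction "depth (m + n) t" arbitrary: t rule: less_induct)
  case less
  show ?case
  proof (cases "t = (\<lambda>_. 0)")
    case True
    then show ?thesis using less by (simp add: vacuum_def)
  next
    case False
    then obtain p where p: "p \<in> {1..m+n}" "t p \<noteq> 0" "t (Suc p) = 0"
      using topmost_site less.prems(1) by blast
    obtain c where "c \<noteq> 0" "spinor_op m n (uE p) (ket t) = smul c (ket (push_quantum (m + n) p t))"
      using spinor_op_push_quantum(1)[OF p(1) n less.prems(1) p(2,3)] by blast
    moreover have "spinor_op m n (uE p) (ket t) \<in> W"
      using p(1) less.prems(2) by (intro op_mem) auto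
    ultimately have "ket (push_quantum (m + n) p t) \<in> W"
      using ket_of_scaled by simp
    then show ?thesis
      using less.hyps[OF depth_push_quantum[OF p] push_quantum_fock_index[OF p(1) less.prems(1)]]
        by blast
  qed
qed

lemma ket_of_vacuum:
  assumes "vacuum \<in> W" "t \<in> fock_index m n"
  shows "ket t \<in> W"
  using assms(2)
proof (induction "depth (m + n) t" arbitrary: t rule: less_induct)
  case less
  show ?case
  proof (cases "t = (\<lambda>_. 0)")
    case True
    then show ?thesis using assms(1) by (simp add: vacuum_def)
  next
    case False
    then obtain p where p: "p \<in> {1..m+n}" "t p \<noteq> 0" "t (Suc p) = 0"
      using topmost_site less.prems by blast
    obtain c where "c \<noteq> 0" "spinor_op m n (uF p) (ket (push_quantum (m + n) p t)) = smul c (ket t)"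
      using spinor_op_push_quantum(2)[OF p(1) n less.prems p(2,3)] by blast
    moreover have "ket (push_quantum (m + n) p t) \<in> W"
      by (rule less.hyps[OF depth_push_quantum[OF p] push_quantum_fock_index[OF p(1) less.prems]])
    then have "spinor_op m n (uF p) (ket (push_quantum (m + n) p t)) \<in> W"
      using p(1) by (intro op_mem) auto
    ultimately show ?thesis
      using ket_of_scaled by simp
  qed
qed

lemma zero_or_everything: "W = {0} \<or> W = Fock m n"
proof (cases "W = {0}")
  case False
  then obtain t where "t \<in> fock_index m n" "ket t \<in> W" by (rule contains_ket)
  then have ket: "ket s \<in> W" if "s \<in> fock_index m n" for s
    using vacuum_of_ket ket_of_vacuum that by blast
  have "v \<in> W" if "v \<in> Fock m n" for v
    using that by (induction rule: Fock_induct) (auto intro: zero_mem add_mem smul_mem ket)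
  then show ?thesis using W_Fock by blast
qed simp

end

lemma Fock_irreducible:
  assumes "1 \<le> m" "1 \<le> n"
  shows "irreducible_module (Uq_osp m n) (Fock m n) (spinor_action m n)"
  unfolding irreducible_module_def
proof (intro conjI allI impI)
  show "is_alg_module (Uq_osp m n) (Fock m n) (spinor_action m n)"
    using assms by (rule Fock_is_alg_module)
  have "vacuum \<noteq> 0" by (simp add: vacuum_def)
  then show "Fock m n \<noteq> {0}" using vacuum_in_Fock by blast
  fix W assume W: "W \<subseteq> Fock m n" "is_alg_module (Uq_osp m n) W (spinor_action m n)"
  have act: "spinor_action m n X w \<in> W" if "X \<in> carrier (Uq_osp m n)" "w \<in> W" for X w
    using W(2) that unfolding is_alg_module_def by blast
  have W_closed: "0 \<in> W" "\<forall>v\<in>W. \<forall>w\<in>W. v + w \<in> W" "\<forall>c. \<forall>v\<in>W. smul c v \<in> W"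
    using W(2) by (simp_all add: is_alg_module_def)
  interpret spinor_submodule W m n
  proof
    show "0 \<in> W" by (rule W_closed(1))
    show "v + w \<in> W" if "v \<in> W" "w \<in> W" for v w
      by (rule bspec[OF bspec[OF W_closed(2) that(1)] that(2)])
    show "smul c v \<in> W" if "v \<in> W" for v c
      by (rule bspec[OF spec[OF W_closed(3)] that])
    fix g w assume g: "g \<in> uq_gens m n" and w: "w \<in> W"
    have "uq_class m n (gen g) \<in> carrier (Uq_osp m n)"
      unfolding carrier_Uq_osp[OF assms] using g by (intro imageI) (simp only: gen_in_free_algebra)
    from act[OF this w] show "spinor_op m n (gen g) w \<in> W"
      using spinor_action_uq_class[OF assms, of w] w W(1) by auto
  qed (use assms W in auto)
  show "W = {0} \<or> W = Fock m n" by (rule zero_or_everything)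
qed

lemma vacuum_highest_weight:
  assumes "1 \<le> m" "1 \<le> n"
  shows "highest_weight_vector m n (Fock m n) (spinor_action m n) vacuum
    (replicate (m - 1) (-1) @ replicate n 1 @ [sqrt_neg1 * qhalf])"
  unfolding highest_weight_vector_def
proof (intro conjI ballI)
  let ?wt = "replicate (m - 1) (-1) @ replicate n 1 @ [sqrt_neg1 * qhalf]"
  show "length ?wt = m + n" using assms by simp
  show "vacuum \<in> Fock m n" by (rule vacuum_in_Fock)
  show "(vacuum :: (nat \<Rightarrow> nat) \<Rightarrow>\<^sub>0 Cq) \<noteq> 0" by (simp add: vacuum_def)
  fix i assume i: "i \<in> {1..m+n}"
  note act = spinor_action_uq_class[OF assms vacuum_in_Fock]
  have "spinor_op m n (uE i) vacuum = 0"
    using assms by (cases rule: node_cases[OF i assms(2)])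
      (simp_all add: spinor_op_def vacuum_def linear_ext_smul)
  then show "spinor_action m n (uq_class m n (uE i)) vacuum = 0"
    by (simp add: act)
  have "?wt ! (i - 1) = K_eigenvalue m n (\<lambda>_. 0) i"
    using assms i by (auto simp: nth_append K_eigenvalue_def)
  then show "spinor_action m n (uq_class m n (uK i)) vacuum = smul (?wt ! (i - 1)) vacuum"
    unfolding act by (simp add: vacuum_def spinor_op_K_ket[OF i assms(2)])
qed

theorem proposition3p3:
  fixes m n :: nat
  assumes "m \<ge> 1" and "n \<ge> 1"
  shows "irreducible_module (Uq_osp m n) (Fock m n) (spinor_action m n) \<and>
         highest_weight_vector m n (Fock m n) (spinor_action m n) vacuum
           (replicate (m - 1) (-1) @ replicate n 1 @ [sqrt_neg1 * qhalf])"
  using Fock_irreducible[OF assms] vacuum_highest_weight[OF assms] ..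

end
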